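(* Let $k$ be an algebraically closed field and let $I\subset R=k[x,y,z]$ be a linearly presented codimension $2$ perfect ideal minimally generated by $n$ monomials of degree $n-1$, such that $R/I$ has exactly two minimal primes. Suppose that the basic entry sequence $c_1\,c_2\,\dots\,c_{n-1}$ of $I$ is a separating sequence of $x$ and $y$, i.e. of the shape $x\,x\,\dots\,x\,y\,y\,\dots\,y$. Then: (a) The special fiber of $I$ is Cohen--Macaulay. (b) The Rees algebra of $I$ is Cohen--Macaulay and of fiber type.
   Context: Linearly presented means that the $n\times(n-1)$ minimal syzygy (Hilbert--Burch) matrix of $I$ has linear entries. Two $n\times(n-1)$ linear matrices over $R$ are conjugate if one is obtained from the other by a $k$-linear change of variables in $R$ together with invertible row and column operations over $k$. Under the stated hypotheses on $I$ the syzygy matrix of $I$ is, up to conjugation, the $n\times(n-1)$ matrix $\varphi$ with $\varphi_{i,i}=z$ and $\varphi_{i+1,i}=-c_i$ for $1\le i\le n-1$, where $c_i\in\{x,y\}$, and all other entries zero. The sequence $c_1\,c_2\,\dots\,c_{n-1}$ is called the basic entry sequence of $I$. The Rees algebra is $\mathcal R_R(I)=R[IT]\subset R[T]$ and the special fiber is $\mathcal F(I)=\mathcal R_R(I)/(x,y,z)\mathcal R_R(I)$. Let $f_1,\dots,f_n$ be minimal generators of $I$ with syzygy matrix $\varphi$, let $\mathcal J$ be the kernel of $R[t_1,\dots,t_n]\to R[IT]$, $t_i\mapsto f_iT$, and let $Q$ be the kernel of $k[t_1,\dots,t_n]\to k[f_1,\dots,f_n]$, $t_i\mapsto f_i$.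 The Rees algebra is of fiber type if $\mathcal J=(I_1((t_1\cdots t_n)\cdot\varphi),Q)$, where $I_1((t_1\cdots t_n)\cdot\varphi)$ is the ideal generated by the entries of the product. *)

theory Defs
  imports
    "HOL-Algebra.Algebraic_Closure_Type"
    "HOL-Algebra.Ring_Divisibility"
    "HOL-Algebra.Generated_Rings"
    "HOL-Algebra.QuotRing"
    "HOL-Library.Poly_Mapping"
    "HOL-Library.Extended_Nat"
    "Jordan_Normal_Form.Matrix"
begin

section \<open>Multivariate polynomials\<close>

type_synonym ('v, 'a) mpoly = "('v \<Rightarrow>\<^sub>0 nat) \<Rightarrow>\<^sub>0 'a"

definition Const :: "'a::zero \<Rightarrow> ('v, 'a) mpoly" where
  "Const a = Poly_Mapping.single 0 a"

definition Var :: "'v \<Rightarrow> ('v, 'a::zero_neq_one) mpoly" where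
  "Var v = Poly_Mapping.single (Poly_Mapping.single v 1) 1"

text \<open>Evaluation at the point \<open>g\<close>, the coefficients being mapped by \<open>h\<close>.\<close>

definition mpoly_eval ::
  "('a::zero \<Rightarrow> 'b::comm_semiring_1) \<Rightarrow> ('v \<Rightarrow> 'b) \<Rightarrow> ('v, 'a) mpoly \<Rightarrow> 'b" where
  "mpoly_eval h g p =
     (\<Sum>m\<in>Poly_Mapping.keys p. h (Poly_Mapping.lookup p m) * (\<Prod>v\<in>Poly_Mapping.keys m. g v ^ Poly_Mapping.lookup m v))"

definition mdeg :: "('v \<Rightarrow>\<^sub>0 nat) \<Rightarrow> nat" where
  "mdeg m = (\<Sum>v\<in>Poly_Mapping.keys m. Poly_Mapping.lookup m v)"

definition homogeneous :: "nat \<Rightarrow> ('v, 'a::zero) mpoly \<Rightarrow> bool" where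
  "homogeneous d p \<longleftrightarrow> (\<forall>m\<in>Poly_Mapping.keys p. mdeg m = d)"

text \<open>The ring \<open>A[t\<^sub>0, \<dots>, t\<^sub>n\<^sub>-\<^sub>1]\<close>, as a subring of the polynomials in countably
  many variables. All indices below start at \<open>0\<close>.\<close>

definition mpoly_ring :: "nat \<Rightarrow> (nat, 'a::comm_ring_1) mpoly ring" where
  "mpoly_ring n = ring_of_type_algebra \<lparr>carrier := {p. \<forall>m\<in>Poly_Mapping.keys p. Poly_Mapping.keys m \<subseteq> {..<n}}\<rparr>"

text \<open>The ring \<open>R = k[x, y, z]\<close> is the type \<open>(xyz, 'k) mpoly\<close>.\<close>

datatype xyz = vx | vy | vz


section \<open>Height, grade and the Cohen--Macaulay property\<close>

definition prime_height :: "('a, 'b) ring_scheme \<Rightarrow> 'a set \<Rightarrow> enat" where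
  "prime_height A P = (SUP h \<in> {h. \<exists>C :: nat \<Rightarrow> 'a set.
     (\<forall>i\<le>h. primeideal (C i) A) \<and> (\<forall>i<h. C i \<subset> C (Suc i)) \<and> C h = P}. enat h)"

definition ideal_height :: "('a, 'b) ring_scheme \<Rightarrow> 'a set \<Rightarrow> enat" where
  "ideal_height A J = (INF P \<in> {P. primeideal P A \<and> J \<subseteq> P}. prime_height A P)"

definition regular_sequence :: "('a, 'b) ring_scheme \<Rightarrow> 'a list \<Rightarrow> bool" where
  "regular_sequence A xs \<longleftrightarrow>
     set xs \<subseteq> carrier A \<and>
     (\<forall>i<length xs. \<forall>r\<in>carrier A.
        xs ! i \<otimes>\<^bsub>A\<^esub> r \<in> Idl\<^bsub>A\<^esub> (set (take i xs)) \<longrightarrow> r \<in> Idl\<^bsub>A\<^esub> (set (take i xs))) \<and>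
     Idl\<^bsub>A\<^esub> (set xs) \<noteq> carrier A"

definition grade :: "('a, 'b) ring_scheme \<Rightarrow> 'a set \<Rightarrow> enat" where
  "grade A J = (SUP xs \<in> {xs. regular_sequence A xs \<and> set xs \<subseteq> J}. enat (length xs))"

text \<open>This is the definition in Section 18.2 of Eisenbud's \<^emph>\<open>Commutative Algebra\<close>:
  \<open>depth(P, A) = codim P\<close> for every maximal ideal \<open>P\<close>. For Noetherian rings it says that
  all localizations at maximal ideals are Cohen--Macaulay local rings.\<close>

definition Cohen_Macaulay :: "('a, 'b) ring_scheme \<Rightarrow> bool" where
  "Cohen_Macaulay A \<longleftrightarrow> cring A \<and> noetherian_ring A \<and>
     (\<forall>P. maximalideal P A \<longrightarrow> grade A P = prime_height A P)"

definition minimal_primes :: "('a, 'b) ring_scheme \<Rightarrow> 'a set set" where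
  "minimal_primes A = {P. primeideal P A \<and> (\<forall>P'. primeideal P' A \<and> P' \<subseteq> P \<longrightarrow> P' = P)}"


section \<open>Perfect ideals\<close>

definition projective_summand :: "nat \<Rightarrow> 'r::comm_ring_1 vec set \<Rightarrow> bool" where
  "projective_summand b P \<longleftrightarrow>
     submodule P ring_of_type_algebra (module_vec TYPE('r) b) \<and>
     (\<exists>Q. submodule Q ring_of_type_algebra (module_vec TYPE('r) b) \<and>
          P \<inter> Q = {0\<^sub>v b} \<and> (\<forall>v\<in>carrier_vec b. \<exists>p\<in>P. \<exists>q\<in>Q. v = p + q))"

text \<open>A resolution \<open>0 \<rightarrow> P\<^sub>d \<rightarrow> \<dots> \<rightarrow> P\<^sub>0 \<rightarrow> R/I \<rightarrow> 0\<close> by finitely generated projective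
  modules, each given as a direct summand of some \<open>R\<^sup>b\<close>, with differentials
  \<open>\<delta>\<^sub>i : P\<^sub>i \<rightarrow> P\<^sub>i\<^sub>-\<^sub>1\<close>. The augmentation \<open>P\<^sub>0 \<rightarrow> R/I\<close> is given by a lift
  \<open>\<epsilon> : P\<^sub>0 \<rightarrow> R\<close>, which exists because \<open>P\<^sub>0\<close> is projective. Over a Noetherian ring \<open>R\<close>,
  finitely generated projectives suffice to compute the projective dimension of \<open>R/I\<close>.\<close>

definition has_projective_resolution :: "'r::comm_ring_1 set \<Rightarrow> nat \<Rightarrow> bool" where
  "has_projective_resolution I d \<longleftrightarrow>
     (\<exists>(b :: nat \<Rightarrow> nat) (P :: nat \<Rightarrow> 'r vec set)
        (\<delta> :: nat \<Rightarrow> 'r vec \<Rightarrow> 'r vec) (\<epsilon> :: 'r vec \<Rightarrow> 'r).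
        let ker = (\<lambda>i. if i = 0 then {v \<in> P 0. \<epsilon> v \<in> I}
                       else {v \<in> P i. \<delta> i v = 0\<^sub>v (b (i - 1))})
        in (\<forall>i\<le>d. projective_summand (b i) (P i)) \<and>
           (\<forall>u\<in>P 0. \<forall>v\<in>P 0. \<epsilon> (u + v) = \<epsilon> u + \<epsilon> v) \<and>
           (\<forall>a. \<forall>v\<in>P 0. \<epsilon> (a \<cdot>\<^sub>v v) = a * \<epsilon> v) \<and>
           (\<forall>i\<in>{1..d}. \<forall>u\<in>P i. \<forall>v\<in>P i. \<delta> i (u + v) = \<delta> i u + \<delta> i v) \<and>
           (\<forall>i\<in>{1..d}. \<forall>a. \<forall>v\<in>P i. \<delta> i (a \<cdot>\<^sub>v v) = a \<cdot>\<^sub>v \<delta> i v) \<and>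
           (\<forall>r. \<exists>v\<in>P 0. \<epsilon> v - r \<in> I) \<and>
           (\<forall>i<d. \<delta> (Suc i) ` P (Suc i) = ker i) \<and>
           ker d = {0\<^sub>v (b d)})"

text \<open>The projective dimension of the module \<open>R/I\<close>.\<close>

definition projective_dim_quot :: "'r::comm_ring_1 set \<Rightarrow> enat" where
  "projective_dim_quot I = (INF d \<in> {d. has_projective_resolution I d}. enat d)"

definition perfect_ideal :: "'r::comm_ring_1 set \<Rightarrow> bool" where
  "perfect_ideal I \<longleftrightarrow> ideal I ring_of_type_algebra \<and> I \<noteq> UNIV \<and>
     projective_dim_quot I = grade ring_of_type_algebra I"


section \<open>Minimal generators and syzygies\<close>

text \<open>Minimal generators are homogeneous, as is the convention in the graded setting.\<close>

definition minimal_generators ::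
  "('v, 'k::field) mpoly set \<Rightarrow> ('v, 'k) mpoly vec \<Rightarrow> bool" where
  "minimal_generators I f \<longleftrightarrow>
     (\<forall>i<dim_vec f. \<exists>d. homogeneous d (f $ i)) \<and>
     Idl\<^bsub>ring_of_type_algebra\<^esub> {f $ i | i. i < dim_vec f} = I \<and>
     (\<forall>j<dim_vec f. f $ j \<notin> Idl\<^bsub>ring_of_type_algebra\<^esub> {f $ i | i. i < dim_vec f \<and> i \<noteq> j})"

text \<open>The columns of the \<open>n \<times> (n - 1)\<close> matrix \<open>\<phi>\<close> minimally generate the syzygies of \<open>f\<close>.\<close>

definition syzygy_matrix :: "'r::comm_ring_1 vec \<Rightarrow> 'r mat \<Rightarrow> bool" where
  "syzygy_matrix f \<phi> \<longleftrightarrow>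
     \<phi> \<in> carrier_mat (dim_vec f) (dim_vec f - 1) \<and>
     {\<phi> *\<^sub>v w | w. w \<in> carrier_vec (dim_col \<phi>)} = {v \<in> carrier_vec (dim_vec f). f \<bullet> v = 0} \<and>
     (\<forall>j<dim_col \<phi>. \<not> (\<exists>w\<in>carrier_vec (dim_col \<phi>). w $ j = 0 \<and> \<phi> *\<^sub>v w = col \<phi> j))"

definition linear_mat :: "('v, 'k::field) mpoly mat \<Rightarrow> bool" where
  "linear_mat \<phi> \<longleftrightarrow> (\<forall>i<dim_row \<phi>. \<forall>j<dim_col \<phi>. homogeneous 1 (\<phi> $$ (i, j)))"

definition linearly_presented :: "('v, 'k::field) mpoly set \<Rightarrow> bool" where
  "linearly_presented I \<longleftrightarrow>
     (\<exists>f \<phi>. minimal_generators I f \<and> syzygy_matrix f \<phi> \<and> linear_mat \<phi>)"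

definition minimally_generated_by_monomials ::
  "('v, 'k::field) mpoly set \<Rightarrow> nat \<Rightarrow> nat \<Rightarrow> bool" where
  "minimally_generated_by_monomials I n d \<longleftrightarrow>
     (\<exists>f. minimal_generators I f \<and> dim_vec f = n \<and>
          (\<forall>i<n. \<exists>m. mdeg m = d \<and> f $ i = Poly_Mapping.single m 1))"


section \<open>The basic entry sequence\<close>

definition linear_change_of_variables ::
  "(('v, 'k::field) mpoly \<Rightarrow> ('v, 'k) mpoly) \<Rightarrow> bool" where
  "linear_change_of_variables \<sigma> \<longleftrightarrow>
     (\<exists>l. (\<forall>v. homogeneous 1 (l v)) \<and> \<sigma> = mpoly_eval Const l) \<and> bij \<sigma>"

definition conjugate_matrices ::
  "('v, 'k::field) mpoly mat \<Rightarrow> ('v, 'k) mpoly mat \<Rightarrow> bool" where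
  "conjugate_matrices \<phi> \<psi> \<longleftrightarrow>
     (\<exists>\<sigma> A B. linear_change_of_variables \<sigma> \<and>
        A \<in> carrier_mat (dim_row \<phi>) (dim_row \<phi>) \<and> invertible_mat A \<and>
        B \<in> carrier_mat (dim_col \<phi>) (dim_col \<phi>) \<and> invertible_mat B \<and>
        \<psi> = map_mat Const A * map_mat \<sigma> \<phi> * map_mat Const B)"

definition basic_matrix :: "xyz list \<Rightarrow> (xyz, 'k::field) mpoly mat" where
  "basic_matrix c = mat (Suc (length c)) (length c)
     (\<lambda>(i, j). if i = j then Var vz else if i = Suc j then - Var (c ! j) else 0)"

definition basic_entry_sequence :: "(xyz, 'k::field) mpoly set \<Rightarrow> xyz list \<Rightarrow> bool" where
  "basic_entry_sequence I c \<longleftrightarrow> set c \<subseteq> {vx, vy} \<and>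
     (\<exists>f \<phi>. minimal_generators I f \<and> dim_vec f = Suc (length c) \<and>
            syzygy_matrix f \<phi> \<and> linear_mat \<phi> \<and> conjugate_matrices \<phi> (basic_matrix c))"

definition separating :: "xyz list \<Rightarrow> bool" where
  "separating c \<longleftrightarrow> (\<exists>a b. a \<ge> 1 \<and> b \<ge> 1 \<and> c = replicate a vx @ replicate b vy)"


section \<open>Rees algebra and special fiber\<close>

text \<open>The subring \<open>R[IT]\<close> of \<open>R[T]\<close>.\<close>

definition rees_algebra :: "'r::comm_ring_1 set \<Rightarrow> 'r poly ring" where
  "rees_algebra I = ring_of_type_algebra
     \<lparr>carrier := generate_ring ring_of_type_algebra
        (range (\<lambda>r. [:r:]) \<union> {monom a 1 | a. a \<in> I})\<rparr>"

definition special_fiber :: "(xyz, 'k::field) mpoly set \<Rightarrow> (xyz, 'k) mpoly poly set ring" where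
  "special_fiber I = rees_algebra I Quot
     (Idl\<^bsub>rees_algebra I\<^esub> {[:Var vx:], [:Var vy:], [:Var vz:]})"

text \<open>The kernel \<open>\<J>\<close> of \<open>R[t\<^sub>0, \<dots>, t\<^sub>n\<^sub>-\<^sub>1] \<rightarrow> R[T]\<close>, \<open>t\<^sub>i \<mapsto> f\<^sub>i T\<close>.\<close>

definition rees_ideal :: "'r::comm_ring_1 vec \<Rightarrow> (nat, 'r) mpoly set" where
  "rees_ideal f = {p \<in> carrier (mpoly_ring (dim_vec f)).
     mpoly_eval (\<lambda>r. [:r:]) (\<lambda>i. monom (f $ i) 1) p = 0}"

text \<open>The kernel \<open>Q\<close> of \<open>k[t\<^sub>0, \<dots>, t\<^sub>n\<^sub>-\<^sub>1] \<rightarrow> k[f\<^sub>0, \<dots>, f\<^sub>n\<^sub>-\<^sub>1]\<close>, \<open>t\<^sub>i \<mapsto> f\<^sub>i\<close>.\<close>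

definition fiber_ideal :: "('v, 'k::field) mpoly vec \<Rightarrow> (nat, 'k) mpoly set" where
  "fiber_ideal f = {q \<in> carrier (mpoly_ring (dim_vec f)). mpoly_eval Const (\<lambda>i. f $ i) q = 0}"

text \<open>Here \<open>Poly_Mapping.map Const\<close> is the inclusion of \<open>k[t]\<close> in \<open>R[t]\<close>.\<close>

definition fiber_type :: "('v, 'k::field) mpoly set \<Rightarrow> bool" where
  "fiber_type I \<longleftrightarrow>
     (\<forall>f \<phi>. minimal_generators I f \<and> syzygy_matrix f \<phi> \<longrightarrow>
        rees_ideal f = Idl\<^bsub>mpoly_ring (dim_vec f)\<^esub>
          ({(\<Sum>i<dim_vec f. Var i * Const (\<phi> $$ (i, j))) | j. j < dim_col \<phi>} \<union>
           Poly_Mapping.map Const ` fiber_ideal f))"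

end

theory Submission
  imports Defs "HOL-Library.Product_Plus" "Jordan_Normal_Form.Char_Poly"
begin

text \<open>After a linear change of variables, \<open>I\<close> is generated by \<open>t\<^sub>i = z\<^sup>i x\<^bsup>a-i\<^esup> y\<^sup>b\<close> for \<open>i \<le> a\<close> and
  \<open>t\<^bsub>a+j\<^esub> = z\<^bsup>a+j\<^esup> y\<^bsup>b-j\<^esup>\<close> for \<open>j \<le> b\<close>. The Rees algebra is then a monoid algebra, free over
  \<open>k[z, t\<^sub>0]\<close> on the products of a power of \<open>x\<close> or a monomial \<open>t\<^sub>i t\<^sub>a\<^sup>g\<close> (\<open>1 \<le> i \<le> a\<close>) with a power of \<open>y\<close> or
  a monomial \<open>t\<^bsub>a+j\<^esub> t\<^bsub>a+b\<^esub>\<^sup>g\<close> (\<open>1 \<le> j \<le> b\<close>). Hence \<open>z - \<alpha>\<close>, \<open>t\<^sub>0 - \<beta>\<close>, \<open>x - t\<^sub>a - \<gamma>\<close>, \<open>y - t\<^bsub>a+b\<^esub> - \<delta>\<close> is a regular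
  sequence for all constants. By the Nullstellensatz some choice of the constants puts it into a given
  maximal ideal, whose depth is therefore the dimension \<open>4\<close>. The special fiber is the part spanned by
  the monomials in the \<open>t\<^sub>i\<close> alone, and the same argument applies with \<open>t\<^sub>0\<close>, \<open>t\<^sub>a\<close>, \<open>t\<^bsub>a+b\<^esub>\<close>. For the fiber
  type, the syzygies and the quadratic relations \<open>t\<^sub>i t\<^sub>j = t\<^sub>k t\<^sub>l\<close> within a block straighten every monomial
  to one of the basis above, and those are linearly independent.\<close>

section \<open>Subrings and ideals inside a ring type\<close>

text \<open>The Cohen--Macaulay property concerns every maximal ideal, not only the graded one,
  which is why the parameters are translated by arbitrary constants. The last two parameters of the
  Rees algebra are differences because of the relations x t_i = z t_{i-1}: modulo z both x and t_a
  are zero divisors. On the basis of the first block, indexed by the integers, x raises the index by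
  1 and t_a lowers it by a. Each does so up to a monomial factor that is trivial only on its own
  half-line, but in a finite combination either the largest index is raised or the smallest one is
  lowered with factor 1, and that suffices. The dimension is pinned down by grade <= height <=
  transcendence degree: a chain of primes lifts to algebraically independent elements, and their
  number is bounded by counting lattice points. The change of variables is forced because the entry
  sequence fixes the syzygy matrix only up to conjugation; the row of generators lies in the left
  kernel of that matrix, and the left kernel of the basic matrix, in the right degree, is spanned by
  the row of standard monomials.\<close>

definition ring_on :: "'r::comm_ring_1 set \<Rightarrow> 'r ring" where
  "ring_on A = ring_of_type_algebra\<lparr>carrier := A\<rparr>"

lemma ring_on_simps [simp]:
  "carrier (ring_on A) = A" "x \<otimes>\<^bsub>ring_on A\<^esub> y = x * y" "x \<oplus>\<^bsub>ring_on A\<^esub> y = x + y"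
  "\<zero>\<^bsub>ring_on A\<^esub> = 0" "\<one>\<^bsub>ring_on A\<^esub> = 1"
  by (simp_all add: ring_on_def ring_of_type_algebra_def)

text \<open>All rings of the proof are subsets of a type of class \<open>comm_ring_1\<close> with
  the operations of that type. Equations are then simplified without carrier conditions, and only
  memberships have to be tracked.\<close>

locale subr =
  fixes A :: "'r::comm_ring_1 set"
  assumes one_mem [simp, intro]: "1 \<in> A"
    and uminus_mem [simp, intro]: "a \<in> A \<Longrightarrow> - a \<in> A"
    and add_mem [simp, intro]: "a \<in> A \<Longrightarrow> b \<in> A \<Longrightarrow> a + b \<in> A"
    and mult_mem [simp, intro]: "a \<in> A \<Longrightarrow> b \<in> A \<Longrightarrow> a * b \<in> A"
begin

lemma zero_mem [simp, intro]: "0 \<in> A"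
  using add_mem[OF one_mem uminus_mem[OF one_mem]] by simp

lemma diff_mem [simp, intro]: "a \<in> A \<Longrightarrow> b \<in> A \<Longrightarrow> a - b \<in> A"
  using add_mem[of a "- b"] by simp

lemma power_mem [simp, intro]: "a \<in> A \<Longrightarrow> a ^ n \<in> A"
  by (induction n) auto

lemma sum_mem [intro]: "(\<And>i. i \<in> Y \<Longrightarrow> f i \<in> A) \<Longrightarrow> sum f Y \<in> A"
  by (induction Y rule: infinite_finite_induct) auto

lemma cring_ring_on: "cring (ring_on A)"
proof (rule cringI)
  show "abelian_group (ring_on A)"
    by (rule abelian_groupI) (auto simp: algebra_simps intro: bexI[of _ "- _"])
  show "Group.comm_monoid (ring_on A)"
    by (rule Group.comm_monoidI) (auto simp: algebra_simps)
qed (auto simp: algebra_simps)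

lemma ring_ring_on: "ring (ring_on A)"
  using cring_ring_on by (rule cring.axioms(1))

lemma a_inv_ring_on: "(a::'r) \<in> A \<Longrightarrow> \<ominus>\<^bsub>ring_on A\<^esub> a = - a"
  using cring.cring_simprules(9)[OF cring_ring_on, of a] cring.cring_simprules(3)[OF cring_ring_on, of a]
  by (simp add: eq_neg_iff_add_eq_0)

end

locale ideal_in = subr A for A :: "'r::comm_ring_1 set" +
  fixes J :: "'r set"
  assumes J_subset: "J \<subseteq> A"
    and J_zero [simp, intro]: "0 \<in> J"
    and J_add [simp, intro]: "a \<in> J \<Longrightarrow> b \<in> J \<Longrightarrow> a + b \<in> J"
    and J_mult [simp, intro]: "a \<in> A \<Longrightarrow> b \<in> J \<Longrightarrow> a * b \<in> J"
begin

lemma J_mult_right [simp, intro]: "b \<in> J \<Longrightarrow> a \<in> A \<Longrightarrow> b * a \<in> J"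
  using J_mult[of a b] by (simp add: mult.commute)

lemma J_uminus [simp, intro]: "a \<in> J \<Longrightarrow> - a \<in> J"
  using J_mult[of "- 1" a] by simp

lemma J_diff [simp, intro]: "a \<in> J \<Longrightarrow> b \<in> J \<Longrightarrow> a - b \<in> J"
  using J_add[of a "- b"] by simp

lemma J_sum [intro]: "(\<And>i. i \<in> Y \<Longrightarrow> f i \<in> J) \<Longrightarrow> sum f Y \<in> J"
  by (induction Y rule: infinite_finite_induct) auto

lemma J_add_cancel: "a + b \<in> J \<Longrightarrow> b \<in> J \<Longrightarrow> a \<in> J"
  using J_diff[of "a + b" b] by simp

end

context subr begin

lemma ideal_ring_on: "ideal J (ring_on A) \<longleftrightarrow> ideal_in A J"
proof
  assume "ideal J (ring_on A)"
  then interpret ideal J "ring_on A" .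
  show "ideal_in A J"
    using a_subset I_l_closed additive_subgroup.zero_closed[OF additive_subgroup_axioms]
      additive_subgroup.a_closed[OF additive_subgroup_axioms]
    by unfold_locales auto
next
  assume "ideal_in A J"
  then interpret ideal_in A J .
  show "ideal J (ring_on A)"
  proof (rule idealI)
    show "subgroup J (add_monoid (ring_on A))"
    proof (rule group.subgroupI)
      show "Group.group (add_monoid (ring_on A))"
        by (rule abelian_group.a_group) (rule ring.is_abelian_group[OF ring_ring_on])
      fix a assume "a \<in> J"
      then show "inv\<^bsub>add_monoid (ring_on A)\<^esub> a \<in> J"
        using a_inv_ring_on[of a] J_subset by (auto simp: a_inv_def)
    qed (use J_subset J_zero in auto)
  qed (use ring_ring_on in auto)
qed

lemma ideal_in_UNIV: "ideal_in A A"
  by unfold_locales auto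

lemma ideal_in_zero: "ideal_in A {0}"
  by unfold_locales auto

end

lemma subr_UNIV: "subr UNIV"
  by unfold_locales auto

subsection \<open>Generated ideals\<close>

definition gen :: "'r::comm_ring_1 set \<Rightarrow> 'r set \<Rightarrow> 'r set" where
  "gen A S = \<Inter>{J. ideal_in A J \<and> S \<subseteq> J}"

context subr begin

lemma Idl_ring_on: "Idl\<^bsub>ring_on A\<^esub> S = gen A S"
  unfolding genideal_def gen_def ideal_ring_on ..

lemma gen_least: "ideal_in A J \<Longrightarrow> S \<subseteq> J \<Longrightarrow> gen A S \<subseteq> J"
  unfolding gen_def by auto

lemma gen_incl: "S \<subseteq> gen A S"
  unfolding gen_def by auto

lemma gen_ideal: assumes "S \<subseteq> A" shows "ideal_in A (gen A S)"
proof unfold_locales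
  show "gen A S \<subseteq> A"
    by (rule gen_least[OF ideal_in_UNIV assms])
qed (auto simp: gen_def ideal_in.J_zero ideal_in.J_add ideal_in.J_mult)

lemma gen_mono: "S \<subseteq> S' \<Longrightarrow> gen A S \<subseteq> gen A S'"
  unfolding gen_def by auto

lemma gen_empty: "gen A {} = {0}"
  using gen_least[OF ideal_in_zero, of "{}"] ideal_in.J_zero[OF gen_ideal[of "{}"]] by auto

lemma gen_insert:
  assumes "S \<subseteq> A" "x \<in> A"
  shows "gen A (insert x S) = {a * x + g | a g. a \<in> A \<and> g \<in> gen A S}" (is "_ = ?R")
proof
  interpret G: ideal_in A "gen A S" by (rule gen_ideal) fact
  have "ideal_in A ?R"
  proof unfold_locales
    show "?R \<subseteq> A" using assms G.J_subset by auto
    have "0 = 0 * x + 0" by simp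
    then show "0 \<in> ?R" by blast
  next
    fix p q assume "p \<in> ?R" "q \<in> ?R"
    then obtain a g a' g' where "p = a * x + g" "q = a' * x + g'" "a \<in> A" "a' \<in> A" "g \<in> gen A S" "g' \<in> gen A S"
      by auto
    moreover from this have "p + q = (a + a') * x + (g + g')" by (simp add: algebra_simps)
    ultimately show "p + q \<in> ?R" by blast
  next
    fix r p assume "r \<in> A" "p \<in> ?R"
    then obtain a g where "p = a * x + g" "a \<in> A" "g \<in> gen A S" by auto
    moreover from this have "r * p = (r * a) * x + r * g" by (simp add: algebra_simps)
    ultimately show "r * p \<in> ?R" using \<open>r \<in> A\<close> by blast
  qed
  moreover have "insert x S \<subseteq> ?R"
  proof -
    have "x = 1 * x + 0" "\<And>s. s = 0 * x + s" by simp_all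
    then show ?thesis using gen_incl[of S] G.J_zero one_mem zero_mem by blast
  qed
  ultimately show "gen A (insert x S) \<subseteq> ?R" by (rule gen_least)
  interpret G': ideal_in A "gen A (insert x S)" by (rule gen_ideal) (use assms in auto)
  show "?R \<subseteq> gen A (insert x S)"
    using gen_incl[of "insert x S"] gen_mono[of S "insert x S"] by blast
qed

end

subsection \<open>Prime and maximal ideals\<close>

locale prime_in = ideal_in A J for A :: "'r::comm_ring_1 set" and J +
  assumes one_notin [simp]: "1 \<notin> J"
    and prime_mem: "a \<in> A \<Longrightarrow> b \<in> A \<Longrightarrow> a * b \<in> J \<Longrightarrow> a \<in> J \<or> b \<in> J"
begin

lemma prime_power: "a \<in> A \<Longrightarrow> a ^ n \<in> J \<Longrightarrow> a \<in> J"
  by (induction n) (auto dest: prime_mem)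

end

context subr begin

lemma ideal_in_eq_carrier: "ideal_in A J \<Longrightarrow> J = A \<longleftrightarrow> 1 \<in> J"
  using ideal_in.J_mult[of A J _ 1] ideal_in.J_subset[of A J] by auto

lemma primeideal_ring_on: "primeideal J (ring_on A) \<longleftrightarrow> prime_in A J"
proof
  assume *: "primeideal J (ring_on A)"
  then have "ideal_in A J" using ideal_ring_on primeideal.axioms(1) by blast
  then show "prime_in A J"
    using ideal_in_eq_carrier[of J] primeideal.I_notcarr[OF *] primeideal.I_prime[OF *]
    by (auto simp: prime_in_def prime_in_axioms_def)
next
  assume *: "prime_in A J"
  then have "ideal_in A J" by (rule prime_in.axioms)
  then show "primeideal J (ring_on A)"
    using ideal_in_eq_carrier[of J] cring_ring_on ideal_ring_on prime_in.one_notin[OF *] prime_in.prime_mem[OF *]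
    by (intro primeidealI) auto
qed

text \<open>\<open>P\<close> and \<open>a\<close> together generate the unit ideal. That the residue
  ring is a field is expressed by congruences, so that no quotient has to be formed.\<close>

lemma maximal_inverse:
  assumes "maximalideal P (ring_on A)" "a \<in> A" "a \<notin> P"
  shows "\<exists>b\<in>A. a * b - 1 \<in> P"
proof -
  interpret P: ideal_in A P
    using assms(1) ideal_ring_on maximalideal.axioms(1) by blast
  interpret G: ideal_in A "gen A (insert a P)"
    by (rule gen_ideal) (use assms P.J_subset in auto)
  have "gen A (insert a P) = A"
    using maximalideal.I_maximal[OF assms(1), of "gen A (insert a P)"] gen_incl[of "insert a P"]
      assms(3) ideal_ring_on G.ideal_in_axioms G.J_subset by auto
  moreover have "gen A P = P" using gen_incl[of P] gen_least[OF P.ideal_in_axioms, of P] by auto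
  ultimately have "1 \<in> {c * a + g | c g. c \<in> A \<and> g \<in> P}"
    using gen_insert[of P a] assms P.J_subset by auto
  then obtain c g where "1 = c * a + g" "c \<in> A" "g \<in> P" by auto
  then have "a * c - 1 = - g" by (simp add: algebra_simps)
  then show ?thesis using \<open>c \<in> A\<close> \<open>g \<in> P\<close> P.J_uminus by metis
qed

lemma maximal_imp_prime: "maximalideal P (ring_on A) \<Longrightarrow> prime_in A P"
  using cring.maximalideal_prime[OF cring_ring_on] primeideal_ring_on by blast

text \<open>Krull's argument: Zorn's lemma gives an ideal that is maximal among those containing
  \<open>J\<close> and missing \<open>S\<close>. Every larger ideal meets \<open>S\<close>, and this
  makes the maximal one prime.\<close>

lemma prime_avoiding:
  assumes J: "ideal_in A J" and S: "1 \<in> S" "\<And>s t. s \<in> S \<Longrightarrow> t \<in> S \<Longrightarrow> s * t \<in> S" "S \<subseteq> A"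
    and disj: "J \<inter> S = {}"
  shows "\<exists>P. prime_in A P \<and> J \<subseteq> P \<and> P \<inter> S = {}"
proof -
  define \<F> where "\<F> = {K. ideal_in A K \<and> J \<subseteq> K \<and> K \<inter> S = {}}"
  have "\<exists>M\<in>\<F>. \<forall>Y\<in>\<F>. M \<subseteq> Y \<longrightarrow> Y = M"
  proof (rule subset_Zorn_nonempty)
    show "\<F> \<noteq> {}" using J disj by (auto simp: \<F>_def)
    fix \<C> assume ne: "\<C> \<noteq> {}" and ch: "subset.chain \<F> \<C>"
    have mem: "ideal_in A K" "J \<subseteq> K" "K \<inter> S = {}" if "K \<in> \<C>" for K
      using that ch by (auto simp: \<F>_def subset.chain_def)
    have "ideal_in A (\<Union>\<C>)"
    proof unfold_locales
      show "\<Union>\<C> \<subseteq> A" using mem(1) ideal_in.J_subset by blast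
      show "0 \<in> \<Union>\<C>" using ne mem(1) ideal_in.J_zero by blast
    next
      fix p q assume "p \<in> \<Union>\<C>" "q \<in> \<Union>\<C>"
      then obtain K K' where "p \<in> K" "q \<in> K'" "K \<in> \<C>" "K' \<in> \<C>" by auto
      moreover from this have "K \<subseteq> K' \<or> K' \<subseteq> K" using ch by (auto simp: subset.chain_def)
      ultimately show "p + q \<in> \<Union>\<C>" using mem(1) ideal_in.J_add by (metis UnionI subsetD)
    next
      fix r p assume "r \<in> A" "p \<in> \<Union>\<C>"
      then show "r * p \<in> \<Union>\<C>" using mem(1) ideal_in.J_mult by blast
    qed
    then show "\<Union>\<C> \<in> \<F>" using ne mem(2,3) unfolding \<F>_def by blast
  qed
  then obtain P where P: "ideal_in A P" "J \<subseteq> P" "P \<inter> S = {}"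
    and max: "\<And>Y. Y \<in> \<F> \<Longrightarrow> P \<subseteq> Y \<Longrightarrow> Y = P" by (auto simp: \<F>_def)
  interpret P: ideal_in A P by fact
  have meets: "\<exists>c\<in>A. \<exists>g\<in>P. c * a + g \<in> S" if "a \<in> A" "a \<notin> P" for a
  proof (rule ccontr)
    assume *: "\<not> ?thesis"
    interpret G: ideal_in A "gen A (insert a P)"
      by (rule gen_ideal) (use that P.J_subset in auto)
    have "gen A P = P" using gen_incl[of P] gen_least[OF P(1), of P] by auto
    then have "gen A (insert a P) \<inter> S = {}"
      using gen_insert[of P a] that P.J_subset * by auto
    then have "gen A (insert a P) \<in> \<F>"
      using G.ideal_in_axioms gen_incl[of "insert a P"] P(2) by (auto simp: \<F>_def)
    then show False using max gen_incl[of "insert a P"] that by blast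
  qed
  have "prime_in A P"
  proof unfold_locales
    show "1 \<notin> P" using S(1) P(3) by auto
    fix a b assume ab: "a \<in> A" "b \<in> A" "a * b \<in> P"
    show "a \<in> P \<or> b \<in> P"
    proof (rule ccontr)
      assume "\<not> (a \<in> P \<or> b \<in> P)"
      then obtain c g c' g' where cg: "c \<in> A" "g \<in> P" "c * a + g \<in> S" "c' \<in> A" "g' \<in> P" "c' * b + g' \<in> S"
        using meets ab by metis
      then have "(c * a + g) * (c' * b + g') \<in> S" by (intro S(2))
      \<comment> \<open>Modulo \<open>P\<close> only the multiple of \<open>a * b\<close> could
        survive, and it lies in \<open>P\<close> as well; so the product is in both \<open>P\<close>
        and \<open>S\<close>.\<close>
      moreover have "(c * a + g) * (c' * b + g') = (c * c') * (a * b) + (c * a) * g' + g * (c' * b + g')"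
        by (simp add: algebra_simps)
      moreover have "(c * c') * (a * b) \<in> P" "(c * a) * g' \<in> P" "g * (c' * b + g') \<in> P"
        using cg ab P.J_subset by (auto intro!: P.J_mult[of "c * c'"] P.J_mult[of "c * a"] P.J_mult_right[of g])
      ultimately show False using P(3) P.J_add by (metis disjoint_iff)
    qed
  qed
  then show ?thesis using P by blast
qed

end

section \<open>Regular sequences\<close>

text \<open>A weakly regular sequence: the generated ideal may be the whole ring. This notion passes
  through free extensions, and properness is automatic once the sequence lies in a prime
  ideal.\<close>

definition wreg :: "'r::comm_ring_1 set \<Rightarrow> 'r list \<Rightarrow> bool" where
  "wreg A xs \<longleftrightarrow> set xs \<subseteq> A \<and>
     (\<forall>i<length xs. \<forall>r\<in>A. xs ! i * r \<in> gen A (set (take i xs)) \<longrightarrow> r \<in> gen A (set (take i xs)))"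

lemma wreg_Nil [simp]: "wreg A []"
  by (simp add: wreg_def)

lemma wreg_snoc:
  "wreg A (xs @ [x]) \<longleftrightarrow> wreg A xs \<and> x \<in> A \<and> (\<forall>r\<in>A. x * r \<in> gen A (set xs) \<longrightarrow> r \<in> gen A (set xs))"
  unfolding wreg_def by (auto simp: nth_append less_Suc_eq)

lemma (in subr) regular_sequence_ring_on:
  "regular_sequence (ring_on A) xs \<longleftrightarrow> wreg A xs \<and> gen A (set xs) \<noteq> A"
  unfolding regular_sequence_def wreg_def Idl_ring_on by auto

definition prime_chain :: "'r::comm_ring_1 set \<Rightarrow> (nat \<Rightarrow> 'r set) \<Rightarrow> nat \<Rightarrow> bool" where
  "prime_chain A C h \<longleftrightarrow> (\<forall>i\<le>h. prime_in A (C i)) \<and> (\<forall>i<h. C i \<subset> C (Suc i))"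

lemma (in subr) prime_height_ring_on:
  "prime_height (ring_on A) P = (SUP h \<in> {h. \<exists>C. prime_chain A C h \<and> C h = P}. enat h)"
  unfolding prime_height_def prime_chain_def primeideal_ring_on by (simp add: conj_assoc)

text \<open>If \<open>x\<close> is regular modulo \<open>J\<close>, then \<open>J\<close> is disjoint from the multiplicative set of the
  elements \<open>s x\<^sup>m\<close> with \<open>s \<notin> P\<close>, so some prime between \<open>J\<close> and \<open>P\<close> misses \<open>x\<close>.\<close>

lemma (in subr) wreg_prime_chain:
  assumes "wreg A xs" "prime_in A P" "set xs \<subseteq> P"
  shows "\<exists>C. prime_chain A C (length xs) \<and> C (length xs) = P"
  using assms
proof (induction xs arbitrary: P rule: rev_induct)
  case Nil
  then show ?case by (intro exI[of _ "\<lambda>_. P"]) (auto simp: prime_chain_def)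
next
  case (snoc x xs)
  interpret P: prime_in A P by fact
  have x: "x \<in> A" "wreg A xs" and reg: "\<And>r. r \<in> A \<Longrightarrow> x * r \<in> gen A (set xs) \<Longrightarrow> r \<in> gen A (set xs)"
    using snoc.prems(1) by (auto simp: wreg_snoc)
  have xsA: "set xs \<subseteq> A" using x(2) by (simp add: wreg_def)
  define S where "S = {s * x ^ m | s m. s \<in> A - P}"
  have genP: "gen A (set xs) \<subseteq> P"
    by (rule gen_least[OF P.ideal_in_axioms]) (use snoc.prems in auto)
  \<comment> \<open>Cancelling \<open>x\<close> repeatedly: if \<open>s * x ^ m\<close> is in the
    generated ideal, then so is \<open>s\<close>, which therefore lies in \<open>P\<close>. This
    yields the disjointness from \<open>S\<close>.\<close>
  have pow: "r \<in> gen A (set xs)" if "r \<in> A" "r * x ^ m \<in> gen A (set xs)" for r m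
    using that
  proof (induction m)
    case (Suc m)
    have "r * x ^ m \<in> gen A (set xs)"
    proof (rule reg)
      show "x * (r * x ^ m) \<in> gen A (set xs)" using Suc.prems by (simp add: algebra_simps)
    qed (use Suc.prems x in auto)
    then show ?case by (rule Suc.IH[OF Suc.prems(1)])
  qed simp
  have "\<exists>P'. prime_in A P' \<and> gen A (set xs) \<subseteq> P' \<and> P' \<inter> S = {}"
  proof (rule prime_avoiding)
    show "1 \<in> S" unfolding S_def by (rule CollectI, rule exI[of _ 1], rule exI[of _ 0]) auto
    show "s * t \<in> S" if "s \<in> S" "t \<in> S" for s t
    proof -
      obtain a b m n where "s = a * x ^ m" "t = b * x ^ n" "a \<in> A - P" "b \<in> A - P"
        using \<open>s \<in> S\<close> \<open>t \<in> S\<close> by (auto simp: S_def)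
      moreover from this have "s * t = (a * b) * x ^ (m + n)" "a * b \<in> A - P"
        using P.prime_mem by (auto simp: power_add algebra_simps)
      ultimately show ?thesis unfolding S_def by blast
    qed
    show "S \<subseteq> A" using x by (auto simp: S_def)
    show "gen A (set xs) \<inter> S = {}" using pow genP by (auto simp: S_def)
  qed (rule gen_ideal[OF xsA])
  then obtain P' where P': "prime_in A P'" "gen A (set xs) \<subseteq> P'" "P' \<inter> S = {}" by auto
  have "P' \<subseteq> P"
  proof
    fix p assume "p \<in> P'"
    then have "p \<in> A" "p \<notin> S" using P' prime_in.axioms(1) ideal_in.J_subset by blast+
    then show "p \<in> P" unfolding S_def by (metis (mono_tags, lifting) DiffI mem_Collect_eq mult.right_neutral power_0)
  qed
  moreover have "x \<in> S" unfolding S_def by (rule CollectI, rule exI[of _ 1], rule exI[of _ 1]) auto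
  then have "x \<notin> P'" using P'(3) by auto
  moreover have "x \<in> P" using snoc.prems by auto
  ultimately have sub: "P' \<subset> P" by auto
  obtain C where C: "prime_chain A C (length xs)" "C (length xs) = P'"
    using snoc.IH[OF x(2) P'(1)] P'(2) gen_incl[of "set xs"] by blast
  show ?case
    using C sub snoc.prems(2)
    by (intro exI[of _ "C(Suc (length xs) := P)"]) (auto simp: prime_chain_def less_Suc_eq le_Suc_eq)
qed

lemma (in subr) grade_le_height:
  assumes "prime_in A P"
  shows "grade (ring_on A) P \<le> prime_height (ring_on A) P"
  unfolding grade_def
proof (rule SUP_least)
  fix xs assume "xs \<in> {xs. regular_sequence (ring_on A) xs \<and> set xs \<subseteq> P}"
  then obtain C where "prime_chain A C (length xs)" "C (length xs) = P"
    using wreg_prime_chain[OF _ assms] unfolding regular_sequence_ring_on by blast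
  then show "enat (length xs) \<le> prime_height (ring_on A) P"
    unfolding prime_height_ring_on by (intro SUP_upper) auto
qed

subsection \<open>Free extensions\<close>

text \<open>The elements \<open>v e\<close> form a basis of the module \<open>A\<close> over
  \<open>C\<close>; the index set may be infinite. The Rees algebra is reached from the constants by
  four such extensions, each contributing one element of the regular sequence.\<close>

locale free_ext = C: subr C + A: subr A for C A :: "'r::comm_ring_1 set" +
  fixes E :: "'e set" and v :: "'e \<Rightarrow> 'r"
  assumes C_subset: "C \<subseteq> A"
    and v_mem: "e \<in> E \<Longrightarrow> v e \<in> A"
    and spans: "r \<in> A \<Longrightarrow> \<exists>D c. finite D \<and> D \<subseteq> E \<and> (\<forall>e\<in>D. c e \<in> C) \<and> r = (\<Sum>e\<in>D. c e * v e)"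
    and indep: "finite D \<Longrightarrow> D \<subseteq> E \<Longrightarrow> (\<And>e. e \<in> D \<Longrightarrow> c e \<in> C) \<Longrightarrow> (\<Sum>e\<in>D. c e * v e) = 0 \<Longrightarrow> e \<in> D \<Longrightarrow> c e = 0"
begin

definition ext :: "'r set \<Rightarrow> 'r set" where
  "ext K = {(\<Sum>e\<in>D. c e * v e) | D c. finite D \<and> D \<subseteq> E \<and> (\<forall>e\<in>D. c e \<in> K)}"

lemma extI: "finite D \<Longrightarrow> D \<subseteq> E \<Longrightarrow> (\<And>e. e \<in> D \<Longrightarrow> c e \<in> K) \<Longrightarrow> (\<Sum>e\<in>D. c e * v e) \<in> ext K"
  unfolding ext_def by blast

text \<open>Two expansions of one element, padded by zeros to a common index set, have the same
  coefficients. So membership in an extended ideal is tested coefficient by coefficient.\<close>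

lemma ext_coeff:
  assumes K: "ideal_in C K" and D: "finite D" "D \<subseteq> E" "\<And>e. e \<in> D \<Longrightarrow> c e \<in> C"
    and mem: "(\<Sum>e\<in>D. c e * v e) \<in> ext K" and e: "e \<in> D"
  shows "c e \<in> K"
proof -
  interpret K: ideal_in C K by fact
  obtain D' c' where D': "finite D'" "D' \<subseteq> E" "\<And>e. e \<in> D' \<Longrightarrow> c' e \<in> K"
    and eq: "(\<Sum>e\<in>D. c e * v e) = (\<Sum>e\<in>D'. c' e * v e)"
    using mem unfolding ext_def by blast
  define g where "g e = (if e \<in> D then c e else 0)" for e
  define g' where "g' e = (if e \<in> D' then c' e else 0)" for e
  have "(\<Sum>e\<in>D \<union> D'. (g e - g' e) * v e) = (\<Sum>e\<in>D \<union> D'. g e * v e) - (\<Sum>e\<in>D \<union> D'. g' e * v e)"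
    by (simp add: algebra_simps sum_subtractf)
  also have "(\<Sum>e\<in>D \<union> D'. g e * v e) = (\<Sum>e\<in>D. c e * v e)"
    by (rule sum.mono_neutral_cong_right) (use D D' in \<open>auto simp: g_def\<close>)
  also have "(\<Sum>e\<in>D \<union> D'. g' e * v e) = (\<Sum>e\<in>D'. c' e * v e)"
    by (rule sum.mono_neutral_cong_right) (use D D' in \<open>auto simp: g'_def\<close>)
  finally have "(\<Sum>e\<in>D \<union> D'. (g e - g' e) * v e) = 0" using eq by simp
  then have "g e - g' e = 0"
    by (rule indep[rotated 3]) (use D D' e K.J_subset in \<open>auto simp: g_def g'_def intro!: C.diff_mem\<close>)
  then have "c e = g' e" using e by (simp add: g_def)
  then show ?thesis using D'(3) K.J_zero by (auto simp: g'_def)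
qed

lemma ext_ideal:
  assumes K: "ideal_in C K" shows "ideal_in A (ext K)"
proof -
  interpret K: ideal_in C K by fact
  have add: "p + q \<in> ext K" if p: "p \<in> ext K" and q: "q \<in> ext K" for p q
  proof -
    obtain D c where D: "finite D" "D \<subseteq> E" "\<forall>e\<in>D. c e \<in> K" "p = (\<Sum>e\<in>D. c e * v e)"
      using p unfolding ext_def by blast
    obtain D' c' where D': "finite D'" "D' \<subseteq> E" "\<forall>e\<in>D'. c' e \<in> K" "q = (\<Sum>e\<in>D'. c' e * v e)"
      using q unfolding ext_def by blast
    define g where "g e = (if e \<in> D then c e else 0)" for e
    define g' where "g' e = (if e \<in> D' then c' e else 0)" for e
    have "p = (\<Sum>e\<in>D \<union> D'. g e * v e)" unfolding D(4)
      by (rule sum.mono_neutral_cong_left) (use D D' in \<open>auto simp: g_def\<close>)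
    moreover have "q = (\<Sum>e\<in>D \<union> D'. g' e * v e)" unfolding D'(4)
      by (rule sum.mono_neutral_cong_left) (use D D' in \<open>auto simp: g'_def\<close>)
    ultimately have "p + q = (\<Sum>e\<in>D \<union> D'. (g e + g' e) * v e)"
      by (simp add: algebra_simps sum.distrib)
    also have "\<dots> \<in> ext K"
      by (rule extI) (use D D' in \<open>auto simp: g_def g'_def\<close>)
    finally show ?thesis .
  qed
  have sum: "sum f Y \<in> ext K" if "finite Y" "\<And>i. i \<in> Y \<Longrightarrow> f i \<in> ext K" for f :: "'e \<Rightarrow> 'r" and Y
    using that by (induction Y rule: finite_induct) (auto intro: add simp: extI[of "{}", simplified])
  show ?thesis
  proof unfold_locales
    show "ext K \<subseteq> A" unfolding ext_def
      using K.J_subset C_subset v_mem by (auto intro!: A.sum_mem A.mult_mem)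
    show "0 \<in> ext K" using extI[of "{}"] by simp
    fix r p assume r: "r \<in> A" and "p \<in> ext K"
    then obtain D c where D: "finite D" "D \<subseteq> E" "\<forall>e\<in>D. c e \<in> K" "p = (\<Sum>e\<in>D. c e * v e)"
      unfolding ext_def by blast
    have "r * (c e * v e) \<in> ext K" if "e \<in> D" for e
    proof -
      have "r * v e \<in> A" using r v_mem that D by auto
      from spans[OF this] obtain D' c' where D': "finite D'" "D' \<subseteq> E" "\<forall>e\<in>D'. c' e \<in> C" "r * v e = (\<Sum>e\<in>D'. c' e * v e)"
        by blast
      have "r * (c e * v e) = c e * (r * v e)" by (simp add: algebra_simps)
      also have "\<dots> = (\<Sum>e'\<in>D'. (c e * c' e') * v e')" unfolding D'(4) by (simp add: sum_distrib_left mult.assoc)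
      also have "\<dots> \<in> ext K" by (rule extI) (use D D' that in auto)
      finally show ?thesis .
    qed
    then have "(\<Sum>e\<in>D. r * (c e * v e)) \<in> ext K" by (intro sum D) auto
    then show "r * p \<in> ext K" unfolding D(4) by (simp add: sum_distrib_left)
  qed (rule add)
qed

lemma gen_eq_ext:
  assumes "S \<subseteq> C" shows "gen A S = ext (gen C S)"
proof
  interpret K: ideal_in C "gen C S" by (rule C.gen_ideal) fact
  interpret EK: ideal_in A "ext (gen C S)" by (rule ext_ideal) (rule K.ideal_in_axioms)
  have SA: "S \<subseteq> A" using assms C_subset by auto
  interpret G: ideal_in A "gen A S" by (rule A.gen_ideal[OF SA])
  have "S \<subseteq> ext (gen C S)"
  proof
    fix s assume s: "s \<in> S"
    obtain D c where D: "finite D" "D \<subseteq> E" "\<forall>e\<in>D. c e \<in> C" "1 = (\<Sum>e\<in>D. c e * v e)"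
      using spans[of 1] by auto
    have "s = s * 1" by simp
    also have "\<dots> = (\<Sum>e\<in>D. (s * c e) * v e)" unfolding D(4) by (simp add: sum_distrib_left mult.assoc)
    also have "\<dots> \<in> ext (gen C S)" using D s C.gen_incl[of S] by (intro extI) auto
    finally show "s \<in> ext (gen C S)" .
  qed
  then show "gen A S \<subseteq> ext (gen C S)"
    by (rule A.gen_least[OF EK.ideal_in_axioms])
  have "ideal_in C (gen A S \<inter> C)" using C_subset by unfold_locales auto
  then have "gen C S \<subseteq> gen A S \<inter> C"
    using assms A.gen_incl[of S] by (intro C.gen_least) auto
  then show "ext (gen C S) \<subseteq> gen A S"
    unfolding ext_def using v_mem by (auto intro!: G.J_sum G.J_mult_right)
qed

text \<open>Multiplication by an element of \<open>C\<close> acts on each coefficient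
  separately.\<close>

lemma ext_regular_const:
  assumes "ideal_in C K" "x \<in> C" and reg: "\<And>r. r \<in> C \<Longrightarrow> x * r \<in> K \<Longrightarrow> r \<in> K"
    and "r \<in> A" "x * r \<in> ext K"
  shows "r \<in> ext K"
proof -
  obtain D c where D: "finite D" "D \<subseteq> E" "\<forall>e\<in>D. c e \<in> C" "r = (\<Sum>e\<in>D. c e * v e)"
    using spans[OF assms(4)] by blast
  have "x * r = (\<Sum>e\<in>D. (x * c e) * v e)" unfolding D(4) by (simp add: sum_distrib_left mult.assoc)
  then have mem: "(\<Sum>e\<in>D. (x * c e) * v e) \<in> ext K" using assms(5) by simp
  have "c e \<in> K" if "e \<in> D" for e
  proof (rule reg)
    show "c e \<in> C" using D that by auto
    show "x * c e \<in> K"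
      by (rule ext_coeff[OF assms(1) D(1,2) _ mem that]) (use D(3) assms(2) in auto)
  qed
  then show ?thesis unfolding D(4) by (intro extI D)
qed

text \<open>\<open>M e' e\<close> is the coefficient of \<open>v e'\<close> in \<open>\<theta> * v e\<close>. The hypothesis says that every
  finite set of columns contains one which has a unit in a row where the others vanish.\<close>

lemma ext_regular_new:
  assumes K: "ideal_in C K" and "\<theta> \<in> A"
    and F: "\<And>e. e \<in> E \<Longrightarrow> finite (F e)" "\<And>e. e \<in> E \<Longrightarrow> F e \<subseteq> E"
    and M: "\<And>e e'. e \<in> E \<Longrightarrow> e' \<in> E \<Longrightarrow> M e' e \<in> C" "\<And>e e'. e \<in> E \<Longrightarrow> e' \<notin> F e \<Longrightarrow> M e' e = 0"
    and \<theta>: "\<And>e. e \<in> E \<Longrightarrow> \<theta> * v e = (\<Sum>e'\<in>F e. M e' e * v e')"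
    and lead: "\<And>D. finite D \<Longrightarrow> D \<subseteq> E \<Longrightarrow> D \<noteq> {} \<Longrightarrow>
       \<exists>e0. \<exists>g\<in>D. M e0 g \<in> {1, - 1} \<and> (\<forall>e\<in>D - {g}. M e0 e = 0)"
    and r: "r \<in> A" "\<theta> * r \<in> ext K"
  shows "r \<in> ext K"
proof -
  interpret K: ideal_in C K by fact
  interpret EK: ideal_in A "ext K" by (rule ext_ideal[OF K])
  obtain D c where D: "finite D" "D \<subseteq> E" "\<forall>e\<in>D. c e \<in> C" "r = (\<Sum>e\<in>D. c e * v e)"
    using spans[OF r(1)] by blast
  \<comment> \<open>Terms with coefficient in \<open>K\<close> lie in \<open>ext K\<close> and are
    split off; it remains to show that there are no others.\<close>
  define D' where "D' = {e \<in> D. c e \<notin> K}"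
  have D': "finite D'" "D' \<subseteq> E" "D' \<subseteq> D" using D by (auto simp: D'_def)
  define r' where "r' = (\<Sum>e\<in>D'. c e * v e)"
  have split: "r = r' + (\<Sum>e\<in>D - D'. c e * v e)"
    unfolding D(4) r'_def by (subst add.commute, rule sum.subset_diff) (use D D' in auto)
  have rest: "(\<Sum>e\<in>D - D'. c e * v e) \<in> ext K"
    by (rule extI) (use D in \<open>auto simp: D'_def\<close>)
  have "\<theta> * r' = \<theta> * r - \<theta> * (\<Sum>e\<in>D - D'. c e * v e)"
    by (subst split) (simp add: distrib_left)
  also have "\<dots> \<in> ext K" by (intro EK.J_diff EK.J_mult r rest \<open>\<theta> \<in> A\<close>)
  finally have \<theta>r': "\<theta> * r' \<in> ext K" .
  have "D' = {}"
  proof (rule ccontr)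
    assume "D' \<noteq> {}"
    then obtain e0 g where g: "g \<in> D'" "M e0 g \<in> {1, - 1}" "\<forall>e\<in>D' - {g}. M e0 e = 0"
      using lead[OF D'(1,2)] by blast
    define U where "U = (\<Union>e\<in>D'. F e)"
    have U: "finite U" unfolding U_def using D'(1,2) F(1) by blast
    have UE: "U \<subseteq> E" unfolding U_def using D'(2) F(2) by blast
    have gE: "g \<in> E" using g D' by auto
    have "e0 \<in> F g" 
    proof (rule ccontr)
      assume "e0 \<notin> F g"
      then have "M e0 g = 0" by (rule M(2)[OF gE])
      then show False using g(2) by simp
    qed
    then have e0: "e0 \<in> U" using g(1) by (auto simp: U_def)
    have "\<theta> * r' = (\<Sum>e\<in>D'. c e * (\<theta> * v e))"
      unfolding r'_def by (simp add: sum_distrib_left algebra_simps)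
    also have "\<dots> = (\<Sum>e\<in>D'. \<Sum>e'\<in>U. c e * M e' e * v e')"
    proof (rule sum.cong)
      fix e assume e: "e \<in> D'"
      have "\<theta> * v e = (\<Sum>e'\<in>U. M e' e * v e')"
        unfolding \<theta>[OF subsetD[OF D'(2) e]]
        by (rule sum.mono_neutral_left) (use U M(2)[OF subsetD[OF D'(2) e]] e in \<open>auto simp: U_def\<close>)
      then show "c e * (\<theta> * v e) = (\<Sum>e'\<in>U. c e * M e' e * v e')"
        by (simp add: sum_distrib_left mult.assoc)
    qed simp
    also have "\<dots> = (\<Sum>e'\<in>U. (\<Sum>e\<in>D'. c e * M e' e) * v e')"
      by (subst sum.swap) (simp add: sum_distrib_right)
    finally have mem: "(\<Sum>e'\<in>U. (\<Sum>e\<in>D'. c e * M e' e) * v e') \<in> ext K" using \<theta>r' by simp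
    \<comment> \<open>In row \<open>e0\<close> only column \<open>g\<close> contributes, and it does
      so with a unit. Hence \<open>c g\<close> is in \<open>K\<close>, against the choice of
      \<open>D'\<close>.\<close>
    have "(\<Sum>e\<in>D'. c e * M e0 e) \<in> K"
    proof (rule ext_coeff[OF K U UE _ mem e0])
      fix e' assume "e' \<in> U"
      then show "(\<Sum>e\<in>D'. c e * M e' e) \<in> C"
        using D'(2,3) D(3) UE M(1) by (intro C.sum_mem C.mult_mem) blast+
    qed
    also have "(\<Sum>e\<in>D'. c e * M e0 e) = c g * M e0 g + (\<Sum>e\<in>D' - {g}. c e * M e0 e)"
      by (rule sum.remove[OF D'(1) g(1)])
    also have "(\<Sum>e\<in>D' - {g}. c e * M e0 e) = 0"
      using g(3) by (intro sum.neutral) auto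
    finally have "c g * M e0 g \<in> K" by simp
    then have "c g \<in> K" using g(2) K.J_uminus[of "- c g"] by (elim insertE) simp_all
    then show False using g(1) by (simp add: D'_def)
  qed
  then show ?thesis using split rest by (simp add: r'_def)
qed

lemma wreg_ext:
  assumes "wreg C xs" shows "wreg A xs"
  unfolding wreg_def
proof (intro conjI allI impI ballI)
  have xs: "set xs \<subseteq> C" using assms by (simp add: wreg_def)
  then show "set xs \<subseteq> A" using C_subset by auto
  fix i r assume i: "i < length xs" and r: "r \<in> A" "xs ! i * r \<in> gen A (set (take i xs))"
  have tk: "set (take i xs) \<subseteq> C" by (rule subset_trans[OF set_take_subset xs])
  show "r \<in> gen A (set (take i xs))"
    unfolding gen_eq_ext[OF tk]
  proof (rule ext_regular_const[OF C.gen_ideal[OF tk] _ _ r(1)])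
    show "xs ! i \<in> C" using xs i by auto
    show "s \<in> gen C (set (take i xs))" if "s \<in> C" "xs ! i * s \<in> gen C (set (take i xs))" for s
      using assms i that unfolding wreg_def by blast
    show "xs ! i * r \<in> ext (gen C (set (take i xs)))" using r(2) unfolding gen_eq_ext[OF tk] .
  qed
qed

lemma wreg_ext_snoc:
  assumes xs: "wreg C xs" and "\<theta> \<in> A"
    and F: "\<And>e. e \<in> E \<Longrightarrow> finite (F e)" "\<And>e. e \<in> E \<Longrightarrow> F e \<subseteq> E"
    and M: "\<And>e e'. e \<in> E \<Longrightarrow> e' \<in> E \<Longrightarrow> M e' e \<in> C" "\<And>e e'. e \<in> E \<Longrightarrow> e' \<notin> F e \<Longrightarrow> M e' e = 0"
    and \<theta>: "\<And>e. e \<in> E \<Longrightarrow> \<theta> * v e = (\<Sum>e'\<in>F e. M e' e * v e')"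
    and lead: "\<And>D. finite D \<Longrightarrow> D \<subseteq> E \<Longrightarrow> D \<noteq> {} \<Longrightarrow>
       \<exists>e0. \<exists>g\<in>D. M e0 g \<in> {1, - 1} \<and> (\<forall>e\<in>D - {g}. M e0 e = 0)"
  shows "wreg A (xs @ [\<theta>])"
  unfolding wreg_snoc
proof (intro conjI ballI impI)
  have S: "set xs \<subseteq> C" using xs by (simp add: wreg_def)
  fix r assume r: "r \<in> A" "\<theta> * r \<in> gen A (set xs)"
  show "r \<in> gen A (set xs)"
    unfolding gen_eq_ext[OF S]
  proof (rule ext_regular_new[where F = F and M = M, OF C.gen_ideal[OF S] \<open>\<theta> \<in> A\<close>])
    show "\<theta> * r \<in> ext (gen C (set xs))" using r(2) unfolding gen_eq_ext[OF S] .
  qed (fact F M \<theta> lead r(1))+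
qed (fact wreg_ext[OF xs] \<open>\<theta> \<in> A\<close>)+

end

section \<open>Algebras over a field\<close>

locale kalg = subr A for A :: "'r::comm_ring_1 set" +
  fixes h :: "'k::field \<Rightarrow> 'r"
  assumes h_one [simp]: "h 1 = 1"
    and h_add: "h (a + b) = h a + h b"
    and h_mult: "h (a * b) = h a * h b"
    and h_mem [simp, intro]: "h a \<in> A"
begin

lemma h_zero [simp]: "h 0 = 0"
  using h_add[of 0 0] by simp

lemma h_uminus: "h (- a) = - h a"
  using h_add[of a "- a"] by (simp add: eq_neg_iff_add_eq_0 add.commute)

lemma h_in_prime: "prime_in A P \<Longrightarrow> h a \<in> P \<longleftrightarrow> a = 0"
proof
  assume P: "prime_in A P" "h a \<in> P"
  interpret prime_in A P by fact
  show "a = 0"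
  proof (rule ccontr)
    assume "a \<noteq> 0"
    then have "h (1 / a) * h a = 1" by (simp flip: h_mult)
    then show False using J_mult[of "h (1 / a)" "h a"] P by simp
  qed
qed (use prime_in.axioms(1) ideal_in.J_zero in auto)

end

subsection \<open>Monomials and algebraic independence modulo a prime ideal\<close>

fun mon :: "'r::comm_ring_1 list \<Rightarrow> nat list \<Rightarrow> 'r" where
  "mon (a # as) (i # \<mu>) = a ^ i * mon as \<mu>"
| "mon _ _ = 1"

text \<open>The bound is on each exponent rather than on the total degree, so the index set is a
  product and its cardinality is a pure power.\<close>

definition exps :: "nat \<Rightarrow> nat \<Rightarrow> nat list set" where
  "exps m n = {\<mu>. set \<mu> \<subseteq> {..m} \<and> length \<mu> = n}"

lemma finite_exps [simp]: "finite (exps m n)"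
  unfolding exps_def by (rule finite_lists_length_eq) simp

lemma card_exps: "card (exps m n) = (m + 1) ^ n"
  unfolding exps_def by (subst card_lists_length_eq) simp_all

lemma exps_0 [simp]: "exps m 0 = {[]}"
  by (auto simp: exps_def)

lemma Cons_in_exps [simp]: "i # \<mu> \<in> exps m (Suc n) \<longleftrightarrow> i \<le> m \<and> \<mu> \<in> exps m n"
  by (auto simp: exps_def)

lemma exps_Suc: "exps m (Suc n) = (\<lambda>(i, \<mu>). i # \<mu>) ` ({..m} \<times> exps m n)"
proof -
  have "\<mu> \<in> (\<lambda>(i, \<mu>). i # \<mu>) ` ({..m} \<times> exps m n)" if \<mu>: "\<mu> \<in> exps m (Suc n)" for \<mu>
  proof -
    obtain i \<nu> where "\<mu> = i # \<nu>" using \<mu> by (cases \<mu>) (auto simp: exps_def)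
    then show ?thesis using \<mu> by auto
  qed
  then show ?thesis by (auto 0 0)
qed

lemma sum_exps_Suc: "sum f (exps m (Suc n)) = (\<Sum>i\<le>m. \<Sum>\<mu>\<in>exps m n. f (i # \<mu>))"
proof -
  have "sum f (exps m (Suc n)) = (\<Sum>(i, \<mu>)\<in>{..m} \<times> exps m n. f (i # \<mu>))"
    unfolding exps_Suc by (subst sum.reindex) (auto simp: inj_on_def intro!: sum.cong)
  then show ?thesis by (simp add: sum.cartesian_product)
qed

lemma (in subr) mon_mem: "set as \<subseteq> A \<Longrightarrow> mon as \<mu> \<in> A"
  by (induction as \<mu> rule: mon.induct) auto

context kalg begin

definition alg_indep :: "'r set \<Rightarrow> 'r list \<Rightarrow> bool" where
  "alg_indep P as \<longleftrightarrow> (\<forall>m \<kappa>. (\<Sum>\<mu>\<in>exps m (length as). h (\<kappa> \<mu>) * mon as \<mu>) \<in> P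
      \<longrightarrow> (\<forall>\<mu>\<in>exps m (length as). \<kappa> \<mu> = 0))"

text \<open>A relation modulo \<open>P\<close> is sorted by powers of \<open>s\<close>. When the
  coefficients below \<open>s ^ i\<close> vanish, \<open>s ^ i\<close> can be cancelled because
  \<open>s\<close> is outside the prime \<open>P\<close>; modulo \<open>P'\<close> only the
  coefficient of \<open>s ^ i\<close> is left, and independence of \<open>as\<close> modulo
  \<open>P'\<close> kills it.\<close>

lemma alg_indep_step:
  assumes P: "prime_in A P" and P': "prime_in A P'" and sub: "P \<subseteq> P'"
    and s: "s \<in> P'" "s \<notin> P" and as: "set as \<subseteq> A" "alg_indep P' as"
  shows "alg_indep P (s # as)"
  unfolding alg_indep_def
proof (intro allI impI)
  interpret P: prime_in A P by fact
  interpret P': prime_in A P' by fact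
  have sA: "s \<in> A" using s P'.J_subset by auto
  fix m \<kappa>
  let ?n = "length as"
  assume *: "(\<Sum>\<mu>\<in>exps m (length (s # as)). h (\<kappa> \<mu>) * mon (s # as) \<mu>) \<in> P"
  define q where "q i = (\<Sum>\<mu>\<in>exps m ?n. h (\<kappa> (i # \<mu>)) * mon as \<mu>)" for i
  have qA: "q i \<in> A" for i
    unfolding q_def using as by (intro sum_mem mult_mem h_mem mon_mem)
  have "(\<Sum>i\<le>m. s ^ i * q i) \<in> P"
    using * by (simp add: sum_exps_Suc q_def sum_distrib_left algebra_simps)
  then have sum: "(\<Sum>i<Suc m. s ^ i * q i) \<in> P" by (simp add: lessThan_Suc_atMost)
  have "\<forall>\<mu>\<in>exps m ?n. \<kappa> (i # \<mu>) = 0" if "i \<le> m" for i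
    using that
  proof (induction i rule: less_induct)
    case (less i)
    have q0: "q j = 0" if "j < i" for j
      using less that unfolding q_def by (intro sum.neutral) auto
    have "(\<Sum>j<Suc m. s ^ j * q j) = (\<Sum>j<i. s ^ j * q j) + (\<Sum>j=i..<Suc m. s ^ j * q j)"
      using less.prems by (simp add: lessThan_atLeast0 sum.atLeastLessThan_concat)
    also have "(\<Sum>j<i. s ^ j * q j) = 0" using q0 by simp
    also have "(\<Sum>j=i..<Suc m. s ^ j * q j) = s ^ i * q i + (\<Sum>j=Suc i..<Suc m. s ^ j * q j)"
      using less.prems by (subst sum.atLeast_Suc_lessThan) auto
    also have "(\<Sum>j=Suc i..<Suc m. s ^ j * q j) = s ^ i * (s * (\<Sum>j=Suc i..<Suc m. s ^ (j - Suc i) * q j))"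
      unfolding sum_distrib_left
    proof (rule sum.cong)
      fix j assume "j \<in> {Suc i..<Suc m}"
      then have "s ^ j = s ^ i * (s * s ^ (j - Suc i))"
        by (simp flip: power_Suc power_add)
      then show "s ^ j * q j = s ^ i * (s * (s ^ (j - Suc i) * q j))" by (simp add: mult.assoc)
    qed simp
    finally have "s ^ i * (q i + s * (\<Sum>j=Suc i..<Suc m. s ^ (j - Suc i) * q j)) \<in> P"
      using sum by (simp add: distrib_left)
    moreover have rest: "(\<Sum>j=Suc i..<Suc m. s ^ (j - Suc i) * q j) \<in> A"
      using qA sA by (intro sum_mem mult_mem power_mem)
    moreover have "s ^ i \<notin> P" using P.prime_power sA s by blast
    ultimately have "q i + s * (\<Sum>j=Suc i..<Suc m. s ^ (j - Suc i) * q j) \<in> P"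
      using P.prime_mem[of "s ^ i"] qA sA by (meson add_mem mult_mem power_mem)
    then have "q i + s * (\<Sum>j=Suc i..<Suc m. s ^ (j - Suc i) * q j) \<in> P'" using sub by auto
    then have "q i \<in> P'" by (rule P'.J_add_cancel) (rule P'.J_mult_right[OF s(1) rest])
    then show ?case
      using as(2)[unfolded alg_indep_def, rule_format, of "\<lambda>\<mu>. \<kappa> (i # \<mu>)" m] unfolding q_def by blast
  qed
  moreover have "\<exists>i \<nu>. \<mu> = i # \<nu> \<and> i \<le> m \<and> \<nu> \<in> exps m ?n" if "\<mu> \<in> exps m (length (s # as))" for \<mu>
    using that by (cases \<mu>) (auto simp: exps_def)
  ultimately show "\<forall>\<mu>\<in>exps m (length (s # as)). \<kappa> \<mu> = 0" by blast
qed

lemma prime_chain_alg_indep: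
  assumes "prime_chain A C n" "i \<le> n"
  shows "\<exists>as. length as = n - i \<and> set as \<subseteq> A \<and> alg_indep (C i) as"
  using assms(2)
proof (induction i rule: inc_induct)
  case base
  then show ?case using assms(1) h_in_prime
    by (intro exI[of _ "[]"]) (auto simp: alg_indep_def prime_chain_def)
next
  case (step i)
  then obtain as where as: "length as = n - Suc i" "set as \<subseteq> A" "alg_indep (C (Suc i)) as" by auto
  have C: "prime_in A (C i)" "prime_in A (C (Suc i))" "C i \<subset> C (Suc i)"
    using assms(1) step.hyps by (auto simp: prime_chain_def)
  then obtain s where s: "s \<in> C (Suc i)" "s \<notin> C i" by auto
  have "alg_indep (C i) (s # as)"
    using C s as by (intro alg_indep_step[of _ "C (Suc i)"]) auto
  moreover have "s \<in> A" using s C prime_in.axioms(1) ideal_in.J_subset by blast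
  ultimately show ?case using as step.hyps by (intro exI[of _ "s # as"]) auto
qed

definition trdeg_le :: "nat \<Rightarrow> bool" where
  "trdeg_le d \<longleftrightarrow> (\<forall>as. set as \<subseteq> A \<longrightarrow> length as > d \<longrightarrow> \<not> alg_indep {0} as)"

lemma alg_indep_mono: "alg_indep P as \<Longrightarrow> Q \<subseteq> P \<Longrightarrow> alg_indep Q as"
  unfolding alg_indep_def by blast

text \<open>A chain with \<open>n\<close> strict inclusions yields \<open>n\<close> elements that
  are independent modulo its lowest prime, hence modulo zero.\<close>

lemma prime_height_le:
  assumes "trdeg_le d"
  shows "prime_height (ring_on A) P \<le> enat d"
  unfolding prime_height_ring_on
proof (rule SUP_least)
  fix n assume "n \<in> {n. \<exists>C. prime_chain A C n \<and> C n = P}"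
  then obtain C where C: "prime_chain A C n" by auto
  then obtain as where as: "length as = n" "set as \<subseteq> A" "alg_indep (C 0) as"
    using prime_chain_alg_indep[of C n 0] by auto
  have "prime_in A (C 0)" using C by (auto simp: prime_chain_def)
  then have "{0} \<subseteq> C 0" using prime_in.axioms(1) ideal_in.J_zero by blast
  then have "alg_indep {0} as" using as alg_indep_mono by blast
  then show "enat n \<le> enat d" using assms as unfolding trdeg_le_def by (metis enat_ord_simps(1) not_less)
qed

end

subsection \<open>Adjoining an element\<close>

definition adj :: "'r::comm_ring_1 set \<Rightarrow> 'r \<Rightarrow> 'r set" where
  "adj C s = {poly p s | p. \<forall>i. coeff p i \<in> C}"

lemma (in subr) coeff_mult_mem:
  assumes "\<And>i. coeff p i \<in> A" "\<And>i. coeff q i \<in> A" shows "coeff (p * q) i \<in> A"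
  unfolding coeff_mult using assms by (intro sum_mem mult_mem)

lemma (in subr) adj_subr: "subr (adj A s)"
proof unfold_locales
  have "1 = poly 1 s" "\<And>i. coeff (1 :: 'r poly) i \<in> A" by simp_all
  then show "1 \<in> adj A s" unfolding adj_def by blast
next
  fix a assume "a \<in> adj A s"
  then obtain p where "a = poly p s" "\<And>i. coeff p i \<in> A" by (auto simp: adj_def)
  then have "- a = poly (- p) s" "\<And>i. coeff (- p) i \<in> A" by simp_all
  then show "- a \<in> adj A s" unfolding adj_def by blast
next
  fix a b assume "a \<in> adj A s" "b \<in> adj A s"
  then obtain p q where pq: "a = poly p s" "\<And>i. coeff p i \<in> A" "b = poly q s" "\<And>i. coeff q i \<in> A"
    by (auto simp: adj_def)
  then have "a + b = poly (p + q) s" "\<And>i. coeff (p + q) i \<in> A" by simp_all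
  then show "a + b \<in> adj A s" unfolding adj_def by blast
  have "a * b = poly (p * q) s" "\<And>i. coeff (p * q) i \<in> A" using pq coeff_mult_mem by simp_all
  then show "a * b \<in> adj A s" unfolding adj_def by blast
qed

lemma (in subr) adj_incl: "A \<subseteq> adj A s"
proof
  fix a assume "a \<in> A"
  then have "a = poly [:a:] s" "\<And>i. coeff [:a:] i \<in> A" by (simp_all add: coeff_pCons split: nat.split)
  then show "a \<in> adj A s" unfolding adj_def by blast
qed

lemma (in subr) adj_self: "s \<in> adj A s"
proof -
  have "s = poly [:0, 1:] s" "\<And>i. coeff [:0, 1:] i \<in> A" by (simp_all add: coeff_pCons split: nat.split)
  then show ?thesis unfolding adj_def by blast
qed

lemma (in subr) adj_least:
  assumes "C \<subseteq> A" "s \<in> A" shows "adj C s \<subseteq> A"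
  using assms unfolding adj_def poly_altdef by (auto intro!: sum_mem mult_mem)

text \<open>The head is adjoined last, so that finitely generated algebras can be treated by
  induction on the list, one adjunction at a time.\<close>

fun kgen :: "('k \<Rightarrow> 'r::comm_ring_1) \<Rightarrow> 'r list \<Rightarrow> 'r set" where
  "kgen h [] = range h"
| "kgen h (a # as) = adj (kgen h as) a"

context kalg begin

lemma subr_range: "subr (range h)"
proof unfold_locales
  show "1 \<in> range h" by (metis h_one rangeI)
qed (auto simp flip: h_add h_mult h_uminus)

lemma subr_kgen: "subr (kgen h as)"
  by (induction as) (auto simp: subr_range subr.adj_subr)

lemma kgen_contains: "range h \<subseteq> kgen h as" "set as \<subseteq> kgen h as"
proof -
  have "range h \<subseteq> kgen h as \<and> set as \<subseteq> kgen h as"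
  proof (induction as)
    case (Cons a as)
    interpret subr "kgen h as" by (rule subr_kgen)
    show ?case using Cons adj_incl[of a] adj_self[of a] by auto
  qed simp
  then show "range h \<subseteq> kgen h as" "set as \<subseteq> kgen h as" by auto
qed

lemma kgen_least: "set as \<subseteq> A \<Longrightarrow> kgen h as \<subseteq> A"
proof (induction as)
  case (Cons a as)
  then show ?case using adj_least[of "kgen h as" a] by auto
qed auto

lemma kgen_kgen_subset:
  assumes "set as \<subseteq> kgen h bs" shows "kgen h as \<subseteq> kgen h bs"
proof -
  interpret B: subr "kgen h bs" by (rule subr_kgen)
  interpret B: kalg "kgen h bs" h
    using h_add h_mult kgen_contains(1)[of bs] by unfold_locales auto
  show ?thesis by (rule B.kgen_least) fact
qed

text \<open>The expansion is claimed for all large \<open>m\<close>, not just for some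
  \<open>m\<close>: the finitely many coefficients of a polynomial in the head must be expanded with
  one common bound.\<close>

lemma kgen_expand:
  assumes "x \<in> kgen h as"
  shows "\<exists>m0. \<forall>m\<ge>m0. \<exists>\<kappa>. x = (\<Sum>\<mu>\<in>exps m (length as). h (\<kappa> \<mu>) * mon as \<mu>)"
    using assms
  proof (induction as arbitrary: x)
    case Nil
    then obtain c where "x = h c" by auto
    then show ?case by (auto intro: exI[of _ "\<lambda>_. c"])
  next
    case (Cons a as)
    then obtain p where p: "x = poly p a" "\<And>i. coeff p i \<in> kgen h as" by (auto simp: adj_def)
    from Cons.IH[OF p(2)] have "\<exists>m0. \<forall>m\<ge>m0. \<exists>\<kappa>. coeff p i = (\<Sum>\<mu>\<in>exps m (length as). h (\<kappa> \<mu>) * mon as \<mu>)" for i .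
    then obtain M where M: "\<And>i m. m \<ge> M i \<Longrightarrow> \<exists>\<kappa>. coeff p i = (\<Sum>\<mu>\<in>exps m (length as). h (\<kappa> \<mu>) * mon as \<mu>)"
      by metis
    define m0 where "m0 = Max (insert (Polynomial.degree p) (M ` {..Polynomial.degree p}))"
    have m0: "Polynomial.degree p \<le> m0" "\<And>i. i \<le> Polynomial.degree p \<Longrightarrow> M i \<le> m0"
      unfolding m0_def by (rule Max_ge; simp)+
    have "\<exists>\<kappa>. x = (\<Sum>\<mu>\<in>exps m (length (a # as)). h (\<kappa> \<mu>) * mon (a # as) \<mu>)" if "m \<ge> m0" for m
    proof -
      have "\<exists>\<kappa>. coeff p i = (\<Sum>\<mu>\<in>exps m (length as). h (\<kappa> \<mu>) * mon as \<mu>)" for i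
      proof (cases "i \<le> Polynomial.degree p")
        case True
        then show ?thesis using M[of i m] m0(2)[of i] that by auto
      next
        case False
        then show ?thesis by (intro exI[of _ "\<lambda>_. 0"]) (simp add: coeff_eq_0)
      qed
      then obtain K where K: "\<And>i. coeff p i = (\<Sum>\<mu>\<in>exps m (length as). h (K i \<mu>) * mon as \<mu>)" by metis
      have "x = (\<Sum>i\<le>m. coeff p i * a ^ i)"
        unfolding p(1) poly_altdef
          by (rule sum.mono_neutral_left) (use m0 that in \<open>auto simp: coeff_eq_0\<close>)
      also have "\<dots> = (\<Sum>\<mu>\<in>exps m (length (a # as)). h (K (hd \<mu>) (tl \<mu>)) * mon (a # as) \<mu>)"
        by (simp add: sum_exps_Suc K sum_distrib_left sum_distrib_right algebra_simps)
      finally show ?thesis by (intro exI)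
    qed
    then show ?case by blast
qed

text \<open>Expanding all coefficients with a common bound turns a polynomial relation for the head
  into a relation between monomials in the whole list.\<close>

lemma alg_indep_poly:
  assumes "alg_indep P (a # as)" "\<And>i. coeff p i \<in> kgen h as" "poly p a \<in> P"
  shows "p = 0"
proof -
  have "\<exists>m0. \<forall>m\<ge>m0. \<exists>\<kappa>. coeff p i = (\<Sum>\<mu>\<in>exps m (length as). h (\<kappa> \<mu>) * mon as \<mu>)" for i
    by (rule kgen_expand) (rule assms)
  then obtain M where M: "\<And>i m. m \<ge> M i \<Longrightarrow> \<exists>\<kappa>. coeff p i = (\<Sum>\<mu>\<in>exps m (length as). h (\<kappa> \<mu>) * mon as \<mu>)"
    by metis
  define m where "m = Max (insert (Polynomial.degree p) (M ` {..Polynomial.degree p}))"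
  have m: "Polynomial.degree p \<le> m" "\<And>i. i \<le> Polynomial.degree p \<Longrightarrow> M i \<le> m"
    unfolding m_def by (rule Max_ge; simp)+
  have "\<exists>\<kappa>. coeff p i = (\<Sum>\<mu>\<in>exps m (length as). h (\<kappa> \<mu>) * mon as \<mu>)" for i
  proof (cases "i \<le> Polynomial.degree p")
    case True
    then show ?thesis using M[of i m] m(2)[of i] by auto
  next
    case False
    then show ?thesis by (intro exI[of _ "\<lambda>_. 0"]) (simp add: coeff_eq_0)
  qed
  then obtain K where K: "\<And>i. coeff p i = (\<Sum>\<mu>\<in>exps m (length as). h (K i \<mu>) * mon as \<mu>)" by metis
  have "poly p a = (\<Sum>i\<le>m. coeff p i * a ^ i)"
    unfolding poly_altdef by (rule sum.mono_neutral_left) (use m in \<open>auto simp: coeff_eq_0\<close>)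
  also have "\<dots> = (\<Sum>\<mu>\<in>exps m (length (a # as)). h (K (hd \<mu>) (tl \<mu>)) * mon (a # as) \<mu>)"
    by (simp add: sum_exps_Suc K sum_distrib_left sum_distrib_right algebra_simps)
  finally have "\<forall>\<mu>\<in>exps m (length (a # as)). K (hd \<mu>) (tl \<mu>) = 0"
    using assms(1)[unfolded alg_indep_def, rule_format, of "\<lambda>\<mu>. K (hd \<mu>) (tl \<mu>)" m] assms(3) by simp
  then have "K i \<mu> = 0" if "i \<le> m" "\<mu> \<in> exps m (length as)" for i \<mu>
    using that by (auto dest!: bspec[of _ _ "i # \<mu>"])
  then have "coeff p i = 0" if "i \<le> m" for i
    unfolding K using that by (intro sum.neutral) auto
  then have "coeff p i = 0" for i using m(1) coeff_eq_0[of p i] by (cases "i \<le> m") auto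
  then show "p = 0" by (simp add: poly_eq_iff)
qed

end

section \<open>The Nullstellensatz\<close>

text \<open>The determinant trick in eliminated form: a finitely generated module \<open>M\<close> over \<open>B\<close> with
  \<open>M = c M\<close> is killed by some \<open>1 + c e\<close>. The generators are removed one at a time.\<close>

lemma (in ideal_in) nakayama:
  fixes n :: nat
  assumes B: "subr B" "B \<subseteq> A" and c: "c \<in> B"
    and "\<And>i. i < n \<Longrightarrow> v i \<in> A" "\<And>i j. i < n \<Longrightarrow> j < n \<Longrightarrow> m i j \<in> B"
    and "\<And>i. i < n \<Longrightarrow> v i - (\<Sum>j<n. c * m i j * v j) \<in> J"
  shows "\<exists>e\<in>B. \<forall>i<n. (1 + c * e) * v i \<in> J"
  using assms(4-)
proof (induction n arbitrary: m)
  case 0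
  then show ?case using subr.zero_mem[OF B(1)] by auto
next
  case (Suc n)
  interpret B: subr B by fact
  \<comment> \<open>Row \<open>n\<close> expresses \<open>u * v n\<close> through the other
    generators. Row \<open>i\<close> is multiplied by \<open>u\<close> so that this can be
    substituted; the diagonal term \<open>m n n\<close> in \<open>m'\<close> brings the left-hand
    side back from \<open>u * v i\<close> to \<open>v i\<close>.\<close>
  define u where "u = 1 - c * m n n"
  define m' where "m' i j = u * m i j + c * m i n * m n j + (if i = j then m n n else 0)" for i j
  have u: "u \<in> B" using c Suc.prems(2)[of n n] by (auto simp: u_def)
  have last: "u * v n - (\<Sum>j<n. c * m n j * v j) \<in> J"
    using Suc.prems(3)[of n] by (simp add: u_def algebra_simps)
  have step: "v i - (\<Sum>j<n. c * m' i j * v j) \<in> J" if i: "i < n" for i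
  proof -
    have "(\<Sum>j<n. c * m' i j * v j) = u * (\<Sum>j<n. c * m i j * v j)
        + c * m i n * (\<Sum>j<n. c * m n j * v j) + (\<Sum>j<n. c * (if i = j then m n n else 0) * v j)"
      unfolding m'_def by (simp add: sum_distrib_left sum.distrib algebra_simps)
    also have "(\<Sum>j<n. c * (if i = j then m n n else 0) * v j) = c * m n n * v i"
      using i by (subst sum.remove[of _ i]) auto
    finally have "v i - (\<Sum>j<n. c * m' i j * v j) =
        u * (v i - (\<Sum>j<Suc n. c * m i j * v j)) + c * m i n * (u * v n - (\<Sum>j<n. c * m n j * v j))"
      by (simp add: u_def algebra_simps)
    moreover have "u * (v i - (\<Sum>j<Suc n. c * m i j * v j)) \<in> J"
      using Suc.prems(3)[of i] u B(2) i by (intro J_mult) auto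
    moreover have "c * m i n * (u * v n - (\<Sum>j<n. c * m n j * v j)) \<in> J"
      using last Suc.prems(2)[of i n] c B(2) i by (intro J_mult) auto
    ultimately show ?thesis by (simp only: J_add)
  qed
  have "m' i j \<in> B" if "i < n" "j < n" for i j
    using that Suc.prems(2)[of i j] Suc.prems(2)[of i n] Suc.prems(2)[of n j] Suc.prems(2)[of n n] u c
    by (auto simp: m'_def)
  then obtain e where e: "e \<in> B" "\<And>i. i < n \<Longrightarrow> (1 + c * e) * v i \<in> J"
    using Suc.IH[of m'] Suc.prems(1) step by auto
  \<comment> \<open>Since \<open>u\<close> is itself 1 minus a multiple of \<open>c\<close>, the
    product of the old annihilator with \<open>u\<close> again has the required form.\<close>
  have key: "1 + c * (e * u - m n n) = (1 + c * e) * u" by (simp add: u_def algebra_simps)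
  show ?case
  proof (intro bexI[of _ "e * u - m n n"] allI impI)
    fix i assume "i < Suc n"
    then consider "i < n" | "i = n" by linarith
    then show "(1 + c * (e * u - m n n)) * v i \<in> J"
    proof cases
      case 1
      have "u * ((1 + c * e) * v i) \<in> J" by (rule J_mult[OF subsetD[OF B(2) u] e(2)[OF 1]])
      then show ?thesis unfolding key by (simp add: algebra_simps)
    next
      case 2
      have "(\<Sum>j<n. (c * m n j) * ((1 + c * e) * v j)) \<in> J"
      proof (rule J_sum)
        fix j assume "j \<in> {..<n}"
        then show "(c * m n j) * ((1 + c * e) * v j) \<in> J"
          using c Suc.prems(2)[of n j] B(2) by (intro J_mult[OF _ e(2)] mult_mem) auto
      qed
      moreover have "(1 + c * e) * (u * v n - (\<Sum>j<n. c * m n j * v j)) \<in> J"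
        using last e(1) c B(2) by (intro J_mult) auto
      ultimately have "(\<Sum>j<n. (c * m n j) * ((1 + c * e) * v j)) +
          (1 + c * e) * (u * v n - (\<Sum>j<n. c * m n j * v j)) \<in> J" by (rule J_add)
      also have "(\<Sum>j<n. (c * m n j) * ((1 + c * e) * v j)) +
          (1 + c * e) * (u * v n - (\<Sum>j<n. c * m n j * v j)) = ((1 + c * e) * u) * v n"
        by (simp add: sum_distrib_left algebra_simps sum.distrib)
      finally show ?thesis unfolding key 2 .
    qed
  qed (use e u Suc.prems(2)[of n n] in auto)
qed

subsection \<open>Nagata's change of variables\<close>

definition monic_over :: "'r::comm_ring_1 set \<Rightarrow> 'r poly \<Rightarrow> nat \<Rightarrow> bool" where
  "monic_over B p w \<longleftrightarrow> (\<forall>i. coeff p i \<in> B) \<and> coeff p w = 1 \<and> Polynomial.degree p = w"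

lemma monic_over_mult:
  assumes "subr B" "monic_over B p w" "monic_over B q w'"
  shows "monic_over B (p * q) (w + w')"
proof -
  have "coeff (p * q) (w + w') = 1"
    using coeff_mult_degree_sum[of p q] assms(2,3) by (auto simp: monic_over_def)
  moreover from this have "Polynomial.degree (p * q) = w + w'"
    using degree_mult_le[of p q] le_degree[of "p * q" "w + w'"] assms(2,3) by (auto simp: monic_over_def)
  ultimately show ?thesis
    using assms subr.coeff_mult_mem[of B p q] by (auto simp: monic_over_def)
qed

lemma monic_over_monom: "subr B \<Longrightarrow> monic_over B (monom 1 w) w"
  by (auto simp: monic_over_def degree_monom_eq subr.zero_mem subr.one_mem)

lemma monic_over_linear: "subr B \<Longrightarrow> b \<in> B \<Longrightarrow> e > 0 \<Longrightarrow> monic_over B ([:b:] + monom 1 e) e"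
  by (auto simp: monic_over_def degree_monom_eq degree_add_eq_right coeff_pCons subr.zero_mem subr.one_mem
      split: nat.split)

lemma monic_over_power: "subr B \<Longrightarrow> monic_over B p w \<Longrightarrow> monic_over B (p ^ n) (n * w)"
proof (induction n)
  case 0
  then show ?case using monic_over_monom[of B 0] by (simp add: monom_0 one_pCons)
qed (use monic_over_mult in auto)

text \<open>The number with digits \<open>\<mu>\<close> in base \<open>N\<close>, least significant
  digit first. After Nagata's substitution it is the degree in \<open>s\<close> of the monomial with
  exponents \<open>\<mu>\<close>.\<close>

fun weight :: "nat \<Rightarrow> nat list \<Rightarrow> nat" where
  "weight N [] = 0"
| "weight N (i # \<mu>) = i + N * weight N \<mu>"

text \<open>Exponents are at most \<open>m\<close>, so they are genuine digits in base
  \<open>Suc m\<close> and are recovered by division with remainder.\<close>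

lemma weight_inj: "inj_on (weight (Suc m)) (exps m n)"
proof (induction n)
  case (Suc n)
  show ?case
  proof (rule inj_onI)
    fix \<mu> \<nu> assume *: "\<mu> \<in> exps m (Suc n)" "\<nu> \<in> exps m (Suc n)" "weight (Suc m) \<mu> = weight (Suc m) \<nu>"
    obtain i \<mu>' j \<nu>' where c: "\<mu> = i # \<mu>'" "\<nu> = j # \<nu>'"
      using *(1,2) by (cases \<mu>; cases \<nu>) (auto simp: exps_def)
    have ij: "i \<le> m" "j \<le> m" "\<mu>' \<in> exps m n" "\<nu>' \<in> exps m n" using * c by auto
    have eq: "i + Suc m * weight (Suc m) \<mu>' = j + Suc m * weight (Suc m) \<nu>'" using * c by simp
    have "(i + Suc m * weight (Suc m) \<mu>') mod Suc m = i" "(j + Suc m * weight (Suc m) \<nu>') mod Suc m = j"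
      using ij by (simp_all only: mod_mult_self2 mod_less less_Suc_eq_le)
    then have "i = j" using eq by simp
    then have "Suc m * weight (Suc m) \<mu>' = Suc m * weight (Suc m) \<nu>'" using eq by (simp only: add_left_cancel)
    then have "weight (Suc m) \<mu>' = weight (Suc m) \<nu>'" by (metis mult_cancel1 Suc_not_Zero)
    then show "\<mu> = \<nu>" using Suc.IH ij c \<open>i = j\<close> by (auto dest: inj_onD)
  qed
qed auto

text \<open>The successive elements are shifted by \<open>s ^ e\<close>, \<open>s ^ (e * N)\<close>,
  \<open>s ^ (e * N ^ 2)\<close> and so on. The initial value \<open>e = N\<close> reserves the
  lowest digit for \<open>s\<close> itself.\<close>

fun nagata :: "nat \<Rightarrow> nat \<Rightarrow> 'r::comm_ring_1 \<Rightarrow> 'r list \<Rightarrow> 'r list" where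
  "nagata N e s [] = []"
| "nagata N e s (a # as) = (a - s ^ e) # nagata N (e * N) s as"

lemma length_nagata [simp]: "length (nagata N e s as) = length as"
  by (induction N e s as rule: nagata.induct) auto

text \<open>Each \<open>a\<close> is the value at \<open>s\<close> of a monic polynomial of degree
  \<open>e\<close> with constant term \<open>a - s ^ e\<close>. Products of monic polynomials are
  monic, and their degrees add up.\<close>

lemma nagata_mon:
  assumes "subr B" "set (nagata N e s as) \<subseteq> B" "e > 0" "N > 0" "length \<mu> = length as"
  shows "\<exists>p. monic_over B p (e * weight N \<mu>) \<and> poly p s = mon as \<mu>"
  using assms(2-)
proof (induction as arbitrary: e \<mu>)
  case Nil
  then show ?case using monic_over_monom[OF assms(1), of 0] by (intro exI[of _ 1]) (auto simp: monom_0 one_pCons)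
next
  case (Cons a as)
  then obtain i \<mu>' where \<mu>: "\<mu> = i # \<mu>'" "length \<mu>' = length as" by (cases \<mu>) auto
  obtain p where p: "monic_over B p (e * N * weight N \<mu>')" "poly p s = mon as \<mu>'"
    using Cons.IH[of "e * N" \<mu>'] Cons.prems \<mu> by auto
  have "monic_over B (([:a - s ^ e:] + monom 1 e) ^ i * p) (i * e + e * N * weight N \<mu>')"
    using Cons.prems p by (intro monic_over_mult monic_over_power monic_over_linear assms(1)) auto
  moreover have "poly (([:a - s ^ e:] + monom 1 e) ^ i * p) s = mon (a # as) \<mu>"
    using p \<mu> by (simp add: poly_monom)
  moreover have "i * e + e * N * weight N \<mu>' = e * weight N \<mu>" using \<mu> by (simp add: algebra_simps)
  ultimately show ?case by metis
qed

lemma (in subr) nagata_generates: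
  assumes "set (nagata N e s as) \<subseteq> A" "s \<in> A" shows "set as \<subseteq> A"
  using assms
proof (induction as arbitrary: e)
  case (Cons a as)
  then have "(a - s ^ e) + s ^ e \<in> A" by (intro add_mem) auto
  then show ?case using Cons by auto
qed auto

lemma (in subr) nagata_mem:
  assumes "set as \<subseteq> A" "s \<in> A" shows "set (nagata N e s as) \<subseteq> A"
  using assms by (induction as arbitrary: e) auto

context kalg begin

lemma comm_ring_hom_h: "comm_ring_hom h"
  by unfold_locales (auto simp: h_add h_mult)

lemma kalg_kgen: "kalg (kgen h as) h"
proof -
  interpret subr "kgen h as" by (rule subr_kgen)
  show ?thesis using h_add h_mult kgen_contains(1)[of as] by unfold_locales auto
qed

text \<open>The exponents in the change of variables grow so fast that distinct monomials of the relation
  acquire distinct degrees in \<open>s\<close>; hence the relation becomes monic.\<close>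

lemma nagata_integral:
  assumes P: "prime_in A P" and as: "set (s # as) \<subseteq> A" and dep: "\<not> alg_indep P (s # as)"
  shows "\<exists>N w p. monic_over (kgen h (nagata N N s as)) p w \<and> w > 0 \<and> poly p s \<in> P"
proof -
  interpret P: prime_in A P by fact
  obtain m \<kappa> \<mu>0 where rel: "(\<Sum>\<mu>\<in>exps m (length (s # as)). h (\<kappa> \<mu>) * mon (s # as) \<mu>) \<in> P"
    and \<mu>0: "\<mu>0 \<in> exps m (length (s # as))" "\<kappa> \<mu>0 \<noteq> 0"
    using dep unfolding alg_indep_def by blast
  define N where "N = Suc m"
  define B where "B = kgen h (nagata N N s as)"
  let ?n = "length (s # as)"
  have bs: "set (nagata N N s as) \<subseteq> A" using as by (intro nagata_mem) auto
  interpret B: kalg B h unfolding B_def by (rule kalg_kgen)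
  have BA: "B \<subseteq> A" unfolding B_def by (rule kgen_least[OF bs])
  have "\<exists>p. monic_over B p (weight N \<mu>) \<and> poly p s = mon (s # as) \<mu>" if "\<mu> \<in> exps m ?n" for \<mu>
  proof -
    obtain i \<mu>' where \<mu>: "\<mu> = i # \<mu>'" "length \<mu>' = length as"
      using \<open>\<mu> \<in> exps m ?n\<close> by (cases \<mu>) (auto simp: exps_def)
    obtain p where p: "monic_over B p (N * weight N \<mu>')" "poly p s = mon as \<mu>'"
      using nagata_mon[OF B.subr_axioms, of N N s as \<mu>'] kgen_contains(2)[of "nagata N N s as"] \<mu>
      by (auto simp: B_def N_def)
    have "monic_over B (monom 1 i * p) (i + N * weight N \<mu>')"
      using p by (intro monic_over_mult monic_over_monom B.subr_axioms) auto
    moreover have "poly (monom 1 i * p) s = mon (s # as) \<mu>" using p \<mu> by (simp add: poly_monom)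
    ultimately show ?thesis using \<mu> by auto
  qed
  then obtain q where q: "\<And>\<mu>. \<mu> \<in> exps m ?n \<Longrightarrow> monic_over B (q \<mu>) (weight N \<mu>)"
    "\<And>\<mu>. \<mu> \<in> exps m ?n \<Longrightarrow> poly (q \<mu>) s = mon (s # as) \<mu>" by metis
  define S where "S = {\<mu> \<in> exps m ?n. \<kappa> \<mu> \<noteq> 0}"
  have S: "finite S" "S \<noteq> {}" using \<mu>0 by (auto simp: S_def)
  have "Max (weight N ` S) \<in> weight N ` S" using S by (intro Max_in) auto
  then obtain \<mu>1 where \<mu>1: "\<mu>1 \<in> S" "weight N \<mu>1 = Max (weight N ` S)" by auto
  then have \<mu>1: "\<mu>1 \<in> S" "\<And>\<mu>. \<mu> \<in> S \<Longrightarrow> weight N \<mu> \<le> weight N \<mu>1"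
    using S by auto
  define w where "w = weight N \<mu>1"
  \<comment> \<open>Only the heaviest monomial \<open>\<mu>1\<close> reaches degree
    \<open>w\<close>; division by its coefficient makes the relation monic.\<close>
  define t where "t = smult (h (1 / \<kappa> \<mu>1)) (\<Sum>\<mu>\<in>S. smult (h (\<kappa> \<mu>)) (q \<mu>))"
  have qS: "monic_over B (q \<mu>) (weight N \<mu>)" if "\<mu> \<in> S" for \<mu> using that q(1) by (auto simp: S_def)
  have coeffB: "coeff t i \<in> B" for i
    unfolding t_def using qS by (auto simp: coeff_sum monic_over_def intro!: B.mult_mem B.sum_mem)
  have lt: "weight N \<mu> < w" if "\<mu> \<in> S - {\<mu>1}" for \<mu>
  proof -
    have "weight N \<mu> \<noteq> weight N \<mu>1"
      using inj_onD[OF weight_inj[of m ?n], of \<mu> \<mu>1] \<mu>1(1) that by (auto simp: S_def N_def)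
    then show ?thesis using \<mu>1(2)[of \<mu>] that by (simp add: w_def)
  qed
  have "coeff t w = h (1 / \<kappa> \<mu>1) * (h (\<kappa> \<mu>1) * coeff (q \<mu>1) w + (\<Sum>\<mu>\<in>S - {\<mu>1}. h (\<kappa> \<mu>) * coeff (q \<mu>) w))"
    unfolding t_def using S \<mu>1 by (simp add: coeff_sum sum.remove[of S \<mu>1])
  also have "(\<Sum>\<mu>\<in>S - {\<mu>1}. h (\<kappa> \<mu>) * coeff (q \<mu>) w) = 0"
  proof (intro sum.neutral ballI)
    fix \<mu> assume "\<mu> \<in> S - {\<mu>1}"
    then have "coeff (q \<mu>) w = 0" using lt[of \<mu>] qS[of \<mu>] by (intro coeff_eq_0) (auto simp: monic_over_def)
    then show "h (\<kappa> \<mu>) * coeff (q \<mu>) w = 0" by simp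
  qed
  also have "h (1 / \<kappa> \<mu>1) * (h (\<kappa> \<mu>1) * coeff (q \<mu>1) w + 0) = h (1 / \<kappa> \<mu>1 * \<kappa> \<mu>1)"
    using qS[OF \<mu>1(1)] by (simp add: monic_over_def w_def flip: h_mult)
  also have "\<dots> = 1" using \<mu>1(1) by (simp add: S_def)
  finally have lead: "coeff t w = 1" .
  have "coeff t i = 0" if "i > w" for i
  proof -
    have "coeff (q \<mu>) i = 0" if "\<mu> \<in> S" for \<mu>
      using qS[OF that] \<mu>1(2)[OF that] \<open>i > w\<close> by (intro coeff_eq_0) (simp add: monic_over_def w_def)
    then show ?thesis unfolding t_def by (simp add: coeff_sum)
  qed
  then have "Polynomial.degree t = w"
    using lead le_degree[of t w] by (intro antisym degree_le) auto
  then have monic: "monic_over B t w" using coeffB lead by (simp add: monic_over_def)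
  have "(\<Sum>\<mu>\<in>S. h (\<kappa> \<mu>) * mon (s # as) \<mu>) = (\<Sum>\<mu>\<in>exps m ?n. h (\<kappa> \<mu>) * mon (s # as) \<mu>)"
    by (rule sum.mono_neutral_left) (auto simp: S_def)
  then have "(\<Sum>\<mu>\<in>S. h (\<kappa> \<mu>) * mon (s # as) \<mu>) \<in> P" using rel by simp
  moreover have "poly t s = h (1 / \<kappa> \<mu>1) * (\<Sum>\<mu>\<in>S. h (\<kappa> \<mu>) * mon (s # as) \<mu>)"
    unfolding t_def using q(2) by (simp add: poly_sum S_def)
  ultimately have mem: "poly t s \<in> P" by simp
  \<comment> \<open>For \<open>w = 0\<close> the monic \<open>t\<close> would be 1, and 1 is not in
    a prime ideal.\<close>
  have "w > 0"
  proof (rule ccontr)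
    assume "\<not> w > 0"
    then have "w = 0" by simp
    then have "t = 1" using monic by (auto simp: monic_over_def elim!: degree_eq_zeroE)
    then show False using mem by simp
  qed
  then show ?thesis using monic mem unfolding B_def by blast
qed

text \<open>Division with remainder by the monic \<open>t\<close>, which vanishes at
  \<open>s\<close> modulo \<open>P\<close>: the powers of \<open>s\<close> below \<open>w\<close>
  span \<open>adj B s\<close> over \<open>B\<close> modulo \<open>P\<close>.\<close>

lemma monic_reduce:
  assumes B: "subr B" "B \<subseteq> A" "s \<in> A" and P: "prime_in A P"
    and t: "monic_over B t w" "poly t s \<in> P" and x: "x \<in> adj B s"
  shows "\<exists>c. (\<forall>i. c i \<in> B) \<and> x - (\<Sum>i<w. c i * s ^ i) \<in> P"
proof -
  interpret B: subr B by fact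
  interpret P: prime_in A P by fact
  have "\<exists>c. (\<forall>i. c i \<in> B) \<and> poly p s - (\<Sum>i<w. c i * s ^ i) \<in> P"
    if "\<And>i. coeff p i \<in> B" "\<And>i. i \<ge> n \<Longrightarrow> coeff p i = 0" for p n
    using that
  proof (induction n arbitrary: p)
    case 0
    then have "p = 0" by (simp add: poly_eq_iff)
    then show ?case by (intro exI[of _ "\<lambda>_. 0"]) auto
  next
    case (Suc n)
    show ?case
    proof (cases "n < w")
      case True
      have "poly p s = (\<Sum>i<w. coeff p i * s ^ i)"
        unfolding poly_altdef
      proof (rule sum.mono_neutral_cong)
        fix i assume i: "i \<in> {..Polynomial.degree p} - {..<w}"
        then show "coeff p i * s ^ i = 0" using Suc.prems(2)[of i] True by auto
      qed (auto simp: coeff_eq_0)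
      then show ?thesis using Suc.prems(1) by (intro exI[of _ "coeff p"]) auto
    next
      case False
      define r where "r = p - monom (coeff p n) (n - w) * t"
      have "coeff r i \<in> B" for i
        unfolding r_def using Suc.prems(1) t(1) B.zero_mem
        by (auto simp: coeff_monom_mult monic_over_def intro!: B.diff_mem B.mult_mem)
      moreover have "coeff r i = 0" if "i \<ge> n" for i
      proof (cases "i = n")
        case True
        then show ?thesis using t(1) False by (simp add: r_def coeff_monom_mult monic_over_def)
      next
        case neq: False
        then have "coeff t (i - (n - w)) = 0" using that t(1) False by (intro coeff_eq_0) (auto simp: monic_over_def)
        then show ?thesis using neq that Suc.prems(2)[of i] by (simp add: r_def coeff_monom_mult)
      qed
      ultimately obtain c where c: "\<And>i. c i \<in> B" "poly r s - (\<Sum>i<w. c i * s ^ i) \<in> P"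
        using Suc.IH[of r] by blast
      have "coeff p n * s ^ (n - w) \<in> A" using Suc.prems(1) B by (intro mult_mem power_mem) auto
      then have "coeff p n * s ^ (n - w) * poly t s \<in> P" using t(2) by (rule P.J_mult)
      moreover have "poly p s - (\<Sum>i<w. c i * s ^ i) = (poly r s - (\<Sum>i<w. c i * s ^ i)) + coeff p n * s ^ (n - w) * poly t s"
        by (simp add: r_def poly_monom)
      ultimately show ?thesis using c by (metis P.J_add)
    qed
  qed
  moreover obtain p where "x = poly p s" "\<And>i. coeff p i \<in> B" using x by (auto simp: adj_def)
  ultimately show ?thesis using coeff_eq_0[of p] by (metis Suc_le_eq)
qed

end

text \<open>A linear factor is split off over the algebraically closed field. As \<open>P\<close> is
  prime, it contains the value at \<open>s\<close> of that factor or of the cofactor, which has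
  smaller degree.\<close>

lemma root_mod_prime:
  fixes h :: "'k::alg_closed_field \<Rightarrow> 'r::comm_ring_1"
  assumes "kalg A h" "prime_in A P" "s \<in> A" "t \<noteq> 0" "poly (map_poly h t) s \<in> P"
  shows "\<exists>\<kappa>. s - h \<kappa> \<in> P"
  using assms(4,5)
proof (induction "Polynomial.degree t" arbitrary: t rule: less_induct)
  case less
  interpret kalg A h by fact
  interpret P: prime_in A P by fact
  interpret comm_ring_hom h by (rule comm_ring_hom_h)
  interpret mp: map_poly_comm_ring_hom h ..
  show ?case
  proof (cases "Polynomial.degree t = 0")
    case True
    then obtain c where c: "t = [:c:]" by (rule degree_eq_zeroE)
    then show ?thesis using less.prems h_in_prime[OF assms(2), of c] by (simp add: map_poly_pCons)
  next
    case False
    then obtain z where "poly t z = 0" using alg_closed_imp_poly_has_root[of t] by auto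
    then obtain t' where t: "t = [:- z, 1:] * t'" by (auto simp: poly_eq_0_iff_dvd)
    then have t': "t' \<noteq> 0" using less.prems by auto
    have "poly (map_poly h t) s = (s - h z) * poly (map_poly h t') s"
      unfolding t mp.hom_mult by (simp add: map_poly_pCons h_uminus algebra_simps)
    moreover have "poly (map_poly h t') s \<in> A"
      unfolding poly_altdef using assms(3) by (auto intro!: sum_mem mult_mem)
    ultimately have "s - h z \<in> P \<or> poly (map_poly h t') s \<in> P"
      using P.prime_mem[of "s - h z"] less.prems(2) assms(3) by auto
    moreover have "Polynomial.degree t' < Polynomial.degree t"
      unfolding t using t' by (subst degree_mult_eq) auto
    ultimately show ?thesis using less.hyps[of t'] t' by blast
  qed
qed

text \<open>The elements congruent to a constant modulo \<open>P\<close> form a subalgebra.\<close>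

lemma const_mod_prime_kgen:
  assumes "kalg A h" "prime_in A P" "set as \<subseteq> A"
    and const: "\<And>a. a \<in> set as \<Longrightarrow> \<exists>\<kappa>. a - h \<kappa> \<in> P" and "x \<in> kgen h as"
  shows "\<exists>\<kappa>. x - h \<kappa> \<in> P"
proof -
  interpret kalg A h by fact
  interpret P: prime_in A P by fact
  define D where "D = {x \<in> A. \<exists>\<kappa>. x - h \<kappa> \<in> P}"
  have D: "x \<in> D" if "x \<in> A" "x - h \<kappa> \<in> P" for x \<kappa> using that by (auto simp: D_def)
  interpret D: subr D
  proof unfold_locales
    show "1 \<in> D" by (rule D[of _ 1]) auto
  next
    fix a assume "a \<in> D"
    then obtain \<kappa> where "a \<in> A" "a - h \<kappa> \<in> P" by (auto simp: D_def)
    then show "- a \<in> D" using P.J_uminus[of "a - h \<kappa>"] by (intro D[of _ "- \<kappa>"]) (auto simp: h_uminus algebra_simps)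
  next
    fix a b assume "a \<in> D" "b \<in> D"
    then obtain \<kappa> \<kappa>' where ab: "a \<in> A" "a - h \<kappa> \<in> P" "b \<in> A" "b - h \<kappa>' \<in> P" by (auto simp: D_def)
    have "a + b - h (\<kappa> + \<kappa>') = (a - h \<kappa>) + (b - h \<kappa>')" by (simp add: h_add)
    then show "a + b \<in> D" using ab by (intro D[of _ "\<kappa> + \<kappa>'"]) (auto simp only: intro!: P.J_add add_mem)
    have "a * b - h (\<kappa> * \<kappa>') = b * (a - h \<kappa>) + h \<kappa> * (b - h \<kappa>')" by (simp add: h_mult algebra_simps)
    then show "a * b \<in> D" using ab by (intro D[of _ "\<kappa> * \<kappa>'"]) (auto simp only: intro!: P.J_add P.J_mult mult_mem h_mem)
  qed
  have hD: "h \<kappa> \<in> D" for \<kappa> by (rule D[of _ \<kappa>]) auto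
  interpret D: kalg D h using hD h_add h_mult by unfold_locales auto
  have "kgen h as \<subseteq> D" by (rule D.kgen_least) (use const assms(3) in \<open>auto simp: D_def\<close>)
  then show ?thesis using assms(5) by (auto simp: D_def)
qed

text \<open>Zariski's lemma, by induction on the number of generators. Nagata's substitution makes
  the head integral over an algebra with one generator fewer. That algebra is again a field modulo
  \<open>P\<close>, so by induction it consists of constants, and the head becomes a root of a
  polynomial over the ground field.\<close>

lemma zariski:
  fixes h :: "'k::alg_closed_field \<Rightarrow> 'r::comm_ring_1"
  assumes "kalg A h" "prime_in A P" "set as \<subseteq> A"
    and "\<And>c. c \<in> kgen h as \<Longrightarrow> c \<notin> P \<Longrightarrow> \<exists>d\<in>kgen h as. c * d - 1 \<in> P"
  shows "\<forall>a\<in>set as. \<exists>\<kappa>. a - h \<kappa> \<in> P"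
  using assms(3,4)
proof (induction "length as" arbitrary: as)
  case 0
  then show ?case by simp
next
  case (Suc n)
  interpret kalg A h by fact
  interpret P: prime_in A P by fact
  obtain s as' where as: "as = s # as'" "length as' = n" using Suc.hyps(2) by (cases as) auto
  have asA: "set (s # as') \<subseteq> A" using Suc.prems(1) as by simp
  interpret K: kalg "kgen h as'" h by (rule kalg_kgen)
  \<comment> \<open>If the list were independent, \<open>s\<close> would be nonzero modulo
    \<open>P\<close> with some inverse \<open>poly p s\<close>, and \<open>pCons (- 1) p\<close>
    would be a relation whose constant term does not vanish.\<close>
  have nonzero: "\<not> alg_indep P (s # as')"
  proof
    assume ind: "alg_indep P (s # as')"
    have "s \<notin> P"
    proof
      assume "s \<in> P"
      then have "monom (1 :: 'r) 1 = 0"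
        by (intro alg_indep_poly[OF ind]) (auto simp: poly_monom)
      then show False by simp
    qed
    moreover have "s \<in> kgen h as" using kgen_contains(2)[of as] as by auto
    ultimately obtain d where d: "d \<in> kgen h as" "s * d - 1 \<in> P" using Suc.prems(2) by blast
    then obtain p where p: "d = poly p s" "\<And>i. coeff p i \<in> kgen h as'" using as by (auto simp: adj_def)
    have "pCons (- 1) p = 0"
      by (rule alg_indep_poly[OF ind]) (use p d in \<open>auto simp: coeff_pCons split: nat.split\<close>)
    then show False by simp
  qed
  then obtain N w t where t: "monic_over (kgen h (nagata N N s as')) t w" "w > 0" "poly t s \<in> P"
    using nagata_integral[OF assms(2) asA] by blast
  define bs where "bs = nagata N N s as'"
  have bs: "set bs \<subseteq> A" unfolding bs_def using asA by (intro nagata_mem) auto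
  interpret B: kalg "kgen h bs" h by (rule kalg_kgen)
  interpret L: kalg "kgen h as" h by (rule kalg_kgen)
  have BA: "kgen h bs \<subseteq> A" by (rule kgen_least[OF bs])
  have sL: "s \<in> kgen h as" "set as' \<subseteq> kgen h as" using kgen_contains(2)[of as] as by auto
  have BL: "kgen h bs \<subseteq> kgen h as"
    by (rule kgen_kgen_subset) (unfold bs_def, rule L.nagata_mem[OF sL(2,1)])
  have sA: "s \<in> A" using asA by auto
  have LB: "kgen h as \<subseteq> adj (kgen h bs) s"
  proof -
    interpret aB: subr "adj (kgen h bs) s" by (rule B.adj_subr)
    interpret aB: kalg "adj (kgen h bs) s" h
      using h_add h_mult subsetD[OF B.adj_incl B.h_mem] by unfold_locales auto
    have "set (nagata N N s as') \<subseteq> adj (kgen h bs) s"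
      using subset_trans[OF kgen_contains(2)[of bs] B.adj_incl[of s]] by (simp add: bs_def)
    then have "set as' \<subseteq> adj (kgen h bs) s"
      using B.adj_self by (rule aB.nagata_generates)
    then show ?thesis using B.adj_self[of s] as by (intro aB.kgen_least) auto
  qed
  \<comment> \<open>The inverse \<open>d\<close> of \<open>c\<close> is only known in the larger
    algebra. It makes multiplication by \<open>c\<close> surjective on the span of the powers of
    \<open>s\<close> below \<open>w\<close>, so the determinant trick kills that span, and in
    particular \<open>s ^ 0\<close>, by some \<open>1 + c * e\<close>. Thus \<open>- e\<close> is an
    inverse in the smaller algebra.\<close>
  have inv: "\<exists>d\<in>kgen h bs. c * d - 1 \<in> P" if c: "c \<in> kgen h bs" "c \<notin> P" for c
  proof -
    obtain d where d: "d \<in> kgen h as" "c * d - 1 \<in> P" using Suc.prems(2) c BL by blast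
    have "\<exists>m. (\<forall>j. m j \<in> kgen h bs) \<and> d * s ^ i - (\<Sum>j<w. m j * s ^ j) \<in> P" for i
      by (rule monic_reduce[OF B.subr_axioms BA sA assms(2)])
        (use t LB d sL in \<open>auto simp: bs_def\<close>)
    then obtain m where m: "\<And>i j. m i j \<in> kgen h bs" "\<And>i. d * s ^ i - (\<Sum>j<w. m i j * s ^ j) \<in> P" by metis
    have "s ^ i - (\<Sum>j<w. c * m i j * s ^ j) \<in> P" for i
    proof -
      have "s ^ i - (\<Sum>j<w. c * m i j * s ^ j) = c * (d * s ^ i - (\<Sum>j<w. m i j * s ^ j)) - s ^ i * (c * d - 1)"
        by (simp add: sum_distrib_left algebra_simps)
      moreover have "c * (d * s ^ i - (\<Sum>j<w. m i j * s ^ j)) \<in> P" using m(2) c BA by (intro P.J_mult) auto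
      moreover have "s ^ i * (c * d - 1) \<in> P" using d(2) sA by (intro P.J_mult) auto
      ultimately show ?thesis by (simp only: P.J_diff)
    qed
    then obtain e where e: "e \<in> kgen h bs" "\<And>i. i < w \<Longrightarrow> (1 + c * e) * s ^ i \<in> P"
      using P.nakayama[OF B.subr_axioms BA c(1), of w "\<lambda>i. s ^ i" m] m(1) sA by auto
    have "c * (- e) - 1 = - ((1 + c * e) * s ^ 0)" by simp
    then have "c * (- e) - 1 \<in> P" using P.J_uminus[OF e(2)[OF t(2)]] by (simp only:)
    then show ?thesis using e(1) B.uminus_mem by blast
  qed
  have constb: "\<forall>b\<in>set bs. \<exists>\<kappa>. b - h \<kappa> \<in> P"
    by (rule Suc.hyps(1)) (use as bs inv in \<open>auto simp: bs_def\<close>)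
  have constB: "\<exists>\<kappa>. x - h \<kappa> \<in> P" if "x \<in> kgen h bs" for x
    by (rule const_mod_prime_kgen[OF assms(1,2) bs _ that]) (use constb in auto)
  have "\<exists>\<kappa>. coeff t i - h \<kappa> \<in> P" for i
    using t(1) by (intro constB) (auto simp: monic_over_def bs_def)
  then obtain \<kappa> where \<kappa>: "\<And>i. coeff t i - h (\<kappa> i) \<in> P" by metis
  \<comment> \<open>\<open>q\<close> is \<open>t\<close> with its lower coefficients replaced by the
    constants congruent to them.\<close>
  define q where "q = monom 1 w + (\<Sum>i<w. monom (\<kappa> i) i)"
  have cq: "coeff q i = (if i = w then 1 else if i < w then \<kappa> i else 0)" for i
    by (auto simp: q_def coeff_sum)
  have "coeff q w \<noteq> 0" by (simp add: cq)
  then have "q \<noteq> 0" by auto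
  interpret hh: comm_ring_hom h by (rule comm_ring_hom_h)
  have degq: "Polynomial.degree q \<le> w" by (rule degree_le) (simp add: cq)
  have "Polynomial.degree (map_poly h q) \<le> w" using degree_map_poly_le[of h q] degq by linarith
  then have "poly (map_poly h q) s = (\<Sum>i\<le>w. coeff (map_poly h q) i * s ^ i)"
    unfolding poly_altdef
  proof (intro sum.mono_neutral_left ballI)
    fix i assume "i \<in> {..w} - {..Polynomial.degree (map_poly h q)}"
    then have "coeff (map_poly h q) i = 0" by (intro coeff_eq_0) auto
    then show "coeff (map_poly h q) i * s ^ i = 0" by (simp only: mult_zero_left)
  qed auto
  then have "poly (map_poly h q) s = (\<Sum>i\<le>w. h (coeff q i) * s ^ i)"
    by (simp add: coeff_map_poly)
  moreover have "poly t s = (\<Sum>i\<le>w. coeff t i * s ^ i)"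
    using t(1) unfolding poly_altdef by (simp add: monic_over_def)
  ultimately have "poly t s - poly (map_poly h q) s = (\<Sum>i\<le>w. (coeff t i - h (coeff q i)) * s ^ i)"
    by (simp add: sum_subtractf algebra_simps)
  also have "\<dots> \<in> P"
  proof (intro P.J_sum P.J_mult_right power_mem sA)
    fix i assume "i \<in> {..w}"
    then show "coeff t i - h (coeff q i) \<in> P" using \<kappa>[of i] t(1) by (auto simp: cq monic_over_def)
  qed
  finally have "poly (map_poly h q) s \<in> P"
    using P.J_diff[OF t(3)] by (metis diff_diff_eq2 add_diff_cancel_left')
  then obtain \<kappa>s where \<kappa>s: "s - h \<kappa>s \<in> P"
    using root_mod_prime[OF assms(1,2) sA \<open>q \<noteq> 0\<close>] by blast
  have sB: "set as' \<subseteq> kgen h (s # bs)"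
  proof -
    interpret SB: subr "kgen h (s # bs)" by (rule subr_kgen)
    have "set (nagata N N s as') \<subseteq> kgen h (s # bs)" "s \<in> kgen h (s # bs)"
      using kgen_contains(2)[of "s # bs"] by (auto simp: bs_def)
    then show ?thesis by (rule SB.nagata_generates)
  qed
  have "\<exists>\<kappa>. a - h \<kappa> \<in> P" if "a \<in> kgen h (s # bs)" for a
    by (rule const_mod_prime_kgen[OF assms(1,2) _ _ that]) (use constb \<kappa>s sA bs in auto)
  then show ?case using sB kgen_contains(2)[of "s # bs"] as by auto
qed

lemma nullstellensatz:
  fixes h :: "'k::alg_closed_field \<Rightarrow> 'r::comm_ring_1"
  assumes "kalg A h" "A = kgen h as" "maximalideal P (ring_on A)" "x \<in> A"
  shows "\<exists>\<kappa>. x - h \<kappa> \<in> P"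
proof -
  interpret kalg A h by fact
  have P: "prime_in A P" using assms(3) by (rule maximal_imp_prime)
  have asA: "set as \<subseteq> A" unfolding assms(2) by (rule kgen_contains)
  have "\<forall>a\<in>set as. \<exists>\<kappa>. a - h \<kappa> \<in> P"
    by (rule zariski[OF assms(1) P asA]) (use maximal_inverse[OF assms(3)] assms(2) in auto)
  then show ?thesis
    using const_mod_prime_kgen[OF assms(1) P asA] assms(2,4) by blast
qed

section \<open>Hilbert's basis theorem\<close>

definition noeth :: "'r::comm_ring_1 set \<Rightarrow> bool" where
  "noeth A \<longleftrightarrow> (\<forall>J. ideal_in A J \<longrightarrow> (\<exists>S. finite S \<and> S \<subseteq> A \<and> J = gen A S))"

lemma (in subr) noetherian_ring_on: "noeth A \<Longrightarrow> noetherian_ring (ring_on A)"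
  by (rule ring.noetherian_ringI[OF ring_ring_on])
    (auto simp: noeth_def ideal_ring_on Idl_ring_on)

lemma (in kalg) noeth_range: "noeth (range h)"
  unfolding noeth_def
proof (intro allI impI)
  interpret K: subr "range h" by (rule subr_range)
  fix J assume "ideal_in (range h) J"
  then interpret J: ideal_in "range h" J .
  show "\<exists>S. finite S \<and> S \<subseteq> range h \<and> J = gen (range h) S"
  proof (cases "J = {0}")
    case True
    then show ?thesis using K.gen_empty by (intro exI[of _ "{}"]) auto
  next
    case False
    then obtain c where c: "h c \<in> J" "h c \<noteq> 0" using J.J_subset J.J_zero by auto
    then have "c \<noteq> 0" by auto
    then have "h (1 / c) * h c = 1" by (simp flip: h_mult)
    then have 1: "1 \<in> J" using J.J_mult[of "h (1 / c)" "h c"] c by auto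
    interpret G: ideal_in "range h" "gen (range h) {1}" by (rule K.gen_ideal) auto
    have "gen (range h) {1} = range h"
      using K.ideal_in_eq_carrier[OF G.ideal_in_axioms] K.gen_incl[of "{1}"] by auto
    moreover have "J = range h" using K.ideal_in_eq_carrier[OF J.ideal_in_axioms] 1 by auto
    ultimately show ?thesis by (intro exI[of _ "{1}"]) auto
  qed
qed

section \<open>Ideals of leading coefficients and the basis theorem\<close>

context subr begin

text \<open>An element of \<open>adj A s\<close> may be represented by many polynomials, because
  \<open>s\<close> need not be transcendental. Leading coefficients therefore belong to a chosen
  polynomial, which is part of the witness.\<close>

definition lead_wit :: "'r set \<Rightarrow> 'r \<Rightarrow> nat \<Rightarrow> 'r \<Rightarrow> 'r poly \<Rightarrow> bool" where
  "lead_wit J s n c p \<longleftrightarrow> (\<forall>i. coeff p i \<in> A) \<and> (\<forall>i>n. coeff p i = 0) \<and> coeff p n = c \<and> poly p s \<in> J"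

lemma lead_wit_ideal:
  assumes "ideal_in (adj A s) J"
  shows "ideal_in A {c. \<exists>p. lead_wit J s n c p}"
proof -
  interpret J: ideal_in "adj A s" J by fact
  show ?thesis
  proof unfold_locales
    have "lead_wit J s n 0 0" by (simp add: lead_wit_def)
    then show "0 \<in> {c. \<exists>p. lead_wit J s n c p}" by blast
  next
    fix a b assume "a \<in> {c. \<exists>p. lead_wit J s n c p}" "b \<in> {c. \<exists>p. lead_wit J s n c p}"
    then obtain p q where "lead_wit J s n a p" "lead_wit J s n b q" by auto
    then have "lead_wit J s n (a + b) (p + q)" by (simp add: lead_wit_def)
    then show "a + b \<in> {c. \<exists>p. lead_wit J s n c p}" by blast
  next
    fix a b assume a: "a \<in> A" "b \<in> {c. \<exists>p. lead_wit J s n c p}"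
    then obtain p where "lead_wit J s n b p" by auto
    then have "lead_wit J s n (a * b) (smult a p)"
      using a(1) J.J_mult[of a "poly p s"] adj_incl[of s] by (auto simp: lead_wit_def)
    then show "a * b \<in> {c. \<exists>p. lead_wit J s n c p}" by blast
  qed (auto simp: lead_wit_def)
qed

lemma lead_wit_shift:
  assumes J: "ideal_in (adj A s) J" and p: "lead_wit J s n c p"
  shows "lead_wit J s (n + k) c (monom 1 k * p)"
proof -
  interpret J: ideal_in "adj A s" J by fact
  have "s ^ k * poly p s \<in> J"
    using p adj_self[of s] by (intro J.J_mult J.power_mem) (auto simp: lead_wit_def)
  then show ?thesis using p by (auto simp: lead_wit_def coeff_monom_mult poly_monom)
qed

text \<open>The ideals \<open>L n\<close> of leading coefficients increase with \<open>n\<close>.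
  Their union is finitely generated and so is reached at some \<open>N\<close>; finitely many
  witnesses for the ideals up to \<open>L N\<close> generate \<open>J\<close>.\<close>

theorem hilbert_basis:
  assumes "noeth A" shows "noeth (adj A s)"
  unfolding noeth_def
proof (intro allI impI)
  fix J assume J: "ideal_in (adj A s) J"
  interpret J: ideal_in "adj A s" J by fact
  define L where "L n = {c. \<exists>p. lead_wit J s n c p}" for n
  have L: "ideal_in A (L n)" for n unfolding L_def by (rule lead_wit_ideal[OF J])
  have Lmono: "L m \<subseteq> L n" if "m \<le> n" for m n
    using lead_wit_shift[OF J, of m _ _ "n - m"] that unfolding L_def by auto
  have "ideal_in A (\<Union>n. L n)"
  proof unfold_locales
    show "(\<Union>n. L n) \<subseteq> A" using L ideal_in.J_subset by blast
    show "0 \<in> (\<Union>n. L n)" using L ideal_in.J_zero by blast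
  next
    fix a b assume "a \<in> (\<Union>n. L n)" "b \<in> (\<Union>n. L n)"
    then obtain m n where "a \<in> L m" "b \<in> L n" by auto
    then have "a \<in> L (max m n)" "b \<in> L (max m n)" using Lmono[of m "max m n"] Lmono[of n "max m n"] by auto
    then have "a + b \<in> L (max m n)" by (rule ideal_in.J_add[OF L])
    then show "a + b \<in> (\<Union>n. L n)" by blast
  next
    fix a b assume "a \<in> A" "b \<in> (\<Union>n. L n)"
    then show "a * b \<in> (\<Union>n. L n)" using ideal_in.J_mult[OF L] by blast
  qed
  then obtain T where T: "finite T" "(\<Union>n. L n) = gen A T" "T \<subseteq> A"
    using assms unfolding noeth_def by metis
  have "\<exists>N. T \<subseteq> L N"
  proof -
    have "T \<subseteq> (\<Union>n. L n)" unfolding T(2) by (rule gen_incl)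
    then obtain k where k: "\<And>t. t \<in> T \<Longrightarrow> t \<in> L (k t)" by (metis UN_iff subsetD)
    have "t \<in> L (Max (insert 0 (k ` T)))" if "t \<in> T" for t
      using Lmono[of "k t" "Max (insert 0 (k ` T))"] k[OF that] that T(1) by (auto intro!: Max_ge)
    then show ?thesis by blast
  qed
  then obtain N where "T \<subseteq> L N" by blast
  then have N: "L n \<subseteq> L N" for n using gen_least[OF L[of N], of T] T(2) by blast
  have "\<exists>G. finite G \<and> G \<subseteq> J \<and> (\<forall>c\<in>L n. \<exists>q. lead_wit J s n c q \<and> poly q s \<in> gen (adj A s) G)" for n
  proof -
    obtain T' where T': "finite T'" "L n = gen A T'" "T' \<subseteq> A"
      using assms L unfolding noeth_def by metis
    have "T' \<subseteq> L n" unfolding T'(2) by (rule gen_incl)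
    then have "\<forall>t\<in>T'. \<exists>q. lead_wit J s n t q" unfolding L_def by blast
    then obtain q where q: "\<And>t. t \<in> T' \<Longrightarrow> lead_wit J s n t (q t)" by metis
    define G where "G = (\<lambda>t. poly (q t) s) ` T'"
    have G: "finite G" "G \<subseteq> J" using T' q by (auto simp: G_def lead_wit_def)
    have GA: "G \<subseteq> adj A s" using G J.J_subset by auto
    have "gen (adj A s) G \<subseteq> J" by (rule J.gen_least[OF J G(2)])
    then have wit: "lead_wit (gen (adj A s) G) s n c p \<Longrightarrow> lead_wit J s n c p \<and> poly p s \<in> gen (adj A s) G" for c p
      by (auto simp: lead_wit_def)
    have "T' \<subseteq> {c. \<exists>p. lead_wit (gen (adj A s) G) s n c p}"
    proof
      fix t assume t: "t \<in> T'"
      then have "poly (q t) s \<in> gen (adj A s) G" using J.gen_incl[of G] by (auto simp: G_def)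
      then have "lead_wit (gen (adj A s) G) s n t (q t)" using q[OF t] by (simp add: lead_wit_def)
      then show "t \<in> {c. \<exists>p. lead_wit (gen (adj A s) G) s n c p}" by blast
    qed
    then have sub: "L n \<subseteq> {c. \<exists>p. lead_wit (gen (adj A s) G) s n c p}"
      unfolding T'(2) by (rule gen_least[OF lead_wit_ideal[OF J.gen_ideal[OF GA]]])
    show ?thesis
    proof (intro exI[of _ G] conjI ballI G)
      fix c assume "c \<in> L n"
      then obtain q where "lead_wit (gen (adj A s) G) s n c q" using sub by auto
      from wit[OF this] show "\<exists>q. lead_wit J s n c q \<and> poly q s \<in> gen (adj A s) G" by (intro exI)
    qed
  qed
  then obtain G where G: "\<And>n. finite (G n)" "\<And>n. G n \<subseteq> J"
    "\<And>n c. c \<in> L n \<Longrightarrow> \<exists>q. lead_wit J s n c q \<and> poly q s \<in> gen (adj A s) (G n)" by metis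
  define G' where "G' = (\<Union>n\<le>N. G n)"
  have G': "finite G'" "G' \<subseteq> J" using G by (auto simp: G'_def)
  then have G'A: "G' \<subseteq> adj A s" using J.J_subset by auto
  interpret I: ideal_in "adj A s" "gen (adj A s) G'" by (rule J.gen_ideal[OF G'A])
  have low: "\<exists>q. lead_wit J s n c q \<and> poly q s \<in> gen (adj A s) G'" if c: "c \<in> L n" for n c
  proof (cases "n \<le> N")
    case True
    then have "gen (adj A s) (G n) \<subseteq> gen (adj A s) G'" by (intro J.gen_mono) (auto simp: G'_def)
    then show ?thesis using G(3)[OF c] by blast
  next
    case False
    have "c \<in> L N" using N c by auto
    then obtain q where q: "lead_wit J s N c q" "poly q s \<in> gen (adj A s) (G N)" using G(3) by blast
    have "gen (adj A s) (G N) \<subseteq> gen (adj A s) G'" by (intro J.gen_mono) (auto simp: G'_def)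
    then have "s ^ (n - N) * poly q s \<in> gen (adj A s) G'"
      using q(2) adj_self[of s] by (intro I.J_mult J.power_mem) auto
    moreover have "lead_wit J s n c (monom 1 (n - N) * q)"
      using lead_wit_shift[OF J q(1), of "n - N"] False by simp
    ultimately show ?thesis by (intro exI[of _ "monom 1 (n - N) * q"]) (simp add: poly_monom)
  qed
  \<comment> \<open>Subtracting a witness in the generated ideal with the same leading coefficient
    lowers the degree bound.\<close>
  have main: "poly p s \<in> gen (adj A s) G'"
    if "\<And>i. coeff p i \<in> A" "\<And>i. i \<ge> n \<Longrightarrow> coeff p i = 0" "poly p s \<in> J" for p n
    using that
  proof (induction n arbitrary: p)
    case 0
    then have "p = 0" by (simp add: poly_eq_iff)
    then show ?case by simp
  next
    case (Suc n)
    have "lead_wit J s n (coeff p n) p" using Suc.prems by (auto simp: lead_wit_def)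
    then have "coeff p n \<in> L n" by (auto simp: L_def)
    then obtain q where q: "lead_wit J s n (coeff p n) q" "poly q s \<in> gen (adj A s) G'" using low by blast
    have "poly (p - q) s \<in> gen (adj A s) G'"
    proof (rule Suc.IH)
      show "coeff (p - q) i \<in> A" for i using Suc.prems(1) q(1) by (auto simp: lead_wit_def)
      show "coeff (p - q) i = 0" if "i \<ge> n" for i
        using Suc.prems(2)[of i] q(1) that by (cases "i = n") (auto simp: lead_wit_def)
      show "poly (p - q) s \<in> J" using Suc.prems(3) q(1) by (auto simp: lead_wit_def)
    qed
    then have "poly (p - q) s + poly q s \<in> gen (adj A s) G'" using q(2) by (rule I.J_add)
    then show ?case by simp
  qed
  have "J \<subseteq> gen (adj A s) G'"
  proof
    fix x assume x: "x \<in> J"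
    then obtain p where p: "x = poly p s" "\<And>i. coeff p i \<in> A" using J.J_subset by (auto simp: adj_def)
    have "poly p s \<in> gen (adj A s) G'"
      by (rule main[of p "Suc (Polynomial.degree p)"]) (use p x in \<open>auto simp: coeff_eq_0\<close>)
    then show "x \<in> gen (adj A s) G'" using p by simp
  qed
  then have "J = gen (adj A s) G'" using J.gen_least[OF J G'(2)] by auto
  then show "\<exists>S. finite S \<and> S \<subseteq> adj A s \<and> J = gen (adj A s) S" using G' G'A by blast
qed

end

lemma (in kalg) noeth_kgen: "noeth (kgen h as)"
proof (induction as)
  case (Cons a as)
  then show ?case using subr.hilbert_basis[OF subr_kgen] by simp
qed (simp add: noeth_range)

section \<open>A criterion for the Cohen--Macaulay property\<close>

text \<open>For maximal \<open>P\<close> the Nullstellensatz provides constants that move the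
  sequence into \<open>P\<close>. Hence \<open>d\<close> is at most the grade of \<open>P\<close>,
  which is at most its height, which is at most \<open>d\<close>.\<close>

theorem Cohen_Macaulay_criterion:
  fixes h :: "'k::alg_closed_field \<Rightarrow> 'r::comm_ring_1"
  assumes "kalg A h" and A: "A = kgen h as" and dim: "kalg.trdeg_le A h d"
    and \<theta>: "length \<theta> = d" "set \<theta> \<subseteq> A"
    and reg: "\<And>\<kappa>. wreg A (map (\<lambda>i. \<theta> ! i - h (\<kappa> i)) [0..<d])"
  shows "Cohen_Macaulay (ring_on A)"
  unfolding Cohen_Macaulay_def
proof (intro conjI allI impI)
  interpret kalg A h by fact
  show "cring (ring_on A)" by (rule cring_ring_on)
  show "noetherian_ring (ring_on A)" by (rule noetherian_ring_on) (simp add: A noeth_kgen)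
  fix P assume P: "maximalideal P (ring_on A)"
  have prime: "prime_in A P" by (rule maximal_imp_prime[OF P])
  interpret P: prime_in A P by fact
  have "\<exists>\<kappa>. \<theta> ! i - h \<kappa> \<in> P" if "i < d" for i
    by (rule nullstellensatz[OF assms(1) A P]) (use \<theta> that in auto)
  then obtain \<kappa> where \<kappa>: "\<And>i. i < d \<Longrightarrow> \<theta> ! i - h (\<kappa> i) \<in> P" by metis
  define xs where "xs = map (\<lambda>i. \<theta> ! i - h (\<kappa> i)) [0..<d]"
  have xsP: "set xs \<subseteq> P" using \<kappa> by (auto simp: xs_def)
  have "gen A (set xs) \<subseteq> P" by (rule gen_least[OF P.ideal_in_axioms xsP])
  then have "gen A (set xs) \<noteq> A" using P.one_notin by blast
  then have "regular_sequence (ring_on A) xs" using reg by (simp add: regular_sequence_ring_on xs_def)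
  then have "enat (length xs) \<le> grade (ring_on A) P"
    unfolding grade_def using xsP by (intro SUP_upper) auto
  moreover have "grade (ring_on A) P \<le> prime_height (ring_on A) P" by (rule grade_le_height[OF prime])
  moreover have "prime_height (ring_on A) P \<le> enat d" by (rule prime_height_le[OF dim])
  ultimately show "grade (ring_on A) P = prime_height (ring_on A) P"
    by (simp add: xs_def)
qed

subsection \<open>Invariance under isomorphisms\<close>

locale iso_rings =
  fixes R :: "('a, 'c) ring_scheme" and S :: "('b, 'd) ring_scheme" and f
  assumes cR: "cring R" and cS: "cring S" and iso: "f \<in> ring_iso R S"
begin

definition g where "g = inv_into (carrier R) f"

lemma bij: "bij_betw f (carrier R) (carrier S)"
  using iso by (simp add: ring_iso_def)

lemma g_iso: "g \<in> ring_iso S R"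
  unfolding g_def by (rule ring_iso_set_sym[OF cring.axioms(1)[OF cR] iso])

lemma gf: "x \<in> carrier R \<Longrightarrow> g (f x) = x"
  unfolding g_def using bij by (simp add: bij_betw_inv_into_left)

lemma fg: "y \<in> carrier S \<Longrightarrow> f (g y) = y"
  unfolding g_def using bij by (simp add: bij_betw_inv_into_right)

lemma f_closed: "x \<in> carrier R \<Longrightarrow> f x \<in> carrier S"
  using ring_iso_memE(1)[OF iso] .

lemma g_closed: "y \<in> carrier S \<Longrightarrow> g y \<in> carrier R"
  using ring_iso_memE(1)[OF g_iso] .

text \<open>By this symmetry, transport of grade and height needs to be proved only as an
  inequality, and transport of ideals only in one direction.\<close>

lemma iso_rings_sym: "iso_rings S R g"
  using cR cS g_iso by (simp add: iso_rings_def)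

lemma g_hom: "ring_hom_ring S R g"
  using g_iso cR cS by (intro ring_hom_ringI2) (simp_all add: ring_iso_def cring.axioms(1))

lemma image_eq: "J \<subseteq> carrier R \<Longrightarrow> f ` J = {y \<in> carrier S. g y \<in> J}"
  using gf fg f_closed by (force intro: rev_image_eqI)

lemma image_gf: "J \<subseteq> carrier R \<Longrightarrow> g ` f ` J = J"
  using gf by (force simp: image_image)

lemma image_fg: "J \<subseteq> carrier S \<Longrightarrow> f ` g ` J = J"
  using fg by (force simp: image_image)

lemma ideal_image:
  assumes J: "ideal J R" shows "ideal (f ` J) S"
proof -
  have "J \<subseteq> carrier R" using ideal.Icarr[OF J] by auto
  then show ?thesis
    using image_eq ring_hom_ring.ideal_vimage[OF g_hom J] by simp
qed

lemma primeideal_image: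
  assumes J: "primeideal J R" shows "primeideal (f ` J) S"
proof (rule primeidealI)
  have sub: "J \<subseteq> carrier R" using ideal.Icarr[OF primeideal.axioms(1)[OF J]] by auto
  show "ideal (f ` J) S" by (rule ideal_image[OF primeideal.axioms(1)[OF J]])
  show "cring S" by (rule cS)
  show "carrier S \<noteq> f ` J"
  proof
    assume "carrier S = f ` J"
    then have "carrier R = J" using image_gf[OF sub] g_closed f_closed gf by (metis image_eqI subsetI subset_antisym image_subset_iff sub)
    then show False using primeideal.I_notcarr[OF J] by simp
  qed
  fix a b assume ab: "a \<in> carrier S" "b \<in> carrier S" "a \<otimes>\<^bsub>S\<^esub> b \<in> f ` J"
  then have "g (a \<otimes>\<^bsub>S\<^esub> b) \<in> J" using image_eq[OF sub] by auto
  then have "g a \<otimes>\<^bsub>R\<^esub> g b \<in> J" using ring_iso_memE(2)[OF g_iso] ab by simp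
  then have "g a \<in> J \<or> g b \<in> J" using primeideal.I_prime[OF J] ab g_closed by auto
  then show "a \<in> f ` J \<or> b \<in> f ` J" using image_eq[OF sub] ab by auto
qed

lemma maximalideal_image:
  assumes J: "maximalideal J R" shows "maximalideal (f ` J) S"
proof (rule maximalidealI)
  interpret bk: iso_rings S R g by (rule iso_rings_sym)
  have sub: "J \<subseteq> carrier R" using ideal.Icarr[OF maximalideal.axioms(1)[OF J]] by auto
  have car: "f ` carrier R = carrier S" "g ` carrier S = carrier R"
    using bij image_gf[of "carrier R"] by (simp_all add: bij_betw_def)
  show "ideal (f ` J) S" by (rule ideal_image[OF maximalideal.axioms(1)[OF J]])
  show "carrier S \<noteq> f ` J"
    using maximalideal.I_notcarr[OF J] image_gf[OF sub] car by metis
  fix K assume K: "ideal K S" "f ` J \<subseteq> K" "K \<subseteq> carrier S"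
  have "g ` K = J \<or> g ` K = carrier R"
  proof (rule maximalideal.I_maximal[OF J])
    show "ideal (g ` K) R" by (rule bk.ideal_image[OF K(1)])
    show "J \<subseteq> g ` K" using image_gf[OF sub] K(2) by (metis image_mono)
    show "g ` K \<subseteq> carrier R" using K(3) g_closed by auto
  qed
  then show "K = f ` J \<or> K = carrier S" using image_fg[OF K(3)] car by metis
qed

lemma genideal_image_subset:
  assumes T: "T \<subseteq> carrier R"
  shows "Idl\<^bsub>S\<^esub> (f ` T) \<subseteq> f ` (Idl\<^bsub>R\<^esub> T)"
proof (rule ring.genideal_minimal[OF cring.axioms(1)[OF cS]])
  show "ideal (f ` (Idl\<^bsub>R\<^esub> T)) S"
    by (rule ideal_image[OF ring.genideal_ideal[OF cring.axioms(1)[OF cR] T]])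
  show "f ` T \<subseteq> f ` (Idl\<^bsub>R\<^esub> T)"
    by (rule image_mono[OF ring.genideal_self[OF cring.axioms(1)[OF cR] T]])
qed

lemma genideal_image:
  assumes T: "T \<subseteq> carrier R"
  shows "Idl\<^bsub>S\<^esub> (f ` T) = f ` (Idl\<^bsub>R\<^esub> T)"
proof
  interpret bk: iso_rings S R g by (rule iso_rings_sym)
  have fT: "f ` T \<subseteq> carrier S" using T f_closed by auto
  then have sub: "Idl\<^bsub>S\<^esub> (f ` T) \<subseteq> carrier S"
    using ideal.Icarr[OF ring.genideal_ideal[OF cring.axioms(1)[OF cS]]] by blast
  have "Idl\<^bsub>R\<^esub> T \<subseteq> g ` (Idl\<^bsub>S\<^esub> (f ` T))"
    using bk.genideal_image_subset[OF fT] image_gf[OF T] by simp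
  then have "f ` (Idl\<^bsub>R\<^esub> T) \<subseteq> f ` g ` (Idl\<^bsub>S\<^esub> (f ` T))" by (rule image_mono)
  then show "f ` (Idl\<^bsub>R\<^esub> T) \<subseteq> Idl\<^bsub>S\<^esub> (f ` T)" using image_fg[OF sub] by simp
qed (rule genideal_image_subset[OF T])

lemma regular_sequence_image:
  assumes xs: "regular_sequence R xs"
  shows "regular_sequence S (map f xs)"
  unfolding regular_sequence_def
proof (intro conjI allI impI ballI)
  have sub: "set xs \<subseteq> carrier R" using xs by (simp add: regular_sequence_def)
  show "set (map f xs) \<subseteq> carrier S" using sub f_closed by auto
  have sub': "Idl\<^bsub>R\<^esub> (set xs) \<subseteq> carrier R"
    using ideal.Icarr[OF ring.genideal_ideal[OF cring.axioms(1)[OF cR] sub]] by blast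
  have "Idl\<^bsub>S\<^esub> (set (map f xs)) = f ` (Idl\<^bsub>R\<^esub> (set xs))" using genideal_image[OF sub] by simp
  moreover have "f ` carrier R = carrier S" using bij by (simp add: bij_betw_def)
  moreover have "Idl\<^bsub>R\<^esub> (set xs) \<noteq> carrier R" using xs by (simp add: regular_sequence_def)
  ultimately show "Idl\<^bsub>S\<^esub> (set (map f xs)) \<noteq> carrier S"
    using image_gf[OF sub'] image_gf[OF subset_refl] by metis
  fix i r assume i: "i < length (map f xs)" and r: "r \<in> carrier S"
    and mem: "map f xs ! i \<otimes>\<^bsub>S\<^esub> r \<in> Idl\<^bsub>S\<^esub> (set (take i (map f xs)))"
  have tk: "set (take i xs) \<subseteq> carrier R" by (rule subset_trans[OF set_take_subset sub])
  have tk': "Idl\<^bsub>R\<^esub> (set (take i xs)) \<subseteq> carrier R"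
    using ideal.Icarr[OF ring.genideal_ideal[OF cring.axioms(1)[OF cR] tk]] by blast
  have Idl: "Idl\<^bsub>S\<^esub> (set (take i (map f xs))) = {y \<in> carrier S. g y \<in> Idl\<^bsub>R\<^esub> (set (take i xs))}"
    using genideal_image[OF tk] image_eq[OF tk'] by (simp add: take_map)
  have xi: "xs ! i \<in> carrier R" using sub i by auto
  have "g (f (xs ! i) \<otimes>\<^bsub>S\<^esub> r) = xs ! i \<otimes>\<^bsub>R\<^esub> g r"
    using ring_iso_memE(2)[OF g_iso] xi r f_closed gf by simp
  then have "xs ! i \<otimes>\<^bsub>R\<^esub> g r \<in> Idl\<^bsub>R\<^esub> (set (take i xs))" using mem i by (simp add: Idl)
  then have "g r \<in> Idl\<^bsub>R\<^esub> (set (take i xs))"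
    using xs i g_closed[OF r] by (simp add: regular_sequence_def)
  then show "r \<in> Idl\<^bsub>S\<^esub> (set (take i (map f xs)))" using r by (simp add: Idl)
qed

lemma grade_image: "grade R J \<le> grade S (f ` J)"
  unfolding grade_def
proof (rule SUP_least)
  fix xs assume "xs \<in> {xs. regular_sequence R xs \<and> set xs \<subseteq> J}"
  then have "map f xs \<in> {ys. regular_sequence S ys \<and> set ys \<subseteq> f ` J}"
    using regular_sequence_image by auto
  from SUP_upper[OF this, of "\<lambda>ys. enat (length ys)"]
  show "enat (length xs) \<le> (SUP ys\<in>{ys. regular_sequence S ys \<and> set ys \<subseteq> f ` J}. enat (length ys))" by simp
qed

lemma prime_height_image: "prime_height R P \<le> prime_height S (f ` P)"
  unfolding prime_height_def
proof (rule SUP_least)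
  fix n assume "n \<in> {h. \<exists>C :: nat \<Rightarrow> _ set. (\<forall>i\<le>h. primeideal (C i) R) \<and> (\<forall>i<h. C i \<subset> C (Suc i)) \<and> C h = P}"
  then obtain C where C: "\<And>i. i \<le> n \<Longrightarrow> primeideal (C i) R" "\<And>i. i < n \<Longrightarrow> C i \<subset> C (Suc i)" "C n = P" by auto
  have sub: "C i \<subseteq> carrier R" if "i \<le> n" for i
    using ideal.Icarr[OF primeideal.axioms(1)[OF C(1)[OF that]]] by blast
  have "f ` C i \<subset> f ` C (Suc i)" if "i < n" for i
    using C(2)[OF that] image_gf[OF sub, of i] image_gf[OF sub, of "Suc i"] that
    by (metis image_mono less_imp_le_nat Suc_leI psubset_eq)
  then have "\<exists>C :: nat \<Rightarrow> _ set. (\<forall>i\<le>n. primeideal (C i) S) \<and> (\<forall>i<n. C i \<subset> C (Suc i)) \<and> C n = f ` P"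
    using C primeideal_image by (intro exI[of _ "\<lambda>i. f ` C i"]) auto
  then show "enat n \<le> (SUP h\<in>{h. \<exists>C :: nat \<Rightarrow> _ set. (\<forall>i\<le>h. primeideal (C i) S) \<and> (\<forall>i<h. C i \<subset> C (Suc i)) \<and> C h = f ` P}. enat h)"
    by (intro SUP_upper) simp
qed

theorem Cohen_Macaulay_iso:
  assumes "Cohen_Macaulay R" shows "Cohen_Macaulay S"
  unfolding Cohen_Macaulay_def
proof (intro conjI allI impI)
  interpret bk: iso_rings S R g by (rule iso_rings_sym)
  show "cring S" by (rule cS)
  show "noetherian_ring S"
  proof (rule ring.noetherian_ringI[OF cring.axioms(1)[OF cS]])
    fix J assume J: "ideal J S"
    have sub: "J \<subseteq> carrier S" using ideal.Icarr[OF J] by auto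
    have "noetherian_ring R" using assms by (simp add: Cohen_Macaulay_def)
    then obtain T where T: "T \<subseteq> carrier R" "finite T" "g ` J = Idl\<^bsub>R\<^esub> T"
      using noetherian_ring.finetely_gen[OF _ bk.ideal_image[OF J]] by blast
    have "J = Idl\<^bsub>S\<^esub> (f ` T)" using genideal_image[OF T(1)] T(3) image_fg[OF sub] by simp
    then show "\<exists>A\<subseteq>carrier S. finite A \<and> J = Idl\<^bsub>S\<^esub> A"
      using T f_closed by (intro exI[of _ "f ` T"]) auto
  qed
  fix P assume P: "maximalideal P S"
  have sub: "P \<subseteq> carrier S" using ideal.Icarr[OF maximalideal.axioms(1)[OF P]] by auto
  have "grade R (g ` P) = prime_height R (g ` P)"
    using assms bk.maximalideal_image[OF P] by (simp add: Cohen_Macaulay_def)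
  then show "grade S P = prime_height S P"
    using grade_image[of "g ` P"] bk.grade_image[of P] prime_height_image[of "g ` P"]
      bk.prime_height_image[of P] image_fg[OF sub] by simp
qed

end

section \<open>Monoid algebras\<close>

lemma poly_mapping_expand: "p = (\<Sum>k\<in>Poly_Mapping.keys p. Poly_Mapping.single k (Poly_Mapping.lookup p k))"
  by (rule poly_mapping_eqI) (auto simp: lookup_sum lookup_single when_def in_keys_iff sum.delta)

lemma lookup_mult_single:
  fixes p :: "'g::ab_group_add \<Rightarrow>\<^sub>0 'a::comm_semiring_1"
  shows "Poly_Mapping.lookup (p * Poly_Mapping.single d c) g = Poly_Mapping.lookup p (g - d) * c"
proof -
  have "p * Poly_Mapping.single d c =
      (\<Sum>k\<in>Poly_Mapping.keys p. Poly_Mapping.single (k + d) (Poly_Mapping.lookup p k * c))"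
    by (subst poly_mapping_expand[of p]) (simp add: sum_distrib_right mult_single)
  then have "Poly_Mapping.lookup (p * Poly_Mapping.single d c) g =
      (\<Sum>k\<in>Poly_Mapping.keys p. if k = g - d then Poly_Mapping.lookup p k * c else 0)"
    by (auto simp: lookup_sum lookup_single when_def algebra_simps intro!: sum.cong)
  then show ?thesis by (simp add: in_keys_iff)
qed

abbreviation kconst :: "'k::field \<Rightarrow> 'g::ab_group_add \<Rightarrow>\<^sub>0 'k" where
  "kconst \<equiv> Poly_Mapping.single 0"

abbreviation mono_at :: "'g::ab_group_add \<Rightarrow> 'g \<Rightarrow>\<^sub>0 'k::field" where
  "mono_at g \<equiv> Poly_Mapping.single g 1"

text \<open>The exponents are taken in a group, so the monoid algebra lies in a ring of Laurent
  polynomials and division by a monomial is a shift of exponents.\<close>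

definition malg :: "'g::ab_group_add set \<Rightarrow> ('g \<Rightarrow>\<^sub>0 'k::field) set" where
  "malg S = {p. Poly_Mapping.keys p \<subseteq> S}"

lemma mono_at_malg [simp]: "(mono_at g :: _ \<Rightarrow>\<^sub>0 'k::field) \<in> malg S \<longleftrightarrow> g \<in> S"
  by (simp add: malg_def)

locale submonoid =
  fixes S :: "'g::ab_group_add set"
  assumes zero_S [simp, intro]: "0 \<in> S" and add_S [intro]: "g \<in> S \<Longrightarrow> g' \<in> S \<Longrightarrow> g + g' \<in> S"

lemma (in submonoid) kalg_malg: "kalg (malg S :: ('g \<Rightarrow>\<^sub>0 'k::field) set) kconst"
proof unfold_locales
  fix p q :: "'g \<Rightarrow>\<^sub>0 'k" assume "p \<in> malg S" "q \<in> malg S"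
  then have pq: "Poly_Mapping.keys p \<subseteq> S" "Poly_Mapping.keys q \<subseteq> S" by (simp_all add: malg_def)
  then show "p + q \<in> malg S" using keys_add[of p q] by (auto simp: malg_def)
  have "Poly_Mapping.keys (p * q) \<subseteq> S" using keys_mult[of p q] pq add_S by blast
  then show "p * q \<in> malg S" by (simp add: malg_def)
next
  fix p :: "'g \<Rightarrow>\<^sub>0 'k" assume "p \<in> malg S"
  then show "- p \<in> malg S" by (auto simp: malg_def in_keys_iff)
qed (auto simp: malg_def single_add mult_single)

text \<open>Sorting the monomials of an element by their index \<open>e\<close> produces its
  coefficients. By \<open>uniq\<close> the exponent \<open>g + \<nu> e\<close> can arise from the
  index \<open>e\<close> only, which gives independence.\<close>

lemma malg_free_ext:
  fixes \<nu> :: "'e \<Rightarrow> 'g::ab_group_add"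
  assumes C: "submonoid C" and A: "submonoid A"
    and sum: "\<And>g e. g \<in> C \<Longrightarrow> e \<in> E \<Longrightarrow> g + \<nu> e \<in> A"
    and sub: "C \<subseteq> A"
    and dec: "\<And>g. g \<in> A \<Longrightarrow> \<exists>e\<in>E. g - \<nu> e \<in> C"
    and uniq: "\<And>g g' e e'. g \<in> C \<Longrightarrow> g' \<in> C \<Longrightarrow> e \<in> E \<Longrightarrow> e' \<in> E \<Longrightarrow> g + \<nu> e = g' + \<nu> e' \<Longrightarrow> e = e'"
  shows "free_ext (malg C :: ('g \<Rightarrow>\<^sub>0 'k::field) set) (malg A) E (\<lambda>e. mono_at (\<nu> e))"
proof -
  interpret C: submonoid C by fact
  interpret A: submonoid A by fact
  interpret KC: kalg "malg C :: ('g \<Rightarrow>\<^sub>0 'k) set" kconst by (rule C.kalg_malg)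
  interpret KA: kalg "malg A :: ('g \<Rightarrow>\<^sub>0 'k) set" kconst by (rule A.kalg_malg)
  show ?thesis
  proof unfold_locales
    show "(malg C :: ('g \<Rightarrow>\<^sub>0 'k) set) \<subseteq> malg A" using sub by (auto simp: malg_def)
    show "(mono_at (\<nu> e) :: 'g \<Rightarrow>\<^sub>0 'k) \<in> malg A" if "e \<in> E" for e
      using sum[OF C.zero_S that] by simp
  next
    fix r :: "'g \<Rightarrow>\<^sub>0 'k" assume r: "r \<in> malg A"
    have "\<forall>g\<in>Poly_Mapping.keys r. \<exists>e\<in>E. g - \<nu> e \<in> C" using r dec by (auto simp: malg_def)
    then obtain \<epsilon> where \<epsilon>: "\<And>g. g \<in> Poly_Mapping.keys r \<Longrightarrow> \<epsilon> g \<in> E \<and> g - \<nu> (\<epsilon> g) \<in> C" by metis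
    define D where "D = \<epsilon> ` Poly_Mapping.keys r"
    define c where "c e = (\<Sum>g\<in>{g \<in> Poly_Mapping.keys r. \<epsilon> g = e}. Poly_Mapping.single (g - \<nu> e) (Poly_Mapping.lookup r g))" for e
    have cC: "c e \<in> malg C" for e
      unfolding c_def by (intro KC.sum_mem) (use \<epsilon> in \<open>auto simp: malg_def\<close>)
    have rD: "r = (\<Sum>e\<in>D. c e * mono_at (\<nu> e))"
    proof -
      have "r = (\<Sum>g\<in>Poly_Mapping.keys r. Poly_Mapping.single g (Poly_Mapping.lookup r g))"
        by (rule poly_mapping_expand)
      also have "\<dots> = (\<Sum>e\<in>D. \<Sum>g\<in>{g \<in> Poly_Mapping.keys r. \<epsilon> g = e}. Poly_Mapping.single g (Poly_Mapping.lookup r g))"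
        unfolding D_def by (rule sum.image_gen) simp
      also have "\<dots> = (\<Sum>e\<in>D. c e * mono_at (\<nu> e))"
        by (simp add: c_def sum_distrib_right mult_single)
      finally show ?thesis .
    qed
    have D: "finite D" "D \<subseteq> E" using \<epsilon> by (auto simp: D_def)
    show "\<exists>D c. finite D \<and> D \<subseteq> E \<and> (\<forall>e\<in>D. c e \<in> malg C) \<and> r = (\<Sum>e\<in>D. c e * mono_at (\<nu> e))"
      by (intro exI[of _ D] exI[of _ c] conjI ballI D cC rD)
  next
    fix D and c :: "'e \<Rightarrow> 'g \<Rightarrow>\<^sub>0 'k" and e
    assume D: "finite D" "D \<subseteq> E" "\<And>e. e \<in> D \<Longrightarrow> c e \<in> malg C" "(\<Sum>e\<in>D. c e * mono_at (\<nu> e)) = 0" "e \<in> D"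
    show "c e = 0"
    proof (rule poly_mapping_eqI)
      fix g
      show "Poly_Mapping.lookup (c e) g = Poly_Mapping.lookup 0 g"
      proof (cases "g \<in> C")
        case True
        have other: "Poly_Mapping.lookup (c e') (g + \<nu> e - \<nu> e') = 0" if e': "e' \<in> D - {e}" for e'
        proof (rule ccontr)
          assume "Poly_Mapping.lookup (c e') (g + \<nu> e - \<nu> e') \<noteq> 0"
          then have "g + \<nu> e - \<nu> e' \<in> C" using D(3)[of e'] e' by (auto simp: malg_def in_keys_iff)
          from uniq[OF True this, of e e'] show False using e' D by auto
        qed
        have "0 = Poly_Mapping.lookup (\<Sum>e\<in>D. c e * mono_at (\<nu> e)) (g + \<nu> e)" using D(4) by simp
        also have "\<dots> = (\<Sum>e'\<in>D. Poly_Mapping.lookup (c e') (g + \<nu> e - \<nu> e'))"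
          by (simp add: lookup_sum lookup_mult_single)
        also have "\<dots> = Poly_Mapping.lookup (c e) g"
          using other by (subst sum.remove[OF D(1,5)]) simp
        finally show ?thesis by simp
      next
        case False
        then show ?thesis using D(3)[OF D(5)] by (auto simp: malg_def in_keys_iff)
      qed
    qed
  qed
qed

text \<open>\<open>\<theta>\<close> moves the index up by 1 with factor \<open>P\<close> and down by
  \<open>b\<close> with factor \<open>- Q\<close>. Among finitely many columns, row
  \<open>Max D + 1\<close> is met only by the largest index and row \<open>Min D - b\<close> only by
  the smallest one. The condition \<open>unit\<close> at the largest index makes one of these two
  entries a unit.\<close>

lemma wreg_two_sided:
  fixes v :: "int \<Rightarrow> 'r::comm_ring_1"
  assumes free: "free_ext C A E v" and xs: "wreg C xs" and \<theta>A: "\<theta> \<in> A" and \<kappa>: "\<kappa> \<in> C" and b: "b > 0"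
    and PQ: "\<And>e. e \<in> E \<Longrightarrow> P e \<in> C" "\<And>e. e \<in> E \<Longrightarrow> Q e \<in> C"
    and E: "\<And>e. e \<in> E \<Longrightarrow> P e \<noteq> 0 \<Longrightarrow> e + 1 \<in> E" "\<And>e. e \<in> E \<Longrightarrow> Q e \<noteq> 0 \<Longrightarrow> e - b \<in> E"
    and \<theta>: "\<And>e. e \<in> E \<Longrightarrow> \<theta> * v e = P e * v (e + 1) - Q e * v (e - b) - \<kappa> * v e"
    and unit: "\<And>e. e \<in> E \<Longrightarrow> P e = 1 \<or> (\<forall>e'\<in>E. e' \<le> e \<longrightarrow> Q e' \<in> {1, - 1})"
  shows "wreg A (xs @ [\<theta>])"
proof -
  interpret free_ext C A E v by fact
  define M where "M e' e = (if e' = e + 1 then P e else if e' = e - b then - Q e else if e' = e then - \<kappa> else 0)" for e' e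
  show ?thesis
  proof (rule wreg_ext_snoc[OF xs \<theta>A, where F = "\<lambda>e. {e + 1, e - b, e} \<inter> E" and M = M])
    fix e assume e: "e \<in> E"
    show "M e' e \<in> C" if "e' \<in> E" for e' using PQ[OF e] \<kappa> by (simp add: M_def)
    show M0: "M e' e = 0" if "e' \<notin> {e + 1, e - b, e} \<inter> E" for e' using that E[OF e] e b
      by (cases "P e = 0"; cases "Q e = 0") (auto simp: M_def)
    have "(\<Sum>e'\<in>{e + 1, e - b, e} \<inter> E. M e' e * v e') = (\<Sum>e'\<in>{e + 1, e - b, e}. M e' e * v e')"
    proof (rule sum.mono_neutral_left)
      show "\<forall>i\<in>{e + 1, e - b, e} - {e + 1, e - b, e} \<inter> E. M i e * v i = 0"
        using M0 by (metis Diff_iff mult_zero_left)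
    qed auto
    also have "\<dots> = P e * v (e + 1) - Q e * v (e - b) - \<kappa> * v e"
      using b by (simp add: M_def)
    finally show "\<theta> * v e = (\<Sum>e'\<in>{e + 1, e - b, e} \<inter> E. M e' e * v e')" using \<theta>[OF e] by simp
  next
    fix D assume D: "finite D" "D \<subseteq> E" "D \<noteq> {}"
    have mx: "Max D \<in> D" "Min D \<in> D" "\<And>e. e \<in> D \<Longrightarrow> e \<le> Max D" "\<And>e. e \<in> D \<Longrightarrow> Min D \<le> e"
      using D by auto
    show "\<exists>e0. \<exists>g\<in>D. M e0 g \<in> {1, - 1} \<and> (\<forall>e\<in>D - {g}. M e0 e = 0)"
    proof (cases "P (Max D) = 1")
      case True
      have "M (Max D + 1) e = 0" if "e \<in> D - {Max D}" for e
        using mx(3)[of e] that b by (auto simp: M_def)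
      then show ?thesis using True mx(1) by (intro exI[of _ "Max D + 1"] bexI[of _ "Max D"]) (auto simp: M_def)
    next
      case False
      then have "Q (Min D) \<in> {1, - 1}"
        using unit[OF subsetD[OF D(2) mx(1)]] subsetD[OF D(2) mx(2)] mx(3)[OF mx(2)] by blast
      moreover have "M (Min D - b) e = 0" if "e \<in> D - {Min D}" for e
        using mx(4)[of e] that b by (auto simp: M_def)
      ultimately show ?thesis using mx(2) b by (intro exI[of _ "Min D - b"] bexI[of _ "Min D"]) (auto simp: M_def)
    qed
  qed auto
qed

subsection \<open>Bounding algebraically independent families by counting monomials\<close>

text \<open>Gaussian elimination: one equation determines the unknown at \<open>x0\<close> by the
  others, and the remaining equations have one unknown fewer.\<close>

lemma linear_dependence:
  fixes F :: "'x \<Rightarrow> 'g \<Rightarrow> 'k::field"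
  assumes "finite V" "finite Y" "card V < card Y"
  shows "\<exists>\<kappa>. (\<exists>x\<in>Y. \<kappa> x \<noteq> 0) \<and> (\<forall>g\<in>V. (\<Sum>x\<in>Y. \<kappa> x * F x g) = 0)"
  using assms
proof (induction V arbitrary: Y F rule: finite_induct)
  case empty
  then show ?case by (intro exI[of _ "\<lambda>_. 1"]) (auto simp: card_gt_0_iff)
next
  case (insert g V)
  show ?case
  proof (cases "\<forall>x\<in>Y. F x g = 0")
    case True
    obtain \<kappa> where "\<exists>x\<in>Y. \<kappa> x \<noteq> 0" "\<forall>g\<in>V. (\<Sum>x\<in>Y. \<kappa> x * F x g) = 0"
      using insert.IH[of Y F] insert.prems insert.hyps by auto
    then show ?thesis using True by (intro exI[of _ \<kappa>]) auto
  next
    case False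
    then obtain x0 where x0: "x0 \<in> Y" "F x0 g \<noteq> 0" by auto
    define \<rho> where "\<rho> x = F x g / F x0 g" for x
    have "card V < card (Y - {x0})" using insert.prems insert.hyps x0 by simp
    then obtain \<kappa> where \<kappa>: "\<exists>x\<in>Y - {x0}. \<kappa> x \<noteq> 0" "\<forall>g\<in>V. (\<Sum>x\<in>Y - {x0}. \<kappa> x * (F x g - \<rho> x * F x0 g)) = 0"
      using insert.IH[of "Y - {x0}" "\<lambda>x g. F x g - \<rho> x * F x0 g"] insert.prems(1) by auto
    define \<kappa>' where "\<kappa>' x = (if x = x0 then - (\<Sum>x\<in>Y - {x0}. \<kappa> x * \<rho> x) else \<kappa> x)" for x
    have split: "(\<Sum>x\<in>Y. \<kappa>' x * F x g') = (\<Sum>x\<in>Y - {x0}. \<kappa> x * (F x g' - \<rho> x * F x0 g'))" for g'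
    proof -
      have "(\<Sum>x\<in>Y. \<kappa>' x * F x g') = \<kappa>' x0 * F x0 g' + (\<Sum>x\<in>Y - {x0}. \<kappa>' x * F x g')"
        using x0 insert.prems by (simp add: sum.remove)
      also have "(\<Sum>x\<in>Y - {x0}. \<kappa>' x * F x g') = (\<Sum>x\<in>Y - {x0}. \<kappa> x * F x g')"
        by (rule sum.cong) (auto simp: \<kappa>'_def)
      finally show ?thesis
        by (simp add: \<kappa>'_def sum_distrib_right sum_distrib_left sum_subtractf algebra_simps)
    qed
    have "(\<Sum>x\<in>Y. \<kappa>' x * F x g') = 0" if "g' \<in> insert g V" for g'
      unfolding split
    proof (cases "g' = g")
      case True
      then show "(\<Sum>x\<in>Y - {x0}. \<kappa> x * (F x g' - \<rho> x * F x0 g')) = 0" using x0 by (simp add: \<rho>_def)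
    qed (use \<kappa>(2) that in auto)
    moreover have "\<exists>x\<in>Y. \<kappa>' x \<noteq> 0" using \<kappa>(1) by (auto simp: \<kappa>'_def)
    ultimately show ?thesis by blast
  qed
qed

type_synonym int4 = "int \<times> int \<times> int \<times> int"

definition box :: "nat \<Rightarrow> int4 set" where
  "box N = {- int N..int N} \<times> {- int N..int N} \<times> {- int N..int N} \<times> {- int N..int N}"

lemma box_add: "g \<in> box M \<Longrightarrow> g' \<in> box N \<Longrightarrow> g + g' \<in> box (M + N)"
  by (auto simp: box_def)

lemma box_mono: "M \<le> N \<Longrightarrow> box M \<subseteq> box N"
  by (auto simp: box_def)

lemma zero_in_box: "0 \<in> box N"
  by (auto simp: box_def zero_prod_def)

lemma finite_box [simp]: "finite (box N)"
  by (simp add: box_def)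

lemma finite_subset_box: "finite K \<Longrightarrow> \<exists>N. K \<subseteq> box N"
proof (induction K rule: finite_induct)
  case (insert g K)
  then obtain N where N: "K \<subseteq> box N" by auto
  obtain p q r s where g: "g = (p, q, r, s)" by (cases g) auto
  define B where "B = nat \<bar>p\<bar> + nat \<bar>q\<bar> + nat \<bar>r\<bar> + nat \<bar>s\<bar>"
  have "g \<in> box B" by (auto simp: g box_def B_def)
  moreover have "box B \<subseteq> box (N + B)" "box N \<subseteq> box (N + B)" by (intro box_mono; simp)+
  ultimately have "insert g K \<subseteq> box (N + B)" using N by blast
  then show ?case by blast
qed auto

lemma keys_mult_box:
  "Poly_Mapping.keys p \<subseteq> box M \<Longrightarrow> Poly_Mapping.keys q \<subseteq> box N \<Longrightarrow> Poly_Mapping.keys (p * q) \<subseteq> box (M + N)"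
  using keys_mult[of p q] box_add by blast

lemma keys_power_box:
  fixes p :: "int4 \<Rightarrow>\<^sub>0 'k::field"
  assumes "Poly_Mapping.keys p \<subseteq> box M" shows "Poly_Mapping.keys (p ^ n) \<subseteq> box (n * M)"
proof (induction n)
  case 0
  then show ?case using zero_in_box by (auto simp: one_poly_mapping.rep_eq keys_def when_def split: if_splits)
next
  case (Suc n)
  then show ?case using keys_mult_box[OF assms Suc] by simp
qed

lemma keys_mon_box:
  fixes as :: "(int4 \<Rightarrow>\<^sub>0 'k::field) list"
  assumes "\<And>a. a \<in> set as \<Longrightarrow> Poly_Mapping.keys a \<subseteq> box N" "\<mu> \<in> exps m (length as)"
  shows "Poly_Mapping.keys (mon as \<mu>) \<subseteq> box (length as * (m * N))"
  using assms
proof (induction as arbitrary: \<mu>)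
  case Nil
  then show ?case using zero_in_box[of 0] by (auto simp: one_poly_mapping.rep_eq keys_def when_def split: if_splits)
next
  case (Cons a as)
  then obtain i \<mu>' where \<mu>: "\<mu> = i # \<mu>'" "i \<le> m" "\<mu>' \<in> exps m (length as)"
    by (cases \<mu>) (auto simp: exps_def)
  have "Poly_Mapping.keys (a ^ i) \<subseteq> box (i * N)" by (rule keys_power_box) (use Cons.prems in auto)
  also have "\<dots> \<subseteq> box (m * N)" using \<mu> by (intro box_mono) simp
  finally have "Poly_Mapping.keys (a ^ i * mon as \<mu>') \<subseteq> box (m * N + length as * (m * N))"
    using Cons.IH[OF _ \<mu>(3)] Cons.prems by (intro keys_mult_box) auto
  then show ?case using \<mu> by simp
qed

text \<open>Products with exponents up to \<open>m\<close> have their support in a box whose size is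
  linear in \<open>m\<close>. It meets \<open>S'\<close> in a number of points of order at most
  \<open>m ^ d\<close>, whereas the number of products is \<open>(m + 1)\<close> to the length of
  the list; if that length exceeds \<open>d\<close>, a linear dependence results.\<close>

lemma trdeg_malg:
  fixes S' :: "int4 set"
  assumes S': "submonoid S'" and count: "\<And>N. card (S' \<inter> box N) \<le> (2 * N + 1) ^ d"
  shows "kalg.trdeg_le (malg S' :: (int4 \<Rightarrow>\<^sub>0 'k::field) set) kconst d"
proof -
  interpret S': submonoid S' by fact
  interpret kalg "malg S' :: (int4 \<Rightarrow>\<^sub>0 'k) set" kconst by (rule S'.kalg_malg)
  show ?thesis
    unfolding trdeg_le_def
  proof (intro allI impI notI)
    fix as :: "(int4 \<Rightarrow>\<^sub>0 'k) list"
    assume as: "set as \<subseteq> malg S'" "d < length as" "alg_indep {0} as"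
    let ?n = "length as"
    have "finite (\<Union>a\<in>set as. Poly_Mapping.keys a)" by simp
    then obtain N where "(\<Union>a\<in>set as. Poly_Mapping.keys a) \<subseteq> box N" using finite_subset_box by blast
    then have N: "Poly_Mapping.keys a \<subseteq> box N" if "a \<in> set as" for a using that by blast
    \<comment> \<open>Chosen equal to the constant factor of the count, so that the number of
      lattice points is at most \<open>m * (m + 1) ^ d\<close>, which is less than
      \<open>(m + 1) ^ Suc d\<close>.\<close>
    define m where "m = (2 * (?n * N) + 1) ^ d"
    define V where "V = S' \<inter> box (?n * (m * N))"
    have "card V \<le> (2 * (?n * (m * N)) + 1) ^ d" unfolding V_def by (rule count)
    also have "\<dots> \<le> ((2 * (?n * N) + 1) * (m + 1)) ^ d" by (intro power_mono) (auto simp: algebra_simps)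
    also have "\<dots> = m * (m + 1) ^ d" by (subst power_mult_distrib) (simp only: m_def)
    also have "\<dots> < (m + 1) ^ Suc d" by simp
    also have "\<dots> \<le> (m + 1) ^ ?n" using as(2) by (intro power_increasing) auto
    also have "\<dots> = card (exps m ?n)" by (simp add: card_exps)
    finally have "card V < card (exps m ?n)" .
    moreover have "finite V" by (simp add: V_def)
    ultimately obtain \<kappa> where \<kappa>: "\<exists>\<mu>\<in>exps m ?n. \<kappa> \<mu> \<noteq> 0"
      "\<forall>g\<in>V. (\<Sum>\<mu>\<in>exps m ?n. \<kappa> \<mu> * Poly_Mapping.lookup (mon as \<mu>) g) = 0"
      using linear_dependence[of V "exps m ?n" "\<lambda>\<mu>. Poly_Mapping.lookup (mon as \<mu>)"] by auto
    have "Poly_Mapping.lookup (mon as \<mu>) g = 0" if "g \<notin> V" "\<mu> \<in> exps m ?n" for g \<mu>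
    proof -
      have "mon as \<mu> \<in> malg S'" using as(1) by (rule mon_mem)
      moreover have "Poly_Mapping.keys (mon as \<mu>) \<subseteq> box (?n * (m * N))"
        by (rule keys_mon_box) (use N that in auto)
      ultimately have "g \<notin> Poly_Mapping.keys (mon as \<mu>)" using that(1) by (auto simp: V_def malg_def)
      then show ?thesis by (simp add: in_keys_iff)
    qed
    then have "(\<Sum>\<mu>\<in>exps m ?n. \<kappa> \<mu> * Poly_Mapping.lookup (mon as \<mu>) g) = 0" for g
      using \<kappa>(2) by (cases "g \<in> V") (auto intro!: sum.neutral)
    then have "(\<Sum>\<mu>\<in>exps m ?n. kconst (\<kappa> \<mu>) * mon as \<mu>) = 0"
      by (intro poly_mapping_eqI) (simp add: lookup_sum mult.commute[of "kconst _"] lookup_mult_single mult.commute)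
    then show False using as(3) \<kappa>(1) unfolding alg_indep_def by blast
  qed
qed

section \<open>The monoid of the Rees algebra\<close>

definition neg :: "int \<Rightarrow> int" where "neg e = max 0 (- e)"

text \<open>The ceiling of \<open>- e / m\<close>, cut off at zero: the least number of generators
  needed to reach the index \<open>e\<close> when each of them lowers the index by at most
  \<open>m\<close>.\<close>

definition up :: "nat \<Rightarrow> int \<Rightarrow> int" where "up m e = max 0 (- (e div int m))"

lemma neg_add: "neg (e + e') \<le> neg e + neg e'"
  by (simp add: neg_def)

lemma neg_ge: "- e \<le> neg e"
  by (simp add: neg_def)

text \<open>A Galois connection for the ceiling; subadditivity of \<open>up\<close> is read off from
  it without returning to division.\<close>

lemma up_le_iff:
  assumes "m \<ge> 1" shows "up m e \<le> w \<longleftrightarrow> 0 \<le> w \<and> - e \<le> int m * w"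
proof -
  define d where "d = int m"
  have d: "d \<ge> 1" using assms by (simp add: d_def)
  define q where "q = e div d"
  have e: "e = d * q + e mod d" "0 \<le> e mod d" "e mod d < d" using d by (simp_all add: q_def)
  have "- q \<le> w \<longleftrightarrow> - e \<le> d * w"
  proof
    assume "- q \<le> w"
    then have "d * (- q) \<le> d * w" using d by (intro mult_left_mono) auto
    then show "- e \<le> d * w" using e by simp
  next
    assume *: "- e \<le> d * w"
    show "- q \<le> w"
    proof (rule ccontr)
      assume "\<not> - q \<le> w"
      then have "d * w \<le> d * (- q - 1)" using d by (intro mult_left_mono) auto
      then show False using * e by (simp add: algebra_simps)
    qed
  qed
  then show ?thesis by (auto simp: up_def q_def d_def)
qed

lemma up_nonneg [simp]: "up m e \<ge> 0"
  by (simp add: up_def)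

lemma up_ge: "m \<ge> 1 \<Longrightarrow> - e \<le> int m * up m e"
  using up_le_iff[of m e "up m e"] by simp

lemma up_add: "m \<ge> 1 \<Longrightarrow> up m (e + e') \<le> up m e + up m e'"
  using up_ge[of m e] up_ge[of m e'] by (simp add: up_le_iff algebra_simps)

lemma up_of_nonneg [simp]: "e \<ge> 0 \<Longrightarrow> up m e = 0"
  by (simp add: up_def pos_imp_zdiv_nonneg_iff div_int_pos_iff)

lemma up_diff: "m \<ge> 1 \<Longrightarrow> e \<le> 0 \<Longrightarrow> up m (e - int m) = up m e + 1"
proof -
  assume m: "m \<ge> 1" "e \<le> 0"
  have "(e - int m) div int m = e div int m - 1"
    using div_add_self2[of "int m" "e - int m"] m by simp
  moreover have "e div int m \<le> 0" using zdiv_mono1[of e 0 "int m"] m by simp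
  ultimately show ?thesis by (simp add: up_def)
qed

lemma up_eq_1: "m \<ge> 1 \<Longrightarrow> - int m \<le> e \<Longrightarrow> e < 0 \<Longrightarrow> up m e = 1"
  using up_le_iff[of m e 1] up_le_iff[of m e 0] by linarith

locale two_blocks =
  fixes a b :: nat
  assumes a_pos: "a \<ge> 1" and b_pos: "b \<ge> 1"
begin

text \<open>Coordinates: the exponent lattice of \<open>k[x, y, z, T]\<close> has the basis \<open>x\<close>, \<open>y\<close>, \<open>z\<close>,
  \<open>t\<^sub>0 = x\<^sup>a y\<^sup>b T\<close>. In it \<open>pt i\<close> is \<open>t\<^sub>i = f\<^sub>i T\<close>. The exponent \<open>u e\<close> is \<open>x\<^sup>e\<close> for \<open>e \<ge> 0\<close> and
  \<open>t\<^sub>i t\<^sub>a\<^sup>g\<close> for \<open>e = - (g a + i)\<close> with \<open>1 \<le> i \<le> a\<close>; likewise \<open>v f\<close> is \<open>y\<^sup>f\<close> or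
  \<open>t\<^bsub>a+j\<^esub> t\<^bsub>a+b\<^esub>\<^sup>g\<close> for \<open>f = - (g b + j)\<close> with \<open>1 \<le> j \<le> b\<close>.\<close>

definition u :: "int \<Rightarrow> int4" where "u e = (e, 0, neg e, up a e)"

definition v :: "int \<Rightarrow> int4" where
  "v f = (- (int a * up b f), f, int a * up b f + neg f, up b f)"

definition pt :: "nat \<Rightarrow> int4" where
  "pt i = (- int (min i a), - int (i - a), int i, 1)"

text \<open>\<open>SZ\<close> and \<open>SU\<close> belong to k[z] and
  k[z, \<open>t\<^sub>0\<close>], \<open>S1\<close> to the algebra that also contains the first
  block, and \<open>SA\<close> to the Rees algebra. The inequalities for \<open>SA\<close> say that
  removing \<open>v q\<close> and then \<open>u (p + int a * up b q)\<close> leaves an exponent in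
  \<open>SU\<close>.\<close>

definition SZ :: "int4 set" where "SZ = {(p, q, r, s). p = 0 \<and> q = 0 \<and> 0 \<le> r \<and> s = 0}"
definition SU :: "int4 set" where "SU = {(p, q, r, s). p = 0 \<and> q = 0 \<and> 0 \<le> r \<and> 0 \<le> s}"
definition S1 :: "int4 set" where "S1 = {(p, q, r, s). q = 0 \<and> neg p \<le> r \<and> up a p \<le> s}"
definition SA :: "int4 set" where
  "SA = {(p, q, r, s). neg (p + int a * up b q) + int a * up b q + neg q \<le> r
                      \<and> up a (p + int a * up b q) + up b q \<le> s}"

text \<open>The degree in x, y, z minus a + b times the degree in T. It is 1 on the variables and 0
  on every \<open>pt i\<close>, so the monomials in the generators alone have excess 0.\<close>

definition excess :: "int4 \<Rightarrow> int" where "excess = (\<lambda>(p, q, r, s). p + q + r)"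

definition FS :: "int4 set" where "FS = SU \<inter> {g. excess g = 0}"
definition F1 :: "int4 set" where "F1 = S1 \<inter> {g. excess g = 0}"
definition FA :: "int4 set" where "FA = SA \<inter> {g. excess g = 0}"

lemmas S_defs = SZ_def SU_def S1_def SA_def FS_def F1_def FA_def zero_prod_def

lemma excess_add [simp]: "excess (g + g') = excess g + excess g'"
  by (auto simp: excess_def split: prod.splits)

lemma excess_0 [simp]: "excess 0 = 0"
  by (simp add: excess_def zero_prod_def)

lemma submonoid_zero: "submonoid {0 :: int4}"
  by unfold_locales auto

lemma submonoid_SZ: "submonoid SZ" and submonoid_SU: "submonoid SU"
  by unfold_locales (auto simp: S_defs)

lemma submonoid_S1: "submonoid S1"
proof unfold_locales
  fix g g' assume "g \<in> S1" "g' \<in> S1"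
  then show "g + g' \<in> S1"
    using neg_add[of "fst g" "fst g'"] up_add[OF a_pos, of "fst g" "fst g'"] by (auto simp: S_defs)
qed (auto simp: S_defs neg_def)

text \<open>Subadditivity of \<open>up b\<close> leaves a slack \<open>\<delta>\<close>, which
  shifts the argument of \<open>neg\<close> and \<open>up a\<close> down by
  \<open>int a * \<delta>\<close>. This costs at most \<open>int a * \<delta>\<close> in the third
  coordinate and \<open>\<delta>\<close> in the fourth, exactly what is saved in the terms with
  \<open>up b\<close>.\<close>

lemma submonoid_SA: "submonoid SA"
proof unfold_locales
  fix g g' assume gg': "g \<in> SA" "g' \<in> SA"
  obtain p q r s p' q' r' s' where g: "g = (p, q, r, s)" "g' = (p', q', r', s')"
    by (cases g; cases g') auto
  define w where "w = up b q"
  define w' where "w' = up b q'"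
  define w'' where "w'' = up b (q + q')"
  define \<delta> where "\<delta> = w + w' - w''"
  have \<delta>: "\<delta> \<ge> 0" using up_add[OF b_pos, of q q'] by (simp add: \<delta>_def w_def w'_def w''_def)
  define d where "d = (p + int a * w) + (p' + int a * w')"
  have d: "p + p' + int a * w'' = d + (- (int a * \<delta>))"
    by (simp add: d_def \<delta>_def algebra_simps)
  have a\<delta>: "0 \<le> int a * \<delta>" using \<delta> by simp
  have n1: "neg (p + p' + int a * w'') \<le> neg d + int a * \<delta>"
    unfolding d using neg_add[of d "- (int a * \<delta>)"] a\<delta> by (simp add: neg_def)
  have n2: "neg d \<le> neg (p + int a * w) + neg (p' + int a * w')"
    unfolding d_def by (rule neg_add)
  have "up a (- (int a * \<delta>)) \<le> \<delta>" using \<delta> up_le_iff[OF a_pos] by simp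
  then have n3: "up a (p + p' + int a * w'') \<le> up a d + \<delta>"
    unfolding d using up_add[OF a_pos, of d "- (int a * \<delta>)"] by simp
  have n4: "up a d \<le> up a (p + int a * w) + up a (p' + int a * w')"
    unfolding d_def by (rule up_add[OF a_pos])
  have h: "neg (p + int a * w) + int a * w + neg q \<le> r" "up a (p + int a * w) + w \<le> s"
    "neg (p' + int a * w') + int a * w' + neg q' \<le> r'" "up a (p' + int a * w') + w' \<le> s'"
    using gg' by (auto simp: g S_defs w_def w'_def)
  have "int a * \<delta> = int a * w + int a * w' - int a * w''" by (simp add: \<delta>_def algebra_simps)
  then have "neg (p + p' + int a * w'') + int a * w'' + neg (q + q') \<le> r + r'"
    using n1 n2 h neg_add[of q q'] by linarith
  moreover have "up a (p + p' + int a * w'') + w'' \<le> s + s'"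
    using n3 n4 h by (simp add: \<delta>_def)
  ultimately show "g + g' \<in> SA" by (simp add: g S_defs w''_def)
qed (auto simp: S_defs neg_def)

lemma submonoid_FS: "submonoid FS" and submonoid_F1: "submonoid F1" and submonoid_FA: "submonoid FA"
  using submonoid_SU submonoid_S1 submonoid_SA
  by (auto simp: submonoid_def FS_def F1_def FA_def)

lemma excess_nonneg: "g \<in> SA \<Longrightarrow> excess g \<ge> 0"
proof -
  assume g: "g \<in> SA"
  obtain p q r s where "g = (p, q, r, s)" by (cases g) auto
  then show ?thesis
    using g neg_ge[of "p + int a * up b q"] neg_ge[of q] by (auto simp: SA_def excess_def)
qed

text \<open>A product of basis monomials is again a basis monomial up to a factor from the base
  ring; the difference is the exponent of this factor.\<close>

lemma uu: "u e + u e' - u (e + e') \<in> SU"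
  using neg_add[of e e'] up_add[OF a_pos, of e e'] by (auto simp: u_def S_defs)

lemma vv: "v f + v f' - v (f + f') \<in> S1"
proof -
  define \<delta> where "\<delta> = up b f + up b f' - up b (f + f')"
  have \<delta>: "\<delta> \<ge> 0" using up_add[OF b_pos, of f f'] by (simp add: \<delta>_def)
  have "v f + v f' - v (f + f') = (- (int a * \<delta>), 0, int a * \<delta> + (neg f + neg f' - neg (f + f')), \<delta>)"
    by (simp add: v_def \<delta>_def algebra_simps)
  moreover have "neg (- (int a * \<delta>)) = int a * \<delta>" using \<delta> by (simp add: neg_def)
  moreover have "up a (- (int a * \<delta>)) \<le> \<delta>" using \<delta> up_le_iff[OF a_pos] by simp
  ultimately show ?thesis using neg_add[of f f'] by (auto simp: S1_def)
qed

lemma excess_u: "e \<le> 0 \<Longrightarrow> excess (u e) = 0" and excess_v: "f \<le> 0 \<Longrightarrow> excess (v f) = 0"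
  by (auto simp: excess_def u_def v_def neg_def)

subsection \<open>Regular sequences\<close>

lemma free_Z: "free_ext (malg {0} :: (int4 \<Rightarrow>\<^sub>0 'k::field) set) (malg SZ) {0..} (\<lambda>e. mono_at (0, 0, e, 0))"
proof (rule malg_free_ext[OF submonoid_zero submonoid_SZ])
  show "\<exists>e\<in>{0..}. g - (0, 0, e, 0) \<in> {0}" if "g \<in> SZ" for g
    using that by (intro bexI[of _ "fst (snd (snd g))"]) (auto simp: S_defs)
qed (auto simp: S_defs)

lemma free_U: "free_ext (malg SZ :: (int4 \<Rightarrow>\<^sub>0 'k::field) set) (malg SU) {0..} (\<lambda>e. mono_at (0, 0, 0, e))"
proof (rule malg_free_ext[OF submonoid_SZ submonoid_SU])
  show "\<exists>e\<in>{0..}. g - (0, 0, 0, e) \<in> SZ" if "g \<in> SU" for g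
    using that by (intro bexI[of _ "snd (snd (snd g))"]) (auto simp: S_defs)
qed (auto simp: S_defs)

lemma free_1: "free_ext (malg SU :: (int4 \<Rightarrow>\<^sub>0 'k::field) set) (malg S1) UNIV (\<lambda>e. mono_at (u e))"
proof (rule malg_free_ext[OF submonoid_SU submonoid_S1])
  show "\<exists>e\<in>UNIV. g - u e \<in> SU" if "g \<in> S1" for g
    using that by (intro bexI[of _ "fst g"]) (auto simp: S_defs u_def)
qed (auto simp: S_defs u_def neg_def)

lemma free_A: "free_ext (malg S1 :: (int4 \<Rightarrow>\<^sub>0 'k::field) set) (malg SA) UNIV (\<lambda>f. mono_at (v f))"
proof (rule malg_free_ext[OF submonoid_S1 submonoid_SA])
  show "\<exists>e\<in>UNIV. g - v e \<in> S1" if "g \<in> SA" for g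
    using that by (intro bexI[of _ "fst (snd g)"]) (auto simp: S_defs v_def)
qed (auto simp: S_defs v_def neg_def)

lemma free_FS: "free_ext (malg {0} :: (int4 \<Rightarrow>\<^sub>0 'k::field) set) (malg FS) {0..} (\<lambda>e. mono_at (0, 0, 0, e))"
proof (rule malg_free_ext[OF submonoid_zero submonoid_FS])
  show "\<exists>e\<in>{0..}. g - (0, 0, 0, e) \<in> {0}" if "g \<in> FS" for g
    using that by (intro bexI[of _ "snd (snd (snd g))"]) (auto simp: S_defs excess_def)
qed (auto simp: S_defs excess_def)

text \<open>For positive \<open>e\<close> the monomial \<open>u e\<close> has excess
  \<open>e\<close>. Hence only the indices up to 0 remain in the special fiber, and a single
  generator instead of a difference serves as parameter.\<close>

lemma free_F1: "free_ext (malg FS :: (int4 \<Rightarrow>\<^sub>0 'k::field) set) (malg F1) {..0} (\<lambda>e. mono_at (u e))"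
proof (rule malg_free_ext[OF submonoid_FS submonoid_F1])
  show "\<exists>e\<in>{..0}. g - u e \<in> FS" if "g \<in> F1" for g
    using that by (intro bexI[of _ "fst g"]) (auto simp: S_defs u_def excess_def neg_def)
qed (auto simp: S_defs u_def neg_def excess_def)

lemma free_FA: "free_ext (malg F1 :: (int4 \<Rightarrow>\<^sub>0 'k::field) set) (malg FA) {..0} (\<lambda>f. mono_at (v f))"
proof (rule malg_free_ext[OF submonoid_F1 submonoid_FA])
  show "\<exists>e\<in>{..0}. g - v e \<in> F1" if "g \<in> FA" for g
    using that by (intro bexI[of _ "fst (snd g)"]) (auto simp: S_defs v_def excess_def neg_def)
qed (auto simp: S_defs v_def neg_def excess_def)

lemma mono_at_diff:
  assumes "submonoid S" "p \<in> malg S" "q \<in> malg S"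
  shows "p - q \<in> (malg S :: (int4 \<Rightarrow>\<^sub>0 'k::field) set)"
proof -
  interpret kalg "malg S :: (int4 \<Rightarrow>\<^sub>0 'k) set" kconst by (rule submonoid.kalg_malg) fact
  show ?thesis using assms by simp
qed

lemma kconst_malg: "submonoid S \<Longrightarrow> kconst \<kappa> \<in> (malg S :: (int4 \<Rightarrow>\<^sub>0 'k::field) set)"
  using submonoid.zero_S by (auto simp: malg_def)

lemma wreg_up:
  fixes \<nu> :: "int \<Rightarrow> int4" and xs :: "(int4 \<Rightarrow>\<^sub>0 'k::field) list"
  assumes free: "free_ext (malg C :: (int4 \<Rightarrow>\<^sub>0 'k::field) set) (malg A) {0..} (\<lambda>e. mono_at (\<nu> e))"
    and C: "submonoid C" and A: "submonoid A"
    and xs: "wreg (malg C) xs" and "\<nu> 1 \<in> A" and \<nu>: "\<And>e. e \<ge> 0 \<Longrightarrow> \<nu> (e + 1) = \<nu> 1 + \<nu> e"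
  shows "wreg (malg A) (xs @ [mono_at (\<nu> 1) - kconst \<kappa>])"
  by (rule wreg_two_sided[OF free xs, where b = 1 and P = "\<lambda>_. 1" and Q = "\<lambda>_. 0" and \<kappa> = "kconst \<kappa>"])
    (use assms submonoid.zero_S[OF C] in
      \<open>auto simp: left_diff_distrib mult_single kconst_malg malg_def[of C] intro!: mono_at_diff[OF A]\<close>)

lemma wreg_down:
  fixes \<nu> :: "int \<Rightarrow> int4" and xs :: "(int4 \<Rightarrow>\<^sub>0 'k::field) list"
  assumes free: "free_ext (malg C :: (int4 \<Rightarrow>\<^sub>0 'k::field) set) (malg A) {..0} (\<lambda>e. mono_at (\<nu> e))"
    and C: "submonoid C" and A: "submonoid A"
    and xs: "wreg (malg C) xs" and m: "m > 0"
    and \<nu>A: "\<nu> (- m) \<in> A" and \<nu>: "\<And>e. e \<le> 0 \<Longrightarrow> \<nu> (e - m) = \<nu> (- m) + \<nu> e"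
  shows "wreg (malg A) (xs @ [mono_at (\<nu> (- m)) - kconst \<kappa>])"
proof -
  interpret KC: kalg "malg C :: (int4 \<Rightarrow>\<^sub>0 'k) set" kconst by (rule submonoid.kalg_malg[OF C])
  interpret KA: kalg "malg A :: (int4 \<Rightarrow>\<^sub>0 'k) set" kconst by (rule submonoid.kalg_malg[OF A])
  show ?thesis
    \<comment> \<open>The general form subtracts the downward term, whence the value
      \<open>- 1\<close> of \<open>Q\<close>.\<close>
    by (rule wreg_two_sided[OF free xs, where b = m and P = "\<lambda>_. 0" and Q = "\<lambda>_. - 1" and \<kappa> = "kconst \<kappa>"])
      (use \<nu>A \<nu> m in \<open>auto simp: left_diff_distrib mult_single\<close>)
qed

text \<open>The cocycle of the basis provides the factors \<open>P\<close> and \<open>Q\<close>.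
  Raising is exact for \<open>e\<close> at least 0. For negative \<open>e\<close> every index below
  it is negative too, and lowering is exact there.\<close>

lemma wreg_both:
  fixes \<nu> :: "int \<Rightarrow> int4" and xs :: "(int4 \<Rightarrow>\<^sub>0 'k::field) list"
  assumes free: "free_ext (malg C :: (int4 \<Rightarrow>\<^sub>0 'k::field) set) (malg A) UNIV (\<lambda>e. mono_at (\<nu> e))"
    and C: "submonoid C" and A: "submonoid A"
    and xs: "wreg (malg C) xs" and m: "m > 0"
    and \<nu>A: "\<nu> 1 \<in> A" "\<nu> (- m) \<in> A"
    and cocycle: "\<And>e e'. \<nu> e + \<nu> e' - \<nu> (e + e') \<in> C"
    and \<nu>: "\<And>e. e \<ge> 0 \<Longrightarrow> \<nu> (e + 1) = \<nu> 1 + \<nu> e" "\<And>e. e \<le> 0 \<Longrightarrow> \<nu> (e - m) = \<nu> (- m) + \<nu> e"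
  shows "wreg (malg A) (xs @ [mono_at (\<nu> 1) - mono_at (\<nu> (- m)) - kconst \<kappa>])"
proof -
  interpret KC: kalg "malg C :: (int4 \<Rightarrow>\<^sub>0 'k) set" kconst by (rule submonoid.kalg_malg[OF C])
  interpret KA: kalg "malg A :: (int4 \<Rightarrow>\<^sub>0 'k) set" kconst by (rule submonoid.kalg_malg[OF A])
  show ?thesis
  proof (rule wreg_two_sided[OF free xs, where b = m and \<kappa> = "kconst \<kappa>"
        and P = "\<lambda>e. mono_at (\<nu> 1 + \<nu> e - \<nu> (e + 1))" and Q = "\<lambda>e. mono_at (\<nu> (- m) + \<nu> e - \<nu> (e - m))"])
    fix e
    show "(mono_at (\<nu> 1 + \<nu> e - \<nu> (e + 1)) :: int4 \<Rightarrow>\<^sub>0 'k) \<in> malg C"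
      using cocycle[of 1 e] by (simp add: add.commute)
    show "(mono_at (\<nu> (- m) + \<nu> e - \<nu> (e - m)) :: int4 \<Rightarrow>\<^sub>0 'k) \<in> malg C"
      using cocycle[of "- m" e] by simp
    show "(mono_at (\<nu> 1) - mono_at (\<nu> (- m)) - kconst \<kappa>) * mono_at (\<nu> e) =
      mono_at (\<nu> 1 + \<nu> e - \<nu> (e + 1)) * mono_at (\<nu> (e + 1)) -
      mono_at (\<nu> (- m) + \<nu> e - \<nu> (e - m)) * mono_at (\<nu> (e - m)) - kconst \<kappa> * mono_at (\<nu> e)"
      by (simp add: left_diff_distrib mult_single)
    show "(mono_at (\<nu> 1 + \<nu> e - \<nu> (e + 1)) :: int4 \<Rightarrow>\<^sub>0 'k) = 1 \<or>
      (\<forall>e'\<in>UNIV. e' \<le> e \<longrightarrow> (mono_at (\<nu> (- m) + \<nu> e' - \<nu> (e' - m)) :: int4 \<Rightarrow>\<^sub>0 'k) \<in> {1, - 1})"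
    proof (cases "e \<ge> 0")
      case False
      then show ?thesis using \<nu>(2) by simp
    qed (simp add: \<nu>(1))
  qed (use \<nu>A m in auto)
qed

lemma u_up: "e \<ge> 0 \<Longrightarrow> u (e + 1) = u 1 + u e" and v_up: "f \<ge> 0 \<Longrightarrow> v (f + 1) = v 1 + v f"
  by (simp_all add: u_def v_def neg_def)

lemma u_down: "e \<le> 0 \<Longrightarrow> u (e - int a) = u (- int a) + u e"
  using up_diff[OF a_pos, of e] up_diff[OF a_pos, of 0] by (simp add: u_def neg_def)

lemma v_down: "f \<le> 0 \<Longrightarrow> v (f - int b) = v (- int b) + v f"
  using up_diff[OF b_pos, of f] up_diff[OF b_pos, of 0] by (simp add: v_def neg_def algebra_simps)

lemma u_mem: "u e \<in> S1" and v_mem: "v f \<in> SA"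
  by (auto simp: u_def v_def S1_def SA_def neg_def)

lemma S_subsets: "SU \<subseteq> S1" "S1 \<subseteq> SA" "F1 \<subseteq> FA"
proof -
  show "SU \<subseteq> S1" by (auto simp: S_defs neg_def)
  show "S1 \<subseteq> SA" by (auto simp: S_defs neg_def)
  then show "F1 \<subseteq> FA" by (auto simp: FA_def F1_def)
qed

definition regs :: "(nat \<Rightarrow> 'k::field) \<Rightarrow> (int4 \<Rightarrow>\<^sub>0 'k) list" where
  "regs \<kappa> = [mono_at (0, 0, 1, 0) - kconst (\<kappa> 0), mono_at (0, 0, 0, 1) - kconst (\<kappa> 1),
    mono_at (u 1) - mono_at (u (- int a)) - kconst (\<kappa> 2),
    mono_at (v 1) - mono_at (v (- int b)) - kconst (\<kappa> 3)]"

theorem wreg_rees: "wreg (malg SA) (regs \<kappa> :: (int4 \<Rightarrow>\<^sub>0 'k::field) list)"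
proof -
  have "wreg (malg SZ) ([] @ [mono_at (0, 0, 1, 0) - kconst (\<kappa> 0)])"
    by (rule wreg_up[OF free_Z submonoid_zero submonoid_SZ]) (auto simp: S_defs)
  from wreg_up[OF free_U submonoid_SZ submonoid_SU this, of "\<kappa> 1"]
  have "wreg (malg SU) ([mono_at (0, 0, 1, 0) - kconst (\<kappa> 0)] @ [mono_at (0, 0, 0, 1) - kconst (\<kappa> 1)])"
    by (auto simp: S_defs)
  from wreg_both[OF free_1 submonoid_SU submonoid_S1 this, of "int a" "\<kappa> 2"]
  have "wreg (malg S1) ([mono_at (0, 0, 1, 0) - kconst (\<kappa> 0), mono_at (0, 0, 0, 1) - kconst (\<kappa> 1)] @
    [mono_at (u 1) - mono_at (u (- int a)) - kconst (\<kappa> 2)])"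
    using a_pos u_mem uu u_up u_down by simp
  from wreg_both[OF free_A submonoid_S1 submonoid_SA this, of "int b" "\<kappa> 3"]
  show ?thesis
    using b_pos v_mem vv v_up v_down by (simp add: regs_def)
qed

theorem wreg_fiber:
  "wreg (malg FA) ([mono_at (0, 0, 0, 1) - kconst (\<kappa> 0), mono_at (u (- int a)) - kconst (\<kappa> 1),
    mono_at (v (- int b)) - kconst (\<kappa> 2)] :: (int4 \<Rightarrow>\<^sub>0 'k::field) list)"
proof -
  have "wreg (malg FS) ([] @ [mono_at (0, 0, 0, 1) - kconst (\<kappa> 0)])"
    by (rule wreg_up[OF free_FS submonoid_zero submonoid_FS]) (auto simp: S_defs excess_def)
  from wreg_down[OF free_F1 submonoid_FS submonoid_F1 this, of "int a" "\<kappa> 1"]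
  have "wreg (malg F1) ([mono_at (0, 0, 0, 1) - kconst (\<kappa> 0)] @ [mono_at (u (- int a)) - kconst (\<kappa> 1)])"
    using a_pos u_mem u_down excess_u[of "- int a"] by (simp add: F1_def)
  from wreg_down[OF free_FA submonoid_F1 submonoid_FA this, of "int b" "\<kappa> 2"]
  show ?thesis
    using b_pos v_mem v_down excess_v[of "- int b"] by (simp add: FA_def)
qed

subsection \<open>Generators\<close>

lemma pt_0: "pt 0 = (0, 0, 0, 1)"
  by (simp add: pt_def)

lemma pt_u: "1 \<le> i \<Longrightarrow> i \<le> a \<Longrightarrow> pt i = u (- int i)"
  using up_eq_1[OF a_pos, of "- int i"] by (simp add: pt_def u_def neg_def)

lemma pt_v: "1 \<le> j \<Longrightarrow> j \<le> b \<Longrightarrow> pt (a + j) = v (- int j)"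
  using up_eq_1[OF b_pos, of "- int j"] by (simp add: pt_def v_def neg_def)

lemma pt_mem: "i \<le> a + b \<Longrightarrow> pt i \<in> FA"
proof -
  assume i: "i \<le> a + b"
  consider "i = 0" | "1 \<le> i" "i \<le> a" | j where "i = a + j" "1 \<le> j" "j \<le> b"
    using i by (metis add_le_cancel_left le_add_diff_inverse less_one nat_le_linear not_less_eq_eq One_nat_def not_le)
  then show ?thesis
  proof cases
    case 1
    then show ?thesis by (simp add: pt_0 FA_def SA_def excess_def neg_def)
  next
    case 2
    then show ?thesis using u_mem[of "- int i"] S_subsets excess_u[of "- int i"] by (auto simp: pt_u FA_def)
  next
    case 3
    then show ?thesis using v_mem[of "- int j"] excess_v[of "- int j"] by (auto simp: pt_v FA_def)
  qed
qed

lemma submonoid_generation_u: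
  assumes "submonoid G" "\<And>i. i \<le> a \<Longrightarrow> pt i \<in> G" "e \<ge> 0 \<Longrightarrow> (1, 0, 0, 0) \<in> G"
  shows "u e \<in> G"
proof -
  interpret submonoid G by fact
  show ?thesis
  proof (cases "e \<ge> 0")
    case True
    have "u (int n) \<in> G" for n
    proof (induction n)
      case 0
      then show ?case using zero_S by (simp add: u_def neg_def zero_prod_def)
    next
      case (Suc n)
      have "u 1 \<in> G" using assms(3) True by (simp add: u_def neg_def)
      then show ?case using u_up[of "int n"] Suc by (auto simp: add.commute)
    qed
    from this[of "nat e"] show ?thesis using True by simp
  next
    case False
    have "u (- int (n + 1)) \<in> G" for n
    proof (induction n rule: less_induct)
      case (less n)
      show ?case
      proof (cases "n + 1 \<le> a")
        case True
        then show ?thesis using pt_u[of "n + 1"] assms(2)[of "n + 1"] by simp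
      next
        case False
        \<comment> \<open>Beyond the first \<open>a\<close> negative indices a whole factor
          \<open>pt a\<close> can be split off.\<close>
        then have "u (- int (n + 1)) = u (- int a) + u (- int (n - a + 1))"
          using u_down[of "- int (n - a + 1)"] by (simp add: of_nat_diff algebra_simps)
        moreover have "u (- int a) \<in> G" using pt_u[of a] a_pos assms(2)[of a] by simp
        moreover have "u (- int (n - a + 1)) \<in> G" using less[of "n - a"] False a_pos by simp
        ultimately show ?thesis by auto
      qed
    qed
    from this[of "nat (- e - 1)"] show ?thesis using False by simp
  qed
qed

lemma submonoid_generation_v:
  assumes "submonoid G" "\<And>i. i \<le> a + b \<Longrightarrow> pt i \<in> G" "f \<ge> 0 \<Longrightarrow> (0, 1, 0, 0) \<in> G"
  shows "v f \<in> G"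
proof -
  interpret submonoid G by fact
  show ?thesis
  proof (cases "f \<ge> 0")
    case True
    have "v (int n) \<in> G" for n
    proof (induction n)
      case 0
      then show ?case using zero_S by (simp add: v_def neg_def zero_prod_def)
    next
      case (Suc n)
      have "v 1 \<in> G" using assms(3) True by (simp add: v_def neg_def)
      then show ?case using v_up[of "int n"] Suc by (auto simp: add.commute)
    qed
    from this[of "nat f"] show ?thesis using True by simp
  next
    case False
    have "v (- int (n + 1)) \<in> G" for n
    proof (induction n rule: less_induct)
      case (less n)
      show ?case
      proof (cases "n + 1 \<le> b")
        case True
        then show ?thesis using pt_v[of "n + 1"] assms(2)[of "a + (n + 1)"] by simp
      next
        case False
        then have "v (- int (n + 1)) = v (- int b) + v (- int (n - b + 1))"
          using v_down[of "- int (n - b + 1)"] by (simp add: of_nat_diff algebra_simps)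
        moreover have "v (- int b) \<in> G" using pt_v[of b] b_pos assms(2)[of "a + b"] by simp
        moreover have "v (- int (n - b + 1)) \<in> G" using less[of "n - b"] False b_pos by simp
        ultimately show ?thesis by auto
      qed
    qed
    from this[of "nat (- f - 1)"] show ?thesis using False by simp
  qed
qed

lemma submonoid_generation_0:
  assumes "submonoid G" "(p, q, r, s) \<in> G" "0 \<le> (n :: int)"
  shows "(n * p, n * q, n * r, n * s) \<in> G"
proof -
  interpret submonoid G by fact
  have "(int m * p, int m * q, int m * r, int m * s) \<in> G" for m
  proof (induction m)
    case 0
    then show ?case using zero_S by (simp add: zero_prod_def)
  next
    case (Suc m)
    then show ?case using add_S[OF Suc assms(2)] by (simp add: algebra_simps)
  qed
  from this[of "nat n"] show ?thesis using assms(3) by simp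
qed

lemma SA_decompose:
  assumes "g \<in> SA"
  shows "\<exists>\<alpha> \<beta> e f. 0 \<le> \<alpha> \<and> 0 \<le> \<beta> \<and> g = (0, 0, \<alpha>, \<beta>) + u e + v f \<and> (excess g = 0 \<longrightarrow> \<alpha> = 0 \<and> e \<le> 0 \<and> f \<le> 0)"
proof -
  obtain p q r s where g: "g = (p, q, r, s)" by (cases g) auto
  let ?e = "p + int a * up b q"
  have *: "neg ?e + int a * up b q + neg q \<le> r" "up a ?e + up b q \<le> s"
    using assms by (auto simp: g SA_def)
  have "g = (0, 0, r - (neg ?e + int a * up b q + neg q), s - (up a ?e + up b q)) + u ?e + v q"
    by (simp add: g u_def v_def)
  moreover have "r - (neg ?e + int a * up b q + neg q) = 0 \<and> ?e \<le> 0 \<and> q \<le> 0" if "excess g = 0"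
    using that * unfolding neg_def by (auto simp: g excess_def max_def split: if_splits)
  ultimately show ?thesis using * by (intro exI conjI) auto
qed

lemma SA_generated:
  assumes "submonoid G" "\<And>i. i \<le> a + b \<Longrightarrow> pt i \<in> G" "(1, 0, 0, 0) \<in> G" "(0, 1, 0, 0) \<in> G" "(0, 0, 1, 0) \<in> G"
  shows "SA \<subseteq> G"
proof
  fix g assume "g \<in> SA"
  then obtain \<alpha> \<beta> e f where g: "0 \<le> \<alpha>" "0 \<le> \<beta>" "g = (0, 0, \<alpha>, \<beta>) + u e + v f"
    using SA_decompose by blast
  interpret submonoid G by fact
  have "(0, 0, \<alpha>, 0) \<in> G" using submonoid_generation_0[OF assms(1) assms(5) g(1)] by simp
  moreover have "(0, 0, 0, \<beta>) \<in> G" using submonoid_generation_0[OF assms(1) assms(2)[of 0, unfolded pt_0] g(2)] by simp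
  ultimately have "(0, 0, \<alpha>, 0) + (0, 0, 0, \<beta>) + u e + v f \<in> G"
    using submonoid_generation_u[OF assms(1), of e] submonoid_generation_v[OF assms(1,2), of f] assms
    by (intro add_S) auto
  then show "g \<in> G" by (simp add: g)
qed

lemma FA_generated:
  assumes "submonoid G" "\<And>i. i \<le> a + b \<Longrightarrow> pt i \<in> G"
  shows "FA \<subseteq> G"
proof
  fix g assume "g \<in> FA"
  then obtain \<beta> e f where g: "0 \<le> \<beta>" "g = (0, 0, 0, \<beta>) + u e + v f" "e \<le> 0" "f \<le> 0"
    using SA_decompose[of g] by (auto simp: FA_def)
  interpret submonoid G by fact
  have zero: "u 0 \<in> G" "v 0 \<in> G" using zero_S by (simp_all add: u_def v_def neg_def zero_prod_def)
  have "u e \<in> G"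
    using submonoid_generation_u[OF assms(1), of e] assms(2) g(3) zero by (cases "e = 0") auto
  moreover have "v f \<in> G"
    using submonoid_generation_v[OF assms(1,2), of f] g(4) zero by (cases "f = 0") auto
  moreover have "(0, 0, 0, \<beta>) \<in> G"
    using submonoid_generation_0[OF assms(1) assms(2)[of 0, unfolded pt_0] g(1)] by simp
  ultimately show "g \<in> G" unfolding g(2) by (intro add_S)
qed

definition gens_fiber :: "(int4 \<Rightarrow>\<^sub>0 'k::field) list" where
  "gens_fiber = map (\<lambda>i. mono_at (pt i)) [0..<a + b + 1]"

definition gens_rees :: "(int4 \<Rightarrow>\<^sub>0 'k::field) list" where
  "gens_rees = [mono_at (1, 0, 0, 0), mono_at (0, 1, 0, 0), mono_at (0, 0, 1, 0)] @ gens_fiber"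

lemma malg_least:
  fixes B :: "(int4 \<Rightarrow>\<^sub>0 'k::field) set"
  assumes B: "kalg B kconst" and G: "\<And>g. g \<in> S \<Longrightarrow> mono_at g \<in> B"
  shows "malg S \<subseteq> B"
proof
  interpret kalg B kconst by fact
  fix p :: "int4 \<Rightarrow>\<^sub>0 'k" assume p: "p \<in> malg S"
  have "p = (\<Sum>g\<in>Poly_Mapping.keys p. kconst (Poly_Mapping.lookup p g) * mono_at g)"
    by (subst poly_mapping_expand) (simp add: mult_single)
  also have "\<dots> \<in> B" using p G by (intro sum_mem mult_mem h_mem) (auto simp: malg_def)
  finally show "p \<in> B" .
qed

text \<open>This reduces the generation of an algebra by monomials to the generation of the monoid
  of its exponents.\<close>

lemma submonoid_of_subr:
  fixes B :: "(int4 \<Rightarrow>\<^sub>0 'k::field) set"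
  assumes "subr B" shows "submonoid {g. mono_at g \<in> B}"
proof -
  interpret subr B by fact
  have "mono_at (g + g') \<in> B" if "mono_at g \<in> B" "mono_at g' \<in> B" for g g'
    using mult_mem[OF that] by (simp add: mult_single)
  then show ?thesis by unfold_locales auto
qed

lemma malg_generated:
  shows "malg SA = kgen kconst (gens_rees :: (int4 \<Rightarrow>\<^sub>0 'k::field) list)"
    and "malg FA = kgen kconst (gens_fiber :: (int4 \<Rightarrow>\<^sub>0 'k::field) list)"
proof -
  interpret A: kalg "malg SA :: (int4 \<Rightarrow>\<^sub>0 'k) set" kconst by (rule submonoid.kalg_malg[OF submonoid_SA])
  interpret F: kalg "malg FA :: (int4 \<Rightarrow>\<^sub>0 'k) set" kconst by (rule submonoid.kalg_malg[OF submonoid_FA])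
  have k: "kalg (kgen kconst gs) kconst" for gs :: "(int4 \<Rightarrow>\<^sub>0 'k) list" by (rule A.kalg_kgen)
  have genF: "set gens_fiber \<subseteq> (malg FA :: (int4 \<Rightarrow>\<^sub>0 'k) set)" using pt_mem by (auto simp: gens_fiber_def)
  then have genA: "set gens_rees \<subseteq> (malg SA :: (int4 \<Rightarrow>\<^sub>0 'k) set)"
    by (auto simp: gens_rees_def malg_def FA_def SA_def neg_def)
  have in_gens: "mono_at (pt i) \<in> set gens_fiber" if "i \<le> a + b" for i
    unfolding gens_fiber_def set_map set_upt by (rule imageI) (use that in simp)
  have SA: "SA \<subseteq> {g. (mono_at g :: int4 \<Rightarrow>\<^sub>0 'k) \<in> kgen kconst gens_rees}"
    by (rule SA_generated[OF submonoid_of_subr[OF kalg.axioms(1)[OF k]]])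
      (use A.kgen_contains(2)[of gens_rees] in_gens in \<open>auto simp: gens_rees_def\<close>)
  have FA: "FA \<subseteq> {g. (mono_at g :: int4 \<Rightarrow>\<^sub>0 'k) \<in> kgen kconst gens_fiber}"
    by (rule FA_generated[OF submonoid_of_subr[OF kalg.axioms(1)[OF k]]])
      (use A.kgen_contains(2)[of gens_fiber] in_gens in auto)
  show "malg SA = kgen kconst (gens_rees :: (int4 \<Rightarrow>\<^sub>0 'k) list)"
    using A.kgen_least[OF genA] malg_least[OF k, of SA gens_rees] SA by auto
  show "malg FA = kgen kconst (gens_fiber :: (int4 \<Rightarrow>\<^sub>0 'k) list)"
    using F.kgen_least[OF genF] malg_least[OF k, of FA gens_fiber] FA by auto
qed

lemma card_symmetric_interval: "card {- int N..int N} = 2 * N + 1"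
  by simp

lemma card_box: "card (box N) = (2 * N + 1) ^ 4"
  by (simp only: box_def card_cartesian_product card_symmetric_interval power4_eq_xxxx mult.assoc)

theorem Cohen_Macaulay_rees: "Cohen_Macaulay (ring_on (malg SA :: (int4 \<Rightarrow>\<^sub>0 'k::alg_closed_field) set))"
proof (rule Cohen_Macaulay_criterion)
  show "kalg (malg SA :: (int4 \<Rightarrow>\<^sub>0 'k) set) kconst" by (rule submonoid.kalg_malg[OF submonoid_SA])
  show "malg SA = kgen kconst (gens_rees :: (int4 \<Rightarrow>\<^sub>0 'k) list)" by (rule malg_generated)
  have "card (SA \<inter> box N) \<le> (2 * N + 1) ^ 4" for N
    using card_mono[of "box N" "SA \<inter> box N"] card_box[of N] by simp
  then show "kalg.trdeg_le (malg SA :: (int4 \<Rightarrow>\<^sub>0 'k) set) kconst 4"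
    by (rule trdeg_malg[OF submonoid_SA])
  let ?\<theta> = "[mono_at (0, 0, 1, 0), mono_at (0, 0, 0, 1), mono_at (u 1) - mono_at (u (- int a)),
    mono_at (v 1) - mono_at (v (- int b))] :: (int4 \<Rightarrow>\<^sub>0 'k) list"
  show "length ?\<theta> = 4" by simp
  show "set ?\<theta> \<subseteq> malg SA"
  proof -
    have "(0, 0, 1, 0) \<in> SA" "(0, 0, 0, 1) \<in> SA" by (auto simp: SA_def neg_def)
    moreover have "u e \<in> SA" for e using u_mem S_subsets(2) by blast
    ultimately show ?thesis using v_mem by (auto intro!: mono_at_diff[OF submonoid_SA])
  qed
  show "wreg (malg SA) (map (\<lambda>i. ?\<theta> ! i - kconst (\<kappa> i)) [0..<4])" for \<kappa>
    using wreg_rees[of \<kappa>] by (simp add: regs_def upt_rec numeral_2_eq_2 numeral_3_eq_3)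
qed

theorem Cohen_Macaulay_fiber: "Cohen_Macaulay (ring_on (malg FA :: (int4 \<Rightarrow>\<^sub>0 'k::alg_closed_field) set))"
proof (rule Cohen_Macaulay_criterion)
  show "kalg (malg FA :: (int4 \<Rightarrow>\<^sub>0 'k) set) kconst" by (rule submonoid.kalg_malg[OF submonoid_FA])
  show "malg FA = kgen kconst (gens_fiber :: (int4 \<Rightarrow>\<^sub>0 'k) list)" by (rule malg_generated)
  have "card (FA \<inter> box N) \<le> (2 * N + 1) ^ 3" for N
  proof -
    let ?I = "{- int N..int N}"
    \<comment> \<open>Excess 0 determines the third coordinate from the first two; this is the drop
      of the dimension from 4 to 3.\<close>
    have "inj_on (\<lambda>(p, q, r, s). (p, q, s)) (FA \<inter> box N)"
      by (auto simp: inj_on_def FA_def excess_def)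
    moreover have "(\<lambda>(p, q, r, s). (p, q, s)) ` (FA \<inter> box N) \<subseteq> ?I \<times> ?I \<times> ?I"
      by (auto simp: box_def)
    ultimately have "card (FA \<inter> box N) \<le> card (?I \<times> ?I \<times> ?I)" by (intro card_inj_on_le) auto
    then show ?thesis
      by (simp only: card_cartesian_product card_symmetric_interval power3_eq_cube mult.assoc)
  qed
  then show "kalg.trdeg_le (malg FA :: (int4 \<Rightarrow>\<^sub>0 'k) set) kconst 3"
    by (rule trdeg_malg[OF submonoid_FA])
  let ?\<theta> = "[mono_at (0, 0, 0, 1), mono_at (u (- int a)), mono_at (v (- int b))] :: (int4 \<Rightarrow>\<^sub>0 'k) list"
  show "length ?\<theta> = 3" by simp
  show "set ?\<theta> \<subseteq> malg FA"
    using pt_mem[of 0] pt_mem[of a] pt_mem[of "a + b"] pt_0 pt_u[of a] pt_v[of b] a_pos b_pos by simp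
  show "wreg (malg FA) (map (\<lambda>i. ?\<theta> ! i - kconst (\<kappa> i)) [0..<3])" for \<kappa>
    using wreg_fiber[of \<kappa>] by (simp add: upt_rec numeral_2_eq_2)
qed

end

section \<open>Evaluation homomorphisms\<close>

text \<open>Vanishing coefficients contribute nothing, so all three sums may run over the union of
  the supports, even when terms cancel.\<close>

lemma sum_keys_add:
  fixes F :: "'m \<Rightarrow> 'a::comm_monoid_add \<Rightarrow> 'b::comm_monoid_add"
  assumes "\<And>k. F k 0 = 0" "\<And>k x y. F k (x + y) = F k x + F k y"
  shows "(\<Sum>k\<in>Poly_Mapping.keys (p + q). F k (Poly_Mapping.lookup (p + q) k)) =
    (\<Sum>k\<in>Poly_Mapping.keys p. F k (Poly_Mapping.lookup p k)) + (\<Sum>k\<in>Poly_Mapping.keys q. F k (Poly_Mapping.lookup q k))"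
proof -
  let ?U = "Poly_Mapping.keys p \<union> Poly_Mapping.keys q"
  have *: "(\<Sum>k\<in>Poly_Mapping.keys r. F k (Poly_Mapping.lookup r k)) = (\<Sum>k\<in>?U. F k (Poly_Mapping.lookup r k))"
    if "Poly_Mapping.keys r \<subseteq> ?U" for r
    by (rule sum.mono_neutral_left) (use that assms(1) in \<open>auto simp: in_keys_iff\<close>)
  have "(\<Sum>k\<in>Poly_Mapping.keys (p + q). F k (Poly_Mapping.lookup (p + q) k)) = (\<Sum>k\<in>?U. F k (Poly_Mapping.lookup (p + q) k))"
    by (rule *) (rule keys_add)
  also have "\<dots> = (\<Sum>k\<in>?U. F k (Poly_Mapping.lookup p k)) + (\<Sum>k\<in>?U. F k (Poly_Mapping.lookup q k))"
    by (simp add: lookup_add assms(2) sum.distrib)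
  finally show ?thesis using *[of p] *[of q] by simp
qed

lemma additive_mult:
  fixes \<epsilon> :: "('m::comm_monoid_add \<Rightarrow>\<^sub>0 'a::comm_semiring_1) \<Rightarrow> 'b::comm_semiring_1"
  assumes zero: "\<epsilon> 0 = 0" and add: "\<And>p q. \<epsilon> (p + q) = \<epsilon> p + \<epsilon> q"
    and single: "\<And>m c m' c'. \<epsilon> (Poly_Mapping.single (m + m') (c * c')) = \<epsilon> (Poly_Mapping.single m c) * \<epsilon> (Poly_Mapping.single m' c')"
  shows "\<epsilon> (p * q) = \<epsilon> p * \<epsilon> q"
proof -
  have sum: "\<epsilon> (sum f Y) = (\<Sum>y\<in>Y. \<epsilon> (f y))" for f :: "'c \<Rightarrow> _" and Y
    by (induction Y rule: infinite_finite_induct) (auto simp: zero add)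
  have sum': "\<epsilon> (sum f Y) = (\<Sum>y\<in>Y. \<epsilon> (f y))" for f :: "'m \<Rightarrow> _" and Y
    by (induction Y rule: infinite_finite_induct) (auto simp: zero add)
  let ?s = "\<lambda>p k. Poly_Mapping.single k (Poly_Mapping.lookup p k)"
  have "p * q = (\<Sum>k\<in>Poly_Mapping.keys p. ?s p k) * (\<Sum>l\<in>Poly_Mapping.keys q. ?s q l)"
    by (simp flip: poly_mapping_expand)
  also have "\<dots> = (\<Sum>k\<in>Poly_Mapping.keys p. \<Sum>l\<in>Poly_Mapping.keys q.
      Poly_Mapping.single (k + l) (Poly_Mapping.lookup p k * Poly_Mapping.lookup q l))"
    by (simp add: sum_product mult_single)
  finally have "\<epsilon> (p * q) = (\<Sum>k\<in>Poly_Mapping.keys p. \<epsilon> (?s p k)) * (\<Sum>l\<in>Poly_Mapping.keys q. \<epsilon> (?s q l))"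
    by (simp add: sum' single sum_product)
  then show ?thesis by (simp flip: sum' poly_mapping_expand)
qed

definition moneval :: "('v \<Rightarrow> 'b::comm_semiring_1) \<Rightarrow> ('v \<Rightarrow>\<^sub>0 nat) \<Rightarrow> 'b" where
  "moneval g m = (\<Prod>v\<in>Poly_Mapping.keys m. g v ^ Poly_Mapping.lookup m v)"

lemma moneval_superset:
  "finite V \<Longrightarrow> Poly_Mapping.keys m \<subseteq> V \<Longrightarrow> moneval g m = (\<Prod>v\<in>V. g v ^ Poly_Mapping.lookup m v)"
  unfolding moneval_def by (rule prod.mono_neutral_left) (auto simp: in_keys_iff)

lemma moneval_zero [simp]: "moneval g 0 = 1"
  by (simp add: moneval_def)

lemma moneval_add: "moneval g (m + m') = moneval g m * moneval g m'"
proof -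
  let ?U = "Poly_Mapping.keys m \<union> Poly_Mapping.keys m'"
  have "moneval g (m + m') = (\<Prod>v\<in>?U. g v ^ Poly_Mapping.lookup (m + m') v)"
    by (rule moneval_superset) (auto simp: keys_add)
  then show ?thesis
    using moneval_superset[of ?U m g] moneval_superset[of ?U m' g]
    by (simp add: lookup_add power_add prod.distrib)
qed

lemma moneval_single [simp]: "moneval g (Poly_Mapping.single v n) = g v ^ n"
  by (simp add: moneval_def)

lemma mpoly_eval_moneval:
  "mpoly_eval h g p = (\<Sum>m\<in>Poly_Mapping.keys p. h (Poly_Mapping.lookup p m) * moneval g m)"
  by (simp add: mpoly_eval_def moneval_def)

lemma mpoly_eval_single: "h 0 = 0 \<Longrightarrow> mpoly_eval h g (Poly_Mapping.single m c) = h c * moneval g m"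
  by (simp add: mpoly_eval_moneval)

context comm_ring_hom begin

lemma mpoly_eval_add: "mpoly_eval hom g (p + q) = mpoly_eval hom g p + mpoly_eval hom g q"
  unfolding mpoly_eval_moneval by (rule sum_keys_add) (auto simp: hom_add distrib_right)

lemma mpoly_eval_mult: "mpoly_eval hom g (p * q) = mpoly_eval hom g p * mpoly_eval hom g q"
  by (rule additive_mult)
    (auto simp: mpoly_eval_add mpoly_eval_single hom_mult moneval_add mpoly_eval_def[of _ _ 0] mult_ac)

lemma comm_ring_hom_mpoly_eval: "comm_ring_hom (mpoly_eval hom g)"
proof unfold_locales
  show "mpoly_eval hom g 1 = 1" using mpoly_eval_single[of hom g 0 1] by simp
  show "mpoly_eval hom g 0 = 0" by (simp add: mpoly_eval_def)
qed (auto simp: mpoly_eval_add mpoly_eval_mult)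

lemma mpoly_eval_Const [simp]: "mpoly_eval hom g (Const c) = hom c"
  unfolding Const_def by (simp add: mpoly_eval_single)

lemma mpoly_eval_Var [simp]: "mpoly_eval hom g (Var v) = g v"
  unfolding Var_def by (simp add: mpoly_eval_single)

end

lemma comm_ring_hom_Const: "comm_ring_hom (Const :: 'a::comm_ring_1 \<Rightarrow> ('v, 'a) mpoly)"
  by unfold_locales (auto simp: Const_def single_add mult_single)

lemma Const_0 [simp]: "Const 0 = (0 :: ('v, 'a::comm_ring_1) mpoly)" and
  Const_1 [simp]: "Const 1 = (1 :: ('v, 'a::comm_ring_1) mpoly)"
  by (simp_all add: Const_def)

lemma Const_add: "Const (c + d) = (Const c + Const d :: ('v, 'a::comm_ring_1) mpoly)" and
  Const_mult: "Const (c * d) = (Const c * Const d :: ('v, 'a::comm_ring_1) mpoly)"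
  by (simp_all add: Const_def single_add mult_single)

lemma single_eq_Const_moneval:
  "Poly_Mapping.single m c = Const c * moneval Var (m :: 'v \<Rightarrow>\<^sub>0 nat)" for c :: "'a::comm_ring_1"
proof -
  have pow: "(Var v :: ('v, 'a) mpoly) ^ n = Poly_Mapping.single (Poly_Mapping.single v n) 1" for v n
    by (induction n) (auto simp: Var_def mult_single single_add[symmetric])
  have "moneval (Var :: 'v \<Rightarrow> ('v, 'a) mpoly) m = Poly_Mapping.single m 1"
  proof -
    have "(\<Prod>v\<in>V. (Var v :: ('v, 'a) mpoly) ^ Poly_Mapping.lookup m v) =
        Poly_Mapping.single (\<Sum>v\<in>V. Poly_Mapping.single v (Poly_Mapping.lookup m v)) 1" if "finite V" for V
      using that by (induction V rule: finite_induct) (auto simp: pow mult_single)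
    then show ?thesis by (simp add: moneval_def flip: poly_mapping_expand)
  qed
  then show ?thesis by (simp add: Const_def mult_single)
qed

lemma mpoly_generated:
  fixes B :: "('v, 'a::comm_ring_1) mpoly set"
  assumes B: "subr B" and C: "\<And>c. Const c \<in> B" and V: "\<And>v. v \<in> V \<Longrightarrow> Var v \<in> B"
    and p: "\<And>m. m \<in> Poly_Mapping.keys p \<Longrightarrow> Poly_Mapping.keys m \<subseteq> V"
  shows "p \<in> B"
proof -
  interpret subr B by fact
  have prod: "(\<And>v. v \<in> U \<Longrightarrow> f v \<in> B) \<Longrightarrow> prod f U \<in> B" for f :: "'v \<Rightarrow> _" and U
    by (induction U rule: infinite_finite_induct) auto
  have "p = (\<Sum>m\<in>Poly_Mapping.keys p. Const (Poly_Mapping.lookup p m) * moneval Var m)"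
    by (subst poly_mapping_expand) (simp flip: single_eq_Const_moneval)
  also have "\<dots> \<in> B"
    unfolding moneval_def using C V p by (intro sum_mem mult_mem prod power_mem) blast+
  finally show ?thesis .
qed

subsection \<open>Homogeneous components\<close>

definition hcomp :: "nat \<Rightarrow> ('v, 'a::zero) mpoly \<Rightarrow> ('v, 'a) mpoly" where
  "hcomp e p = Poly_Mapping.mapp (\<lambda>m c. c when mdeg m = e) p"

lemma lookup_hcomp: "Poly_Mapping.lookup (hcomp e p) m = (Poly_Mapping.lookup p m when mdeg m = e)"
  by (simp add: hcomp_def lookup_mapp when_def in_keys_iff)

lemma hcomp_add: "hcomp e (p + q) = hcomp e p + hcomp e (q :: ('v, 'a::comm_monoid_add) mpoly)"
  by (rule poly_mapping_eqI) (simp add: lookup_hcomp lookup_add when_def)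

lemma hcomp_0 [simp]: "hcomp e 0 = 0"
  by (rule poly_mapping_eqI) (simp add: lookup_hcomp)

lemma hcomp_sum: "hcomp e (sum f Y) = (\<Sum>y\<in>Y. hcomp e (f y :: ('v, 'a::comm_monoid_add) mpoly))"
  by (induction Y rule: infinite_finite_induct) (auto simp: hcomp_add)

lemma hcomp_homogeneous: "homogeneous d p \<Longrightarrow> hcomp e p = (p when d = e)"
  by (rule poly_mapping_eqI) (auto simp: lookup_hcomp homogeneous_def when_def in_keys_iff)

lemma homogeneous_hcomp: "homogeneous e (hcomp e p)"
  by (auto simp: homogeneous_def in_keys_iff lookup_hcomp when_def split: if_splits)

lemma mdeg_superset: "finite V \<Longrightarrow> Poly_Mapping.keys m \<subseteq> V \<Longrightarrow> mdeg m = (\<Sum>v\<in>V. Poly_Mapping.lookup m v)"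
  unfolding mdeg_def by (rule sum.mono_neutral_left) (auto simp: in_keys_iff)

lemma mdeg_0 [simp]: "mdeg 0 = 0"
  by (simp add: mdeg_def)

lemma mdeg_add: "mdeg (m + m') = mdeg m + mdeg m'"
proof -
  let ?U = "Poly_Mapping.keys m \<union> Poly_Mapping.keys m'"
  have "mdeg (m + m') = (\<Sum>v\<in>?U. Poly_Mapping.lookup (m + m') v)"
    by (rule mdeg_superset) (auto simp: keys_add)
  then show ?thesis
    using mdeg_superset[of ?U m] mdeg_superset[of ?U m'] by (simp add: lookup_add sum.distrib)
qed

lemma mdeg_eq_0: "mdeg m = 0 \<Longrightarrow> m = 0"
  by (rule poly_mapping_eqI) (auto simp: mdeg_def in_keys_iff)

lemma homogeneous_add: "homogeneous d p \<Longrightarrow> homogeneous d q \<Longrightarrow> homogeneous d (p + q :: ('v, 'a::comm_monoid_add) mpoly)"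
  using keys_add[of p q] by (auto simp: homogeneous_def)

lemma homogeneous_0 [simp]: "homogeneous d 0"
  by (simp add: homogeneous_def)

lemma homogeneous_sum: "(\<And>y. y \<in> Y \<Longrightarrow> homogeneous d (f y)) \<Longrightarrow> homogeneous d (sum f Y :: ('v, 'a::comm_monoid_add) mpoly)"
  by (induction Y rule: infinite_finite_induct) (auto simp: homogeneous_add)

lemma homogeneous_mult: "homogeneous d p \<Longrightarrow> homogeneous e q \<Longrightarrow> homogeneous (d + e) (p * q :: ('v, 'a::comm_ring_1) mpoly)"
  using keys_mult[of p q] by (fastforce simp: homogeneous_def mdeg_add)

lemma homogeneous_Const: "homogeneous 0 (Const c)"
  by (simp add: homogeneous_def Const_def)

lemma homogeneous_Const_mult: "homogeneous d p \<Longrightarrow> homogeneous d (Const c * p :: ('v, 'a::comm_ring_1) mpoly)"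
  using homogeneous_mult[OF homogeneous_Const] by fastforce

lemma homogeneous_power: "homogeneous d p \<Longrightarrow> homogeneous (n * d) (p ^ n :: ('v, 'a::comm_ring_1) mpoly)"
proof (induction n)
  case 0
  then show ?case by (simp add: homogeneous_def)
qed (auto intro: homogeneous_mult)

lemma homogeneous_moneval:
  assumes "\<And>v. v \<in> Poly_Mapping.keys m \<Longrightarrow> homogeneous d (g v)"
  shows "homogeneous (mdeg m * d) (moneval g m :: ('w, 'a::comm_ring_1) mpoly)"
proof -
  have "homogeneous ((\<Sum>v\<in>V. Poly_Mapping.lookup m v) * d) (\<Prod>v\<in>V. g v ^ Poly_Mapping.lookup m v)"
    if "finite V" "\<And>v. v \<in> V \<Longrightarrow> homogeneous d (g v)" for V
    using that
  proof (induction V rule: finite_induct)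
    case empty
    then show ?case by (simp add: homogeneous_def)
  next
    case (insert v V)
    then show ?case by (auto simp: add_mult_distrib intro!: homogeneous_mult homogeneous_power)
  qed
  then show ?thesis using assms by (simp add: mdeg_def moneval_def)
qed

lemma homogeneous_linear_eval:
  assumes "\<And>v. homogeneous 1 (l v)" "homogeneous d p"
  shows "homogeneous d (mpoly_eval Const l p :: ('w, 'a::comm_ring_1) mpoly)"
  unfolding mpoly_eval_moneval
proof (rule homogeneous_sum)
  fix m assume "m \<in> Poly_Mapping.keys p"
  then have "mdeg m = d" using assms(2) by (simp add: homogeneous_def)
  then show "homogeneous d (Const (Poly_Mapping.lookup p m) * moneval l m)"
    using homogeneous_Const_mult[OF homogeneous_moneval[of m 1 l]] assms(1) by simp
qed

text \<open>Only the component of \<open>r\<close> in the complementary degree contributes. The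
  subtraction \<open>e - d\<close> is truncated, hence the guard.\<close>

lemma hcomp_mult_homogeneous:
  fixes r p :: "('v, 'a::comm_ring_1) mpoly"
  assumes "homogeneous d p"
  shows "hcomp e (r * p) = (hcomp (e - d) r * p when d \<le> e)"
proof -
  have "\<exists>r'. r = hcomp (e - d) r + r' \<and> (\<forall>m\<in>Poly_Mapping.keys r'. mdeg m \<noteq> e - d)"
  proof (intro exI conjI ballI)
    show "r = hcomp (e - d) r + (r - hcomp (e - d) r)" by simp
    show "mdeg m \<noteq> e - d" if "m \<in> Poly_Mapping.keys (r - hcomp (e - d) r)" for m
      using that by (auto simp: in_keys_iff lookup_minus lookup_hcomp)
  qed
  then obtain r' where r': "r = hcomp (e - d) r + r'" "\<forall>m\<in>Poly_Mapping.keys r'. mdeg m \<noteq> e - d" by blast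
  have zero: "hcomp e (s * p) = 0" if "\<forall>m\<in>Poly_Mapping.keys s. mdeg m + d \<noteq> e" for s
  proof (rule poly_mapping_eqI)
    fix m
    have "mdeg m \<noteq> e" if m: "m \<in> Poly_Mapping.keys (s * p)"
    proof -
      obtain m' c where "m = m' + c" "m' \<in> Poly_Mapping.keys s" "c \<in> Poly_Mapping.keys p"
        using keys_mult[of s p] m by blast
      then show ?thesis
        using \<open>\<forall>m\<in>Poly_Mapping.keys s. mdeg m + d \<noteq> e\<close> assms by (auto simp: homogeneous_def mdeg_add)
    qed
    then show "Poly_Mapping.lookup (hcomp e (s * p)) m = Poly_Mapping.lookup 0 m"
      by (auto simp: lookup_hcomp in_keys_iff when_def)
  qed
  show ?thesis
  proof (cases "d \<le> e")
    case True
    have "homogeneous (e - d + d) (hcomp (e - d) r * p)" by (rule homogeneous_mult[OF homogeneous_hcomp assms])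
    then have "hcomp e (hcomp (e - d) r * p) = hcomp (e - d) r * p" using True by (simp add: hcomp_homogeneous)
    moreover have "hcomp e (r' * p) = 0" by (rule zero) (use r'(2) True in auto)
    ultimately have "hcomp e ((hcomp (e - d) r + r') * p) = hcomp (e - d) r * p"
      by (simp only: distrib_right hcomp_add add_0_right)
    then show ?thesis using r'(1) True by simp
  next
    case False
    then have "hcomp e (r * p) = 0" by (intro zero) auto
    then show ?thesis using False by simp
  qed
qed

lemma hcomp_0_Const: "\<exists>c. hcomp 0 r = Const (c :: 'a::zero)"
proof (intro exI poly_mapping_eqI)
  fix m
  show "Poly_Mapping.lookup (hcomp 0 r) m = Poly_Mapping.lookup (Const (Poly_Mapping.lookup r 0)) m"
    using mdeg_eq_0[of m] by (auto simp: lookup_hcomp Const_def lookup_single when_def)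
qed

subsection \<open>Minimal generators\<close>

lemma ring_on_UNIV: "ring_on UNIV = ring_of_type_algebra"
  by (simp add: ring_on_def ring_of_type_algebra_def)

lemma Idl_type: "Idl\<^bsub>ring_of_type_algebra\<^esub> S = gen UNIV S"
  using subr.Idl_ring_on[OF subr_UNIV] by (simp add: ring_on_UNIV)

lemma (in subr) gen_indexed:
  assumes f: "\<And>i. i \<in> N \<Longrightarrow> f i \<in> A" and fin: "finite N"
  shows "gen A (f ` N) = {(\<Sum>i\<in>N. r i * f i) | r. \<forall>i. r i \<in> A}" (is "_ = ?R")
proof
  have "ideal_in A ?R"
  proof unfold_locales
    show "?R \<subseteq> A" using f by (auto intro!: sum_mem)
    show "0 \<in> ?R" by (rule CollectI, rule exI[of _ "\<lambda>_. 0"]) auto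
  next
    fix p q assume "p \<in> ?R" "q \<in> ?R"
    then obtain r r' where "p = (\<Sum>i\<in>N. r i * f i)" "\<forall>i. r i \<in> A" "q = (\<Sum>i\<in>N. r' i * f i)" "\<forall>i. r' i \<in> A"
      by auto
    then show "p + q \<in> ?R"
      by (intro CollectI exI[of _ "\<lambda>i. r i + r' i"]) (auto simp: distrib_right sum.distrib)
  next
    fix c p assume "c \<in> A" "p \<in> ?R"
    then obtain r where "p = (\<Sum>i\<in>N. r i * f i)" "\<forall>i. r i \<in> A" by auto
    then show "c * p \<in> ?R" using \<open>c \<in> A\<close>
      by (intro CollectI exI[of _ "\<lambda>i. c * r i"]) (auto simp: sum_distrib_left mult.assoc)
  qed
  moreover have "f ` N \<subseteq> ?R"
  proof
    fix x assume "x \<in> f ` N"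
    then obtain j where j: "j \<in> N" "x = f j" by auto
    then have "x = (\<Sum>i\<in>N. (if i = j then 1 else 0) * f i)" using fin by (simp add: if_distrib[of "\<lambda>c. c * _"] cong: if_cong)
    then show "x \<in> ?R" by (intro CollectI exI[of _ "\<lambda>i. if i = j then 1 else 0"]) auto
  qed
  ultimately show "gen A (f ` N) \<subseteq> ?R" by (rule gen_least)
  interpret G: ideal_in A "gen A (f ` N)" by (rule gen_ideal) (use f in auto)
  show "?R \<subseteq> gen A (f ` N)" using gen_incl[of "f ` N"] by (auto intro!: G.J_sum)
qed

lemma gen_type_indexed:
  "finite N \<Longrightarrow> gen UNIV (f ` N) = {(\<Sum>i\<in>N. r i * f i) | r. True}"
  using subr.gen_indexed[OF subr_UNIV, of N f] by simp

definition deg_gens :: "('v, 'k::field) mpoly set \<Rightarrow> nat \<Rightarrow> bool" where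
  "deg_gens I d \<longleftrightarrow> (\<exists>N g. finite (N :: nat set) \<and> (\<forall>i\<in>N. homogeneous d (g i)) \<and> I = gen UNIV (g ` N))"

lemma minimal_generators_gen:
  assumes "minimal_generators I f"
  shows "I = gen UNIV ((\<lambda>i. f $ i) ` {..<dim_vec f})"
proof -
  have "{f $ i |i. i < dim_vec f} = (\<lambda>i. f $ i) ` {..<dim_vec f}" by auto
  then show ?thesis using assms unfolding minimal_generators_def Idl_type by simp
qed

lemma deg_gens_monomials:
  fixes I :: "('v, 'k::field) mpoly set"
  assumes "minimally_generated_by_monomials I n d" shows "deg_gens I d"
proof -
  from assms
  obtain f :: "('v, 'k) mpoly vec" where f: "minimal_generators I f" "dim_vec f = n"
    "\<forall>i<n. \<exists>m. mdeg m = d \<and> f $ i = Poly_Mapping.single m 1"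
    unfolding minimally_generated_by_monomials_def by blast
  then have "homogeneous d (f $ i)" if "i < n" for i
    using that by (auto simp: homogeneous_def)
  then show ?thesis using minimal_generators_gen[OF f(1)] f(2) unfolding deg_gens_def
    by (intro exI[of _ "{..<n}"] exI[of _ "\<lambda>i. f $ i"]) auto
qed

lemma deg_gens_low:
  assumes "deg_gens I d" "p \<in> I" "m \<in> Poly_Mapping.keys p" shows "d \<le> mdeg m"
proof -
  obtain N :: "nat set" and g where g: "finite N" "\<And>i. i \<in> N \<Longrightarrow> homogeneous d (g i)" "I = gen UNIV (g ` N)"
    using assms(1) by (auto simp: deg_gens_def)
  then obtain r where p: "p = (\<Sum>i\<in>N. r i * g i)" using assms(2) gen_type_indexed[OF g(1), of g] by auto
  have "\<exists>i\<in>N. m \<in> Poly_Mapping.keys (r i * g i)"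
    using assms(3) by (auto simp: p lookup_sum in_keys_iff intro: ccontr)
  then obtain i a c where "i \<in> N" "m = a + c" "c \<in> Poly_Mapping.keys (g i)"
    using keys_mult by blast
  then show ?thesis using g(2) by (auto simp: homogeneous_def mdeg_add)
qed

text \<open>The ideal has no elements of degree below \<open>d\<close>. If some generator had larger
  degree, comparing components of degree \<open>d\<close> would express all of \<open>g\<close> by
  the remaining generators, against minimality.\<close>

lemma minimal_generators_degree:
  fixes I :: "('v, 'k::field) mpoly set" and f :: "('v, 'k) mpoly vec"
  assumes I: "deg_gens I d" and f: "minimal_generators I f" and l: "l < dim_vec f"
  shows "homogeneous d (f $ l) \<and> f $ l \<noteq> 0"
proof -
  obtain N :: "nat set" and g where g: "finite N" "\<And>i. i \<in> N \<Longrightarrow> homogeneous d (g i)" "I = gen UNIV (g ` N)"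
    using I by (auto simp: deg_gens_def)
  define n where "n = dim_vec f"
  have If: "I = gen UNIV ((\<lambda>i. f $ i) ` {..<n})" unfolding n_def by (rule minimal_generators_gen[OF f])
  have min: "f $ j \<notin> gen UNIV ((\<lambda>i. f $ i) ` ({..<n} - {j}))" if "j < n" for j
  proof -
    have "{f $ i |i. i < dim_vec f \<and> i \<noteq> j} = (\<lambda>i. f $ i) ` ({..<n} - {j})" by (auto simp: n_def)
    moreover have "f $ j \<notin> gen UNIV {f $ i |i. i < dim_vec f \<and> i \<noteq> j}"
      using f that unfolding minimal_generators_def Idl_type n_def by blast
    ultimately show ?thesis by simp
  qed
  have ideal: "ideal_in UNIV (gen UNIV S)" for S :: "('v, 'k) mpoly set" by (rule subr.gen_ideal[OF subr_UNIV]) simp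
  have nz: "f $ j \<noteq> 0" if "j < n" for j using min[OF that] ideal_in.J_zero[OF ideal] by metis
  obtain deg where deg: "\<And>i. i < n \<Longrightarrow> homogeneous (deg i) (f $ i)"
    using f unfolding minimal_generators_def n_def by metis
  have memI: "f $ j \<in> I" if "j < n" for j unfolding If
    by (rule subsetD[OF subr.gen_incl[OF subr_UNIV]]) (use that in simp)
  have ge: "d \<le> deg j" if j: "j < n" for j
  proof -
    obtain m where "m \<in> Poly_Mapping.keys (f $ j)" using nz[OF j] by (metis keys_eq_empty all_not_in_conv)
    then show ?thesis using deg_gens_low[OF I memI[OF j]] deg[OF j] by (auto simp: homogeneous_def)
  qed
  have "deg l = d"
  proof (rule ccontr)
    assume neq: "deg l \<noteq> d"
    have ln: "l < n" using l by (simp add: n_def)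
    have "g i \<in> gen UNIV ((\<lambda>i. f $ i) ` ({..<n} - {l}))" if i: "i \<in> N" for i
    proof -
      have "g i \<in> I" unfolding g(3) by (rule subsetD[OF subr.gen_incl[OF subr_UNIV]]) (use i in simp)
      then obtain r where r: "g i = (\<Sum>j<n. r j * f $ j)" using gen_type_indexed[of "{..<n}" "\<lambda>i. f $ i"] If by auto
      have "g i = hcomp d (g i)" using hcomp_homogeneous[OF g(2)[OF i], of d] by simp
      also have "\<dots> = (\<Sum>j<n. hcomp d (r j * f $ j))" unfolding r by (rule hcomp_sum)
      also have "\<dots> = (\<Sum>j\<in>{..<n} - {l}. hcomp d (r j * f $ j))"
        using ln hcomp_mult_homogeneous[OF deg[OF ln], of d "r l"] ge[OF ln] neq
        by (subst sum.remove[of _ l]) (auto simp: when_def)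
      also have "\<dots> = (\<Sum>j\<in>{..<n} - {l}. (hcomp (d - deg j) (r j) when deg j \<le> d) * f $ j)"
        by (rule sum.cong) (auto simp: hcomp_mult_homogeneous[OF deg] when_def)
      finally show ?thesis using gen_type_indexed[of "{..<n} - {l}" "\<lambda>i. f $ i"] by auto
    qed
    then have "I \<subseteq> gen UNIV ((\<lambda>i. f $ i) ` ({..<n} - {l}))"
      unfolding g(3) by (intro subr.gen_least[OF subr_UNIV ideal]) auto
    then show False using min[OF ln] memI[OF ln] by blast
  qed
  then show ?thesis using deg nz l by (auto simp: n_def)
qed

text \<open>In the component of degree \<open>d\<close> each coefficient is replaced by its
  component of degree 0, which is a constant.\<close>

lemma homogeneous_span:
  assumes f: "\<And>i. i \<in> N \<Longrightarrow> homogeneous d (f i)" and N: "finite N"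
    and p: "p \<in> gen UNIV (f ` N)" "homogeneous d p"
  shows "\<exists>\<kappa>. p = (\<Sum>i\<in>N. Const (\<kappa> i) * f i :: ('v, 'a::comm_ring_1) mpoly)"
proof -
  obtain r where r: "p = (\<Sum>i\<in>N. r i * f i)" using p(1) gen_type_indexed[OF N, of f] by auto
  obtain \<kappa> where \<kappa>: "\<And>i. hcomp 0 (r i) = Const (\<kappa> i)" 
    using choice[of "\<lambda>i c. hcomp 0 (r i) = Const c"] hcomp_0_Const by blast
  have "p = hcomp d p" using hcomp_homogeneous[OF p(2), of d] by simp
  also have "\<dots> = (\<Sum>i\<in>N. Const (\<kappa> i) * f i)"
    unfolding r hcomp_sum by (rule sum.cong) (auto simp: hcomp_mult_homogeneous[OF f] \<kappa>)
  finally show ?thesis by blast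
qed

section \<open>Reduction to the standard generators\<close>

lemma lookup_single_mult:
  fixes d m :: "'v \<Rightarrow>\<^sub>0 nat" and p :: "('v, 'a::comm_ring_1) mpoly"
  shows "Poly_Mapping.lookup (Poly_Mapping.single d 1 * p) (d + m) = Poly_Mapping.lookup p m"
proof -
  have "Poly_Mapping.single d 1 * p = (\<Sum>k\<in>Poly_Mapping.keys p. Poly_Mapping.single (d + k) (Poly_Mapping.lookup p k))"
    by (subst poly_mapping_expand[of p]) (simp add: sum_distrib_left mult_single)
  then have "Poly_Mapping.lookup (Poly_Mapping.single d 1 * p) (d + m) =
      (\<Sum>k\<in>Poly_Mapping.keys p. if k = m then Poly_Mapping.lookup p k else 0)"
    by (auto simp: lookup_sum lookup_single when_def intro!: sum.cong)
  then show ?thesis by (simp add: in_keys_iff)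
qed

lemma keys_single_mult:
  fixes d :: "'v \<Rightarrow>\<^sub>0 nat" and p :: "('v, 'a::comm_ring_1) mpoly"
  assumes "m \<in> Poly_Mapping.keys (Poly_Mapping.single d 1 * p)"
  shows "\<exists>m'. m = d + m'"
  using keys_mult[of "Poly_Mapping.single d 1" p] assms by (auto split: if_splits)

lemma UNIV_xyz: "(UNIV :: xyz set) = {vx, vy, vz}"
  using xyz.exhaust by auto

lemma mdeg_xyz: "mdeg m = Poly_Mapping.lookup m vx + Poly_Mapping.lookup m vy + Poly_Mapping.lookup m vz"
proof -
  have "Poly_Mapping.keys m \<subseteq> {vx, vy, vz}" unfolding UNIV_xyz[symmetric] by simp
  then show ?thesis using mdeg_superset[of "{vx, vy, vz}" m] by simp
qed

lemma xyz_eqI: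
  assumes "Poly_Mapping.lookup m vx = Poly_Mapping.lookup m' vx" "Poly_Mapping.lookup m vy = Poly_Mapping.lookup m' vy"
    "Poly_Mapping.lookup m vz = Poly_Mapping.lookup m' vz"
  shows "m = m'"
proof (rule poly_mapping_eqI)
  show "Poly_Mapping.lookup m v = Poly_Mapping.lookup m' v" for v using assms by (cases v) auto
qed

section \<open>The standard monomials and the left kernel of the basic matrix\<close>

context two_blocks begin

text \<open>Truncated subtraction covers both blocks at once: up to index \<open>a\<close> the
  exponent of y stays at \<open>b\<close>, and from there on the exponent of x is 0.\<close>

definition mexp :: "nat \<Rightarrow> xyz \<Rightarrow>\<^sub>0 nat" where
  "mexp i = Poly_Mapping.single vx (a - i) + Poly_Mapping.single vy (b - (i - a)) + Poly_Mapping.single vz i"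

definition f0 :: "nat \<Rightarrow> (xyz, 'k::field) mpoly" where
  "f0 i = Poly_Mapping.single (mexp i) 1"

definition cvar :: "nat \<Rightarrow> xyz" where
  "cvar j = (if j < a then vx else vy)"

lemma lookup_mexp [simp]:
  "Poly_Mapping.lookup (mexp i) vx = a - i" "Poly_Mapping.lookup (mexp i) vy = b - (i - a)"
  "Poly_Mapping.lookup (mexp i) vz = i"
  by (simp_all add: mexp_def lookup_add lookup_single)

lemma f0_linear: "j < a + b \<Longrightarrow> Var vz * f0 j = (Var (cvar j) * f0 (Suc j) :: (xyz, 'k::field) mpoly)"
proof -
  assume j: "j < a + b"
  have "Poly_Mapping.single vz 1 + mexp j = Poly_Mapping.single (cvar j) 1 + mexp (Suc j)"
    by (rule xyz_eqI) (use j in \<open>auto simp: lookup_add lookup_single cvar_def\<close>)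
  then show ?thesis by (simp add: Var_def f0_def mult_single)
qed

text \<open>Within one block \<open>mexp\<close> is affine in the index, so a product of two
  monomials depends only on the sum of their indices.\<close>

lemma f0_product:
  assumes "i + j = k + l" "{i, j, k, l} \<subseteq> {..a} \<or> {i, j, k, l} \<subseteq> {a..a + b}"
  shows "f0 i * f0 j = (f0 k * f0 l :: (xyz, 'k::field) mpoly)"
proof -
  have "mexp i + mexp j = mexp k + mexp l"
    by (rule xyz_eqI) (use assms in \<open>auto simp: lookup_add\<close>)
  then show ?thesis by (simp add: f0_def mult_single)
qed

text \<open>The hypothesis \<open>rel\<close> says that \<open>\<omega>\<close> kills the basic matrix. For degree reasons the factor
  \<open>\<gamma>\<close> is a constant.\<close>

lemma kernel_basic:
  fixes \<omega> :: "nat \<Rightarrow> (xyz, 'k::field) mpoly"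
  assumes rel: "\<And>j. j < a + b \<Longrightarrow> Var vz * \<omega> j = Var (cvar j) * \<omega> (Suc j)"
    and hom: "\<And>j. j \<le> a + b \<Longrightarrow> homogeneous (a + b) (\<omega> j)"
  shows "\<exists>\<gamma>. \<forall>k\<le>a + b. \<omega> k = Const \<gamma> * f0 k"
proof -
  \<comment> \<open>The exponent of the product of the first \<open>k\<close> entries of the
    sequence; multiplying the first \<open>k\<close> relations together telescopes to
    \<open>iter\<close>.\<close>
  define cm where "cm k = Poly_Mapping.single vx (min k a) + Poly_Mapping.single vy (k - a)" for k
  have cm_Suc: "cm (Suc k) = Poly_Mapping.single (cvar k) 1 + cm k" for k
    by (rule xyz_eqI) (auto simp: cm_def lookup_add lookup_single cvar_def)
  have iter: "Poly_Mapping.single (Poly_Mapping.single vz k) 1 * \<omega> 0 = Poly_Mapping.single (cm k) 1 * \<omega> k"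
    if "k \<le> a + b" for k
    using that
  proof (induction k)
    case 0
    then show ?case by (simp add: cm_def)
  next
    case (Suc k)
    have "Poly_Mapping.single (Poly_Mapping.single vz (Suc k)) 1 * \<omega> 0 =
        Var vz * (Poly_Mapping.single (Poly_Mapping.single vz k) 1 * \<omega> 0)"
      by (simp add: Var_def mult.assoc[symmetric] mult_single single_add[symmetric])
    also have "\<dots> = Poly_Mapping.single (cm k) 1 * (Var vz * \<omega> k)"
      using Suc by (simp add: mult.left_commute)
    also have "\<dots> = Poly_Mapping.single (cm (Suc k)) 1 * \<omega> (Suc k)"
      unfolding rel[of k, OF Suc_le_lessD[OF Suc.prems]] cm_Suc
      by (simp add: Var_def mult.assoc[symmetric] mult_single add.commute)
    finally show ?case .
  qed
  \<comment> \<open>With \<open>k = a + b\<close> the relation shows that \<open>x^a y^b\<close>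
    divides a power of z times \<open>\<omega> 0\<close>, hence divides \<open>\<omega> 0\<close>;
    the degree leaves no further factor.\<close>
  have key0: "m = mexp 0" if m: "m \<in> Poly_Mapping.keys (\<omega> 0)" for m
  proof -
    have "Poly_Mapping.single vz (a + b) + m \<in> Poly_Mapping.keys (Poly_Mapping.single (cm (a + b)) 1 * \<omega> (a + b))"
      using m by (simp flip: iter add: in_keys_iff lookup_single_mult)
    then obtain m' where m': "Poly_Mapping.single vz (a + b) + m = cm (a + b) + m'"
      using keys_single_mult by blast
    have "Poly_Mapping.lookup (Poly_Mapping.single vz (a + b) + m) v = Poly_Mapping.lookup (cm (a + b) + m') v" for v
      by (simp add: m')
    from this[of vx] this[of vy] have "Poly_Mapping.lookup m vx \<ge> a" "Poly_Mapping.lookup m vy \<ge> b"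
      by (simp_all add: lookup_add lookup_single cm_def)
    moreover have "mdeg m = a + b" using hom[of 0] m by (simp add: homogeneous_def)
    ultimately show ?thesis by (intro xyz_eqI) (auto simp: mdeg_xyz)
  qed
  define \<gamma> where "\<gamma> = Poly_Mapping.lookup (\<omega> 0) (mexp 0)"
  have \<omega>0: "\<omega> 0 = Poly_Mapping.single (mexp 0) \<gamma>"
    by (rule poly_mapping_eqI) (use key0 in \<open>auto simp: \<gamma>_def lookup_single when_def in_keys_iff\<close>)
  have "\<omega> k = Const \<gamma> * f0 k" if k: "k \<le> a + b" for k
  proof (rule poly_mapping_eqI)
    fix m
    have eq: "Poly_Mapping.single vz k + mexp 0 = cm k + mexp k"
      by (rule xyz_eqI) (use k in \<open>auto simp: lookup_add lookup_single cm_def\<close>)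
    have "Poly_Mapping.lookup (\<omega> k) m = Poly_Mapping.lookup (Poly_Mapping.single (cm k) 1 * \<omega> k) (cm k + m)"
      by (simp add: lookup_single_mult)
    also have "\<dots> = Poly_Mapping.lookup (Poly_Mapping.single (Poly_Mapping.single vz k + mexp 0) \<gamma>) (cm k + m)"
      by (simp flip: iter[OF k] add: \<omega>0 mult_single)
    also have "\<dots> = Poly_Mapping.lookup (Const \<gamma> * f0 k) m"
      unfolding eq by (simp add: f0_def Const_def mult_single lookup_single when_def)
    finally show "Poly_Mapping.lookup (\<omega> k) m = Poly_Mapping.lookup (Const \<gamma> * f0 k) m" .
  qed
  then show ?thesis by blast
qed

definition entries :: "xyz list" where "entries = replicate a vx @ replicate b vy"

lemma entries [simp]: "length entries = a + b" "j < a + b \<Longrightarrow> entries ! j = cvar j"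
  by (auto simp: entries_def cvar_def nth_append)

text \<open>The row of generators kills \<open>\<phi>\<close>. After multiplication by the inverse
  of the row operations and the substitution \<open>\<sigma>\<close> it kills the basic matrix, so
  it is a constant multiple of the row of standard monomials. The preimages of the monomials,
  normalized by that constant, still generate \<open>I\<close> because the row operations are
  invertible.\<close>

lemma reduction:
  fixes I :: "(xyz, 'k::field) mpoly set"
  assumes deg: "deg_gens I (a + b)" and seq: "basic_entry_sequence I entries"
  shows "\<exists>l g. (\<forall>v. homogeneous 1 (l v)) \<and> bij (mpoly_eval Const l) \<and>
    (\<forall>i\<le>a + b. mpoly_eval Const l (g i) = f0 i \<and> homogeneous (a + b) (g i)) \<and> I = gen UNIV (g ` {..a + b})"
proof -
  define n where "n = Suc (a + b)"
  obtain f \<phi> where f: "minimal_generators I f" "dim_vec f = n" "syzygy_matrix f \<phi>"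
    and conj: "conjugate_matrices \<phi> (basic_matrix entries)"
    using seq unfolding basic_entry_sequence_def n_def by auto
  obtain \<sigma> A B where \<sigma>: "linear_change_of_variables \<sigma>" and A: "A \<in> carrier_mat (dim_row \<phi>) (dim_row \<phi>)" "invertible_mat A"
    and B: "B \<in> carrier_mat (dim_col \<phi>) (dim_col \<phi>)"
    and eq: "basic_matrix entries = map_mat Const A * map_mat \<sigma> \<phi> * map_mat Const B"
    using conj unfolding conjugate_matrices_def by blast
  obtain l where l: "\<And>v. homogeneous 1 (l v)" "\<sigma> = mpoly_eval Const l" "bij \<sigma>"
    using \<sigma> unfolding linear_change_of_variables_def by auto
  interpret K: comm_ring_hom "Const :: 'k \<Rightarrow> (xyz, 'k) mpoly" by (rule comm_ring_hom_Const)
  interpret \<sigma>: comm_ring_hom \<sigma> unfolding l(2) by (rule K.comm_ring_hom_mpoly_eval)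
  have \<sigma>C: "\<sigma> (Const c) = Const c" for c unfolding l(2) by simp
  have \<phi>: "\<phi> \<in> carrier_mat n (a + b)" using f(2,3) by (simp add: syzygy_matrix_def n_def)
  have A: "A \<in> carrier_mat n n" "invertible_mat A" and B: "B \<in> carrier_mat (a + b) (a + b)" using A B \<phi> by auto
  obtain A' where A': "A' \<in> carrier_mat n n" "A' * A = 1\<^sub>m n" "A * A' = 1\<^sub>m n"
    using A unfolding invertible_mat_def inverts_mat_def
    by (metis carrier_matD(1) carrier_matD(2) carrier_matI index_mult_mat(2) index_mult_mat(3) index_one_mat(2) index_one_mat(3))
  define F where "F = mat 1 n (\<lambda>(_, i). f $ i)"
  have F: "F \<in> carrier_mat 1 n" by (simp add: F_def)
  have F\<phi>: "F * \<phi> = 0\<^sub>m 1 (a + b)"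
  proof (rule eq_matI)
    fix i j assume "i < dim_row (0\<^sub>m 1 (a + b) :: (xyz, 'k) mpoly mat)" "j < dim_col (0\<^sub>m 1 (a + b) :: (xyz, 'k) mpoly mat)"
    then have ij: "i = 0" "j < a + b" by auto
    have "\<phi> *\<^sub>v unit_vec (a + b) j \<in> {\<phi> *\<^sub>v w | w. w \<in> carrier_vec (dim_col \<phi>)}" using \<phi> by auto
    then have "f \<bullet> (\<phi> *\<^sub>v unit_vec (a + b) j) = 0" using f(3) unfolding syzygy_matrix_def by auto
    moreover have "\<phi> *\<^sub>v unit_vec (a + b) j = col \<phi> j"
      using \<phi> ij by (intro eq_vecI) (auto simp: scalar_prod_right_unit)
    moreover have "row F 0 = f" using f(2) by (intro eq_vecI) (auto simp: F_def)
    ultimately show "(F * \<phi>) $$ (i, j) = 0\<^sub>m 1 (a + b) $$ (i, j)" using ij F \<phi> by simp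
  qed (use F \<phi> in auto)
  define W where "W = F * map_mat Const A'"
  have W: "W \<in> carrier_mat 1 n" using F A' by (simp add: W_def)
  have CA: "map_mat Const A' \<in> carrier_mat n n" "map_mat Const A \<in> carrier_mat n n"
    "map_mat Const B \<in> carrier_mat (a + b) (a + b)" "map_mat \<sigma> \<phi> \<in> carrier_mat n (a + b)" "map_mat \<sigma> F \<in> carrier_mat 1 n"
    using A' A B \<phi> F by auto
  have CA': "map_mat Const A' * map_mat Const A = (1\<^sub>m n :: (xyz, 'k) mpoly mat)"
    using K.mat_hom_mult[OF A'(1) A(1)] A'(2) K.mat_hom_one by simp
  have \<sigma>\<phi>: "map_mat \<sigma> F * map_mat \<sigma> \<phi> = 0\<^sub>m 1 (a + b)"
  proof -
    have "map_mat \<sigma> (0\<^sub>m 1 (a + b)) = 0\<^sub>m 1 (a + b)" by (intro eq_matI) auto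
    then show ?thesis using \<sigma>.mat_hom_mult[OF F \<phi>] F\<phi> by simp
  qed
  have "map_mat \<sigma> (map_mat Const A') = map_mat Const A'" by (intro eq_matI) (auto simp: \<sigma>C)
  then have "map_mat \<sigma> W = map_mat \<sigma> F * map_mat Const A'"
    unfolding W_def using \<sigma>.mat_hom_mult[OF F CA(1)] by simp
  then have "map_mat \<sigma> W * basic_matrix entries =
      map_mat \<sigma> F * map_mat Const A' * (map_mat Const A * map_mat \<sigma> \<phi> * map_mat Const B)"
    by (simp add: eq)
  also have "\<dots> = map_mat \<sigma> F * map_mat Const A' * (map_mat Const A * (map_mat \<sigma> \<phi> * map_mat Const B))"
    using CA by (simp add: assoc_mult_mat[of _ n n _ "a + b" _ "a + b"])
  also have "\<dots> = map_mat \<sigma> F * (map_mat Const A' * (map_mat Const A * (map_mat \<sigma> \<phi> * map_mat Const B)))"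
    by (rule assoc_mult_mat[of _ 1 n _ n _ "a + b"]) (use CA in auto)
  also have "map_mat Const A' * (map_mat Const A * (map_mat \<sigma> \<phi> * map_mat Const B)) =
      (map_mat Const A' * map_mat Const A) * (map_mat \<sigma> \<phi> * map_mat Const B)"
    by (rule assoc_mult_mat[symmetric, of _ n n _ n _ "a + b"]) (use CA in auto)
  also have "\<dots> = map_mat \<sigma> \<phi> * map_mat Const B" unfolding CA' by (rule left_mult_one_mat) (use CA in auto)
  also have "map_mat \<sigma> F * (map_mat \<sigma> \<phi> * map_mat Const B) = map_mat \<sigma> F * map_mat \<sigma> \<phi> * map_mat Const B"
    by (rule assoc_mult_mat[symmetric, of _ 1 n _ "a + b" _ "a + b"]) (use CA in auto)
  also have "\<dots> = 0\<^sub>m 1 (a + b)" unfolding \<sigma>\<phi> using CA by simp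
  finally have zero: "map_mat \<sigma> W * basic_matrix entries = 0\<^sub>m 1 (a + b)" .
  define w where "w k = W $$ (0, k)" for k
  have w: "w k = (\<Sum>i<n. Const (A' $$ (i, k)) * f $ i)" if "k < n" for k
    using that F A' unfolding w_def W_def by (simp add: scalar_prod_def F_def atLeast0LessThan mult.commute)
  have "Var vz * \<sigma> (w j) = Var (cvar j) * \<sigma> (w (Suc j))" if j: "j < a + b" for j
  proof -
    have bas: "(basic_matrix entries :: (xyz, 'k) mpoly mat) \<in> carrier_mat n (a + b)" by (simp add: basic_matrix_def n_def)
    have "0 = (map_mat \<sigma> W * basic_matrix entries) $$ (0, j)" using zero j by simp
    also have "\<dots> = (\<Sum>k<n. \<sigma> (w k) * basic_matrix entries $$ (k, j))"
    proof -
      have "dim_row W = 1" "dim_col W = n" 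
        "dim_row (basic_matrix entries :: (xyz, 'k) mpoly mat) = n"
        "dim_col (basic_matrix entries :: (xyz, 'k) mpoly mat) = a + b"
        using W bas by auto
      then show ?thesis
        using j by (subst index_mult_mat(1)) (auto simp: scalar_prod_def w_def atLeast0LessThan intro!: sum.cong)
    qed
    also have "\<dots> = (\<Sum>k<n. (if k = j then \<sigma> (w j) * Var vz else 0) + (if k = Suc j then - (\<sigma> (w (Suc j)) * Var (cvar j)) else 0))"
      by (rule sum.cong) (use j in \<open>auto simp: basic_matrix_def n_def\<close>)
    also have "\<dots> = \<sigma> (w j) * Var vz - \<sigma> (w (Suc j)) * Var (cvar j)"
      using j by (simp add: sum.distrib n_def)
    finally show ?thesis by (simp add: mult.commute)
  qed
  moreover have fhom: "homogeneous (a + b) (f $ i)" "f $ i \<noteq> 0" if "i < n" for i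
    using minimal_generators_degree[OF deg f(1), of i] f(2) that by auto
  have whom: "homogeneous (a + b) (w j)" if "j \<le> a + b" for j
    unfolding w[OF le_imp_less_Suc[OF that, folded n_def]]
    by (intro homogeneous_sum homogeneous_Const_mult fhom) simp
  then have "homogeneous (a + b) (\<sigma> (w j))" if "j \<le> a + b" for j
    unfolding l(2) using that by (intro homogeneous_linear_eval l(1))
  ultimately obtain \<gamma> where \<gamma>: "\<And>k. k \<le> a + b \<Longrightarrow> \<sigma> (w k) = Const \<gamma> * f0 k"
    using kernel_basic[of "\<lambda>j. \<sigma> (w j)"] by blast
  have "W * map_mat Const A = F * (map_mat Const A' * map_mat Const A)"
    unfolding W_def by (rule assoc_mult_mat[OF F CA(1,2)])
  then have WA: "W * map_mat Const A = F" using CA' F by simp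
  have fw: "f $ i = (\<Sum>k<n. Const (A $$ (k, i)) * w k)" if i: "i < n" for i
  proof -
    have "f $ i = F $$ (0, i)" using i by (simp add: F_def)
    also have "\<dots> = (W * map_mat Const A) $$ (0, i)" by (simp add: WA)
    also have "\<dots> = (\<Sum>k<n. w k * Const (A $$ (k, i)))"
      using W A i by (simp add: scalar_prod_def w_def atLeast0LessThan)
    finally show ?thesis by (simp add: mult.commute)
  qed
  \<comment> \<open>Otherwise \<open>w\<close> and hence every generator would vanish, since
    \<open>\<sigma>\<close> is injective.\<close>
  have "\<gamma> \<noteq> 0"
  proof
    assume "\<gamma> = 0"
    have "w k = 0" if "k < n" for k
    proof (rule injD[OF bij_is_inj[OF l(3)]])
      show "\<sigma> (w k) = \<sigma> 0" using \<gamma>[of k] that \<open>\<gamma> = 0\<close> by (simp add: n_def)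
    qed
    then have "f $ 0 = 0" using fw[of 0] by (simp add: n_def)
    then show False using fhom(2)[of 0] by (simp add: n_def)
  qed
  define g where "g k = Const (1 / \<gamma>) * w k" for k
  have gf0: "\<sigma> (g k) = f0 k" if "k \<le> a + b" for k
    using \<gamma>[OF that] \<open>\<gamma> \<noteq> 0\<close> by (simp add: g_def \<sigma>.hom_mult \<sigma>C mult.assoc[symmetric] flip: Const_mult)
  have ghom: "homogeneous (a + b) (g k)" if "k \<le> a + b" for k
    unfolding g_def by (rule homogeneous_Const_mult[OF whom[OF that]])
  have wg: "w k = Const \<gamma> * g k" for k
    using \<open>\<gamma> \<noteq> 0\<close> by (simp add: g_def mult.assoc[symmetric] flip: Const_mult)
  have ideal: "ideal_in UNIV (gen UNIV S)" for S :: "(xyz, 'k) mpoly set"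
    by (rule subr.gen_ideal[OF subr_UNIV]) simp
  have If: "I = gen UNIV ((\<lambda>i. f $ i) ` {..<n})" using minimal_generators_gen[OF f(1)] f(2) by simp
  have "I = gen UNIV (g ` {..a + b})"
  proof
    have "f $ i \<in> gen UNIV (g ` {..a + b})" if "i < n" for i
    proof -
      interpret G: ideal_in UNIV "gen UNIV (g ` {..a + b})" by (rule ideal)
      have "f $ i = (\<Sum>k<n. (Const (A $$ (k, i)) * Const \<gamma>) * g k)"
        using fw[OF that] by (simp add: wg mult.assoc)
      also have "\<dots> \<in> gen UNIV (g ` {..a + b})"
        using subr.gen_incl[OF subr_UNIV, of "g ` {..a + b}"] by (intro G.J_sum G.J_mult) (auto simp: n_def)
      finally show ?thesis .
    qed
    then show "I \<subseteq> gen UNIV (g ` {..a + b})" unfolding If by (intro subr.gen_least[OF subr_UNIV ideal]) auto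
    have "g k \<in> I" if "k \<le> a + b" for k
    proof -
      interpret G: ideal_in UNIV I unfolding If by (rule ideal)
      have "f $ i \<in> I" if "i < n" for i unfolding If by (rule subsetD[OF subr.gen_incl[OF subr_UNIV]]) (use that in simp)
      then have "w k \<in> I"
        unfolding w[OF le_imp_less_Suc[OF \<open>k \<le> a + b\<close>, folded n_def]] by (intro G.J_sum G.J_mult) auto
      then show ?thesis unfolding g_def by (intro G.J_mult) auto
    qed
    then show "gen UNIV (g ` {..a + b}) \<subseteq> I" using If ideal by (intro subr.gen_least[OF subr_UNIV]) auto
  qed
  then show ?thesis using l gf0 ghom by (intro exI[of _ l] exI[of _ g]) auto
qed

end

section \<open>The Rees algebra and the special fiber as monoid algebras\<close>

lemma subr_generate_ring: "subr (generate_ring ring_of_type_algebra H)"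
proof unfold_locales
  show "1 \<in> generate_ring ring_of_type_algebra H"
    using generate_ring.one[of ring_of_type_algebra H] by (simp add: ring_of_type_algebra_def)
next
  fix x :: 'a assume "x \<in> generate_ring ring_of_type_algebra H"
  then show "- x \<in> generate_ring ring_of_type_algebra H"
    using generate_ring.a_inv[of x ring_of_type_algebra H] subr.a_inv_ring_on[OF subr_UNIV, of x]
    by (simp add: ring_on_UNIV)
next
  fix x y :: 'a assume *: "x \<in> generate_ring ring_of_type_algebra H" "y \<in> generate_ring ring_of_type_algebra H"
  show "x + y \<in> generate_ring ring_of_type_algebra H"
    using generate_ring.eng_add[OF *] by (simp add: ring_of_type_algebra_def)
  show "x * y \<in> generate_ring ring_of_type_algebra H"
    using generate_ring.eng_mult[OF *] by (simp add: ring_of_type_algebra_def)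
qed

lemma generate_ring_least:
  assumes "subr B" "H \<subseteq> B" shows "generate_ring ring_of_type_algebra H \<subseteq> B"
proof
  interpret subr B by fact
  fix x assume "x \<in> generate_ring ring_of_type_algebra H"
  then show "x \<in> B"
  proof (induction rule: generate_ring.induct)
    case (a_inv h)
    then show ?case using subr.a_inv_ring_on[OF subr_UNIV, of h] by (simp add: ring_on_UNIV)
  qed (use assms(2) in \<open>auto simp: ring_of_type_algebra_def\<close>)
qed

definition rees_carrier :: "'r::comm_ring_1 set \<Rightarrow> 'r poly set" where
  "rees_carrier I = generate_ring ring_of_type_algebra (range (\<lambda>r. [:r:]) \<union> {monom a 1 | a. a \<in> I})"

lemma rees_algebra_ring_on: "rees_algebra I = ring_on (rees_carrier I)"
  by (simp add: rees_algebra_def ring_on_def rees_carrier_def)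

lemma subr_rees_carrier: "subr (rees_carrier I)"
  unfolding rees_carrier_def by (rule subr_generate_ring)

lemma const_in_rees: "[:r:] \<in> rees_carrier I" and monom_in_rees: "f \<in> I \<Longrightarrow> monom f 1 \<in> rees_carrier I"
  unfolding rees_carrier_def by (auto intro!: generate_ring.incl)

lemma mono_at_power:
  "(mono_at (p, q, r, s) :: int4 \<Rightarrow>\<^sub>0 'k::field) ^ n = mono_at (int n * p, int n * q, int n * r, int n * s)"
  by (induction n) (auto simp: mult_single algebra_simps zero_prod_def[symmetric])

lemma comm_ring_hom_comp: "comm_ring_hom f \<Longrightarrow> comm_ring_hom g \<Longrightarrow> comm_ring_hom (\<lambda>x. f (g x))"
proof -
  assume "comm_ring_hom f" "comm_ring_hom g"
  then interpret f: comm_ring_hom f + g: comm_ring_hom g .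
  show ?thesis by unfold_locales (auto simp: f.hom_add f.hom_mult g.hom_add g.hom_mult)
qed

lemma comm_ring_hom_map_poly: "comm_ring_hom f \<Longrightarrow> comm_ring_hom (map_poly f)"
proof -
  assume "comm_ring_hom f"
  then interpret f: comm_ring_hom f .
  interpret mp: map_poly_comm_ring_hom f ..
  show ?thesis by (rule mp.comm_ring_hom_axioms)
qed

lemma comm_ring_hom_kconst: "comm_ring_hom (kconst :: 'k::field \<Rightarrow> 'g::ab_group_add \<Rightarrow>\<^sub>0 'k)"
  by unfold_locales (auto simp: single_add mult_single)

section \<open>Embedding of R[T] into Laurent polynomials and the grading by excess\<close>

context two_blocks begin

fun xyz_pt :: "xyz \<Rightarrow> int4" where
  "xyz_pt vx = (1, 0, 0, 0)" | "xyz_pt vy = (0, 1, 0, 0)" | "xyz_pt vz = (0, 0, 1, 0)"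

definition ev :: "(xyz, 'k::field) mpoly \<Rightarrow> int4 \<Rightarrow>\<^sub>0 'k" where
  "ev = mpoly_eval kconst (\<lambda>v. mono_at (xyz_pt v))"

text \<open>The exponent of the monomial \<open>m\<close> times the \<open>i\<close>-th power of T
  in the basis x, y, z, \<open>t\<^sub>0\<close>.\<close>

definition pos :: "(xyz \<Rightarrow>\<^sub>0 nat) \<Rightarrow> nat \<Rightarrow> int4" where
  "pos m i = (int (Poly_Mapping.lookup m vx) - int (a * i), int (Poly_Mapping.lookup m vy) - int (b * i),
     int (Poly_Mapping.lookup m vz), int i)"

text \<open>The variable \<open>T\<close> has exponent \<open>(- a, - b, 0, 1)\<close>, since \<open>t\<^sub>0 = x\<^sup>a y\<^sup>b T\<close>.\<close>

definition \<Phi> :: "(xyz, 'k::field) mpoly poly \<Rightarrow> int4 \<Rightarrow>\<^sub>0 'k" where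
  "\<Phi> P = poly (map_poly ev P) (mono_at (- int a, - int b, 0, 1))"

lemma comm_ring_hom_ev: "comm_ring_hom (ev :: (xyz, 'k::field) mpoly \<Rightarrow> _)"
  unfolding ev_def by (rule comm_ring_hom.comm_ring_hom_mpoly_eval[OF comm_ring_hom_kconst])

lemma comm_ring_hom_poly: "comm_ring_hom (\<lambda>p :: 'r::comm_ring_1 poly. poly p x)"
  by unfold_locales auto

lemma comm_ring_hom_\<Phi>: "comm_ring_hom (\<Phi> :: (xyz, 'k::field) mpoly poly \<Rightarrow> _)"
  using comm_ring_hom_comp[OF comm_ring_hom_poly comm_ring_hom_map_poly[OF comm_ring_hom_ev]]
  by (simp add: \<Phi>_def[abs_def])

lemma ev_single: "ev (Poly_Mapping.single m c) = Poly_Mapping.single (pos m 0) c"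
proof -
  have "moneval (\<lambda>v. mono_at (xyz_pt v) :: int4 \<Rightarrow>\<^sub>0 'a) m = (\<Prod>v\<in>{vx, vy, vz}. mono_at (xyz_pt v) ^ Poly_Mapping.lookup m v)"
    by (rule moneval_superset) (simp, simp flip: UNIV_xyz)
  then show ?thesis by (simp add: ev_def mpoly_eval_single mono_at_power mult_single pos_def)
qed

lemma pos_shift: "pos m 0 + (int i * - int a, int i * - int b, 0, int i) = pos m i"
  by (simp add: pos_def algebra_simps)

lemma \<Phi>_monom: "\<Phi> (monom f i) = ev f * mono_at (int i * - int a, int i * - int b, 0, int i)"
proof -
  interpret comm_ring_hom "ev :: (xyz, 'a) mpoly \<Rightarrow> _" by (rule comm_ring_hom_ev)
  show ?thesis by (simp add: \<Phi>_def poly_monom mono_at_power)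
qed

lemma \<Phi>_single: "\<Phi> (monom (Poly_Mapping.single m c) i) = Poly_Mapping.single (pos m i) c"
  unfolding \<Phi>_monom ev_single mult_single pos_shift by simp

lemma pos_inj: "pos m i = pos m' i' \<Longrightarrow> m = m' \<and> i = i'"
  by (auto simp: pos_def intro: xyz_eqI)

lemma lookup_\<Phi>: "Poly_Mapping.lookup (\<Phi> P) (pos m i) = Poly_Mapping.lookup (coeff P i) m"
proof -
  interpret comm_ring_hom "\<Phi> :: (xyz, 'a) mpoly poly \<Rightarrow> _" by (rule comm_ring_hom_\<Phi>)
  have mono: "Poly_Mapping.lookup (\<Phi> (monom f j)) (pos m i) = (if j = i then Poly_Mapping.lookup f m else 0)"
    for f :: "(xyz, 'a) mpoly" and j
  proof -
    have "monom f j = (\<Sum>m\<in>Poly_Mapping.keys f. monom (Poly_Mapping.single m (Poly_Mapping.lookup f m)) j)"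
      by (simp flip: monom_sum poly_mapping_expand)
    then have "\<Phi> (monom f j) = (\<Sum>m\<in>Poly_Mapping.keys f. Poly_Mapping.single (pos m j) (Poly_Mapping.lookup f m))"
      by (simp add: hom_sum \<Phi>_single)
    then have "Poly_Mapping.lookup (\<Phi> (monom f j)) (pos m i) =
        (\<Sum>m'\<in>Poly_Mapping.keys f. if m' = m \<and> j = i then Poly_Mapping.lookup f m' else 0)"
      using pos_inj by (auto simp: lookup_sum lookup_single when_def intro!: sum.cong)
    then show ?thesis by (auto simp: in_keys_iff)
  qed
  have "\<Phi> P = (\<Sum>j\<le>Polynomial.degree P. \<Phi> (monom (coeff P j) j))"
    by (subst poly_as_sum_of_monoms[symmetric]) (simp add: hom_sum)
  then have "Poly_Mapping.lookup (\<Phi> P) (pos m i) =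
      (\<Sum>j\<le>Polynomial.degree P. if j = i then Poly_Mapping.lookup (coeff P j) m else 0)"
    by (simp add: lookup_sum mono)
  then show ?thesis by (auto simp: coeff_eq_0)
qed

lemma \<Phi>_eq_0: "\<Phi> P = 0 \<Longrightarrow> P = 0"
proof -
  assume "\<Phi> P = 0"
  then have "Poly_Mapping.lookup (coeff P i) m = 0" for i m using lookup_\<Phi>[of P m i] by simp
  then have "coeff P i = 0" for i by (intro poly_mapping_eqI) simp
  then show ?thesis by (simp add: poly_eq_iff)
qed

lemma pos_mexp: "i \<le> a + b \<Longrightarrow> pos (mexp i) 1 = pt i"
  by (auto simp: pos_def pt_def)

lemma SA_xyz: "xyz_pt w \<in> SA"
  by (cases w) (auto simp: SA_def neg_def)

text \<open>The exponents that have excess 0 or remain in \<open>SA\<close> after division by a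
  variable form a submonoid, and it contains all generators.\<close>

lemma excess_pos_divisible:
  assumes "g \<in> SA" "excess g > 0" shows "\<exists>w. g - xyz_pt w \<in> SA"
proof -
  interpret SA: submonoid SA by (rule submonoid_SA)
  define G where "G = {g \<in> SA. excess g = 0 \<or> (\<exists>w. g - xyz_pt w \<in> SA)}"
  have "submonoid G"
  proof unfold_locales
    fix g g' assume *: "g \<in> G" "g' \<in> G"
    then have mem: "g + g' \<in> SA" by (auto simp: G_def)
    have "\<exists>w. g + g' - xyz_pt w \<in> SA" if "g - xyz_pt w \<in> SA" for w
      using SA.add_S[OF that, of g'] * by (auto simp: G_def algebra_simps)
    moreover have "\<exists>w. g + g' - xyz_pt w \<in> SA" if "g' - xyz_pt w \<in> SA" for w
      using SA.add_S[OF _ that, of g] * by (auto simp: G_def algebra_simps)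
    ultimately show "g + g' \<in> G" using * mem by (auto simp: G_def)
  qed (auto simp: G_def)
  then have "SA \<subseteq> G"
  proof (rule SA_generated)
    show "pt i \<in> G" if "i \<le> a + b" for i using pt_mem[OF that] by (auto simp: G_def FA_def)
    have "xyz_pt w \<in> G" for w using SA_xyz[of w] SA.zero_S unfolding G_def by (metis (mono_tags, lifting) cancel_comm_monoid_add_class.diff_cancel mem_Collect_eq)
    from this[of vx] this[of vy] this[of vz] show "(1, 0, 0, 0) \<in> G" "(0, 1, 0, 0) \<in> G" "(0, 0, 1, 0) \<in> G" by simp_all
  qed
  then show ?thesis using assms by (auto simp: G_def)
qed

definition low :: "(int4 \<Rightarrow>\<^sub>0 'k::field) \<Rightarrow> int4 \<Rightarrow>\<^sub>0 'k" where
  "low p = Poly_Mapping.mapp (\<lambda>g c. c when excess g = 0) p"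

lemma lookup_low: "Poly_Mapping.lookup (low p) g = (Poly_Mapping.lookup p g when excess g = 0)"
  by (simp add: low_def lookup_mapp when_def in_keys_iff)

lemma low_add: "low (p + q) = low p + low q"
  by (rule poly_mapping_eqI) (simp add: lookup_low lookup_add when_def)

lemma low_id: "(\<And>g. g \<in> Poly_Mapping.keys p \<Longrightarrow> excess g = 0) \<Longrightarrow> low p = p"
  by (rule poly_mapping_eqI) (auto simp: lookup_low when_def in_keys_iff)

lemma low_eq_0: "(\<And>g. g \<in> Poly_Mapping.keys p \<Longrightarrow> excess g \<noteq> 0) \<Longrightarrow> low p = 0"
  by (rule poly_mapping_eqI) (auto simp: lookup_low when_def in_keys_iff)

lemma keys_low: "g \<in> Poly_Mapping.keys (low p) \<longleftrightarrow> g \<in> Poly_Mapping.keys p \<and> excess g = 0"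
  by (auto simp: in_keys_iff lookup_low when_def)

text \<open>On \<open>SA\<close> the excess is nonnegative, so the part of positive excess absorbs
  products and the projection to excess 0 is multiplicative.\<close>

lemma low_mult:
  assumes "p \<in> malg SA" "q \<in> malg SA" shows "low (p * q) = low p * low q"
proof -
  have ex: "excess g \<ge> 0" if "g \<in> Poly_Mapping.keys r" "r \<in> malg SA" for g and r :: "int4 \<Rightarrow>\<^sub>0 'a"
    using that by (intro excess_nonneg) (auto simp: malg_def)
  define p' where "p' = p - low p"
  define q' where "q' = q - low q"
  have keys': "excess g > 0" if "g \<in> Poly_Mapping.keys (r - low r)" "r \<in> malg SA" for g and r :: "int4 \<Rightarrow>\<^sub>0 'a"
    using that ex[of g r] by (auto simp: in_keys_iff lookup_minus lookup_low when_def split: if_splits)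
  have "p * q = low p * low q + (p' * q + low p * q')" by (simp add: p'_def q'_def algebra_simps)
  then have "low (p * q) = low (low p * low q) + (low (p' * q) + low (low p * q'))"
    by (simp only: low_add)
  also have "low (low p * low q) = low p * low q"
  proof (rule low_id)
    fix g assume "g \<in> Poly_Mapping.keys (low p * low q)"
    then obtain x y where "g = x + y" "x \<in> Poly_Mapping.keys (low p)" "y \<in> Poly_Mapping.keys (low q)"
      using keys_mult by blast
    then show "excess g = 0" by (simp add: keys_low)
  qed
  also have "low (p' * q) = 0"
  proof (rule low_eq_0)
    fix g assume "g \<in> Poly_Mapping.keys (p' * q)"
    then obtain x y where "g = x + y" "x \<in> Poly_Mapping.keys p'" "y \<in> Poly_Mapping.keys q" using keys_mult by blast
    then show "excess g \<noteq> 0" using keys'[of x p] ex[of y q] assms by (simp add: p'_def)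
  qed
  also have "low (low p * q') = 0"
  proof (rule low_eq_0)
    fix g assume "g \<in> Poly_Mapping.keys (low p * q')"
    then obtain x y where "g = x + y" "x \<in> Poly_Mapping.keys (low p)" "y \<in> Poly_Mapping.keys q'" using keys_mult by blast
    then show "excess g \<noteq> 0" using keys'[of y q] assms by (simp add: q'_def keys_low)
  qed
  finally show ?thesis by simp
qed

end

text \<open>The outcome of the reduction: a bijective linear substitution that carries generators of
  \<open>I\<close> to the standard monomials. The ground field is arbitrary here; algebraic
  closedness enters only with the Nullstellensatz.\<close>

locale rees_setup = two_blocks a b for a b :: nat +
  fixes I :: "(xyz, 'k::field) mpoly set" and l :: "xyz \<Rightarrow> (xyz, 'k) mpoly" and g :: "nat \<Rightarrow> (xyz, 'k) mpoly"
  assumes l_hom: "\<And>v. homogeneous 1 (l v)" and bij_l: "bij (mpoly_eval Const l)"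
    and g_f0: "\<And>i. i \<le> a + b \<Longrightarrow> mpoly_eval Const l (g i) = f0 i"
    and g_hom: "\<And>i. i \<le> a + b \<Longrightarrow> homogeneous (a + b) (g i)"
    and I_gen: "I = gen UNIV (g ` {..a + b})"
begin

definition \<sigma> :: "(xyz, 'k) mpoly \<Rightarrow> (xyz, 'k) mpoly" where "\<sigma> = mpoly_eval Const l"
definition \<tau> :: "(xyz, 'k) mpoly \<Rightarrow> (xyz, 'k) mpoly" where "\<tau> = inv_into UNIV \<sigma>"
definition \<Psi> :: "(xyz, 'k) mpoly poly \<Rightarrow> int4 \<Rightarrow>\<^sub>0 'k" where "\<Psi> P = \<Phi> (map_poly \<sigma> P)"

sublocale \<sigma>: comm_ring_hom \<sigma>
  unfolding \<sigma>_def by (rule comm_ring_hom.comm_ring_hom_mpoly_eval[OF comm_ring_hom_Const])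

lemma bij_\<sigma>: "bij \<sigma>" unfolding \<sigma>_def by (rule bij_l)

lemma \<sigma>\<tau> [simp]: "\<sigma> (\<tau> x) = x" and \<tau>\<sigma> [simp]: "\<tau> (\<sigma> x) = x"
  using bij_\<sigma> by (simp_all add: \<tau>_def bij_is_surj surj_f_inv_f bij_is_inj)

lemma \<sigma>_inj: "\<sigma> x = \<sigma> y \<Longrightarrow> x = y"
  using bij_\<sigma> by (simp add: bij_is_inj inj_eq)

lemma \<sigma>_Const [simp]: "\<sigma> (Const c) = Const c"
  unfolding \<sigma>_def by (rule comm_ring_hom.mpoly_eval_Const[OF comm_ring_hom_Const])

lemma comm_ring_hom_\<Psi>: "comm_ring_hom \<Psi>"
  using comm_ring_hom_comp[OF comm_ring_hom_\<Phi> comm_ring_hom_map_poly[OF \<sigma>.comm_ring_hom_axioms]]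
  by (simp add: \<Psi>_def[abs_def])

sublocale \<Psi>: comm_ring_hom \<Psi> by (rule comm_ring_hom_\<Psi>)

lemma \<Psi>_eq_0: "\<Psi> P = 0 \<Longrightarrow> P = 0"
proof -
  assume "\<Psi> P = 0"
  then have "map_poly \<sigma> P = 0" unfolding \<Psi>_def by (rule \<Phi>_eq_0)
  then have "\<sigma> (coeff P i) = \<sigma> 0" for i
    using coeff_map_poly[of \<sigma> P i] by simp
  then have "coeff P i = 0" for i by (rule \<sigma>_inj)
  then show ?thesis by (simp add: poly_eq_iff)
qed

lemma \<Psi>_inj: "\<Psi> P = \<Psi> Q \<Longrightarrow> P = Q"
  using \<Psi>_eq_0[of "P - Q"] by (simp add: \<Psi>.hom_minus)

lemma \<Psi>_monom: "\<Psi> (monom f i) = \<Phi> (monom (\<sigma> f) i)"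
  by (simp add: \<Psi>_def)

lemma \<Psi>_const: "\<Psi> [:r:] = ev (\<sigma> r)"
  using \<Psi>_monom[of r 0] \<Phi>_monom[of "\<sigma> r" 0] by (simp add: monom_0 zero_prod_def[symmetric])

lemma \<Psi>_g: "i \<le> a + b \<Longrightarrow> \<Psi> (monom (g i) 1) = mono_at (pt i)"
  using g_f0[of i] by (simp add: \<Psi>_monom f0_def \<Phi>_single pos_mexp[unfolded One_nat_def] flip: \<sigma>_def)

lemma \<Psi>_xyz: "\<Psi> [:\<tau> (Var w):] = mono_at (xyz_pt w)"
  by (simp add: \<Psi>_const ev_def comm_ring_hom.mpoly_eval_Var[OF comm_ring_hom_kconst])

lemma \<Psi>_Const: "\<Psi> [:Const c:] = kconst c"
  by (simp add: \<Psi>_const ev_def comm_ring_hom.mpoly_eval_Const[OF comm_ring_hom_kconst])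

lemma subr_malg: "subr (malg SA :: (int4 \<Rightarrow>\<^sub>0 'k) set)"
  using kalg.axioms(1)[OF submonoid.kalg_malg[OF submonoid_SA]] .

lemma ev_malg: "ev (p :: (xyz, 'k) mpoly) \<in> malg SA"
proof -
  interpret A: kalg "malg SA :: (int4 \<Rightarrow>\<^sub>0 'k) set" kconst by (rule submonoid.kalg_malg[OF submonoid_SA])
  interpret ev: comm_ring_hom "ev :: (xyz, 'k) mpoly \<Rightarrow> _" by (rule comm_ring_hom_ev)
  have pos_SA: "pos m 0 \<in> SA" for m by (auto simp: pos_def SA_def neg_def)
  have "(\<Sum>m\<in>Poly_Mapping.keys p. ev (Poly_Mapping.single m (Poly_Mapping.lookup p m))) \<in> malg SA"
    by (rule A.sum_mem) (use pos_SA in \<open>auto simp: ev_single malg_def\<close>)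
  then show ?thesis by (simp flip: ev.hom_sum poly_mapping_expand)
qed

lemma g_in_I: "i \<le> a + b \<Longrightarrow> g i \<in> I"
  unfolding I_gen by (rule subsetD[OF subr.gen_incl[OF subr_UNIV]]) simp

lemma \<Psi>_image: "\<Psi> ` rees_carrier I = malg SA"
proof
  interpret A: kalg "malg SA :: (int4 \<Rightarrow>\<^sub>0 'k) set" kconst by (rule submonoid.kalg_malg[OF submonoid_SA])
  interpret RR: subr "rees_carrier I" by (rule subr_rees_carrier)
  have "subr {P. \<Psi> P \<in> malg SA}"
    by unfold_locales (auto simp: \<Psi>.hom_add \<Psi>.hom_mult \<Psi>.hom_uminus)
  moreover have "range (\<lambda>r. [:r:]) \<union> {monom f 1 |f. f \<in> I} \<subseteq> {P. \<Psi> P \<in> malg SA}"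
  proof -
    have "\<Psi> (monom f 1) \<in> malg SA" if f: "f \<in> I" for f
    proof -
      obtain r where r: "f = (\<Sum>i\<le>a + b. r i * g i)" using f gen_type_indexed[of "{..a + b}" g] by (auto simp: I_gen)
      have "monom f 1 = (\<Sum>i\<le>a + b. [:r i:] * monom (g i) 1)"
        unfolding r by (simp add: monom_sum smult_monom)
      then have "\<Psi> (monom f 1) = (\<Sum>i\<le>a + b. ev (\<sigma> (r i)) * mono_at (pt i))"
        by (simp add: \<Psi>.hom_sum \<Psi>.hom_mult \<Psi>_const \<Psi>_g[unfolded One_nat_def] del: mult_pCons_left)
      also have "\<dots> \<in> malg SA" using ev_malg pt_mem by (intro A.sum_mem A.mult_mem) (auto simp: FA_def)
      finally show ?thesis .
    qed
    then show ?thesis using ev_malg by (auto simp: \<Psi>_const)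
  qed
  ultimately have "rees_carrier I \<subseteq> {P. \<Psi> P \<in> malg SA}"
    unfolding rees_carrier_def by (rule generate_ring_least)
  then show "\<Psi> ` rees_carrier I \<subseteq> malg SA" by auto
  have "subr (\<Psi> ` rees_carrier I)"
  proof unfold_locales
    have "\<Psi> 1 = 1" by simp
    then show "1 \<in> \<Psi> ` rees_carrier I" using RR.one_mem by (metis image_eqI)
  next
    fix x assume "x \<in> \<Psi> ` rees_carrier I"
    then obtain P where "x = \<Psi> P" "P \<in> rees_carrier I" by auto
    then show "- x \<in> \<Psi> ` rees_carrier I" by (intro image_eqI[of _ _ "- P"]) (auto simp: \<Psi>.hom_uminus)
  next
    fix x y assume "x \<in> \<Psi> ` rees_carrier I" "y \<in> \<Psi> ` rees_carrier I"
    then obtain P Q where *: "x = \<Psi> P" "P \<in> rees_carrier I" "y = \<Psi> Q" "Q \<in> rees_carrier I" by auto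
    show "x + y \<in> \<Psi> ` rees_carrier I" using * by (intro image_eqI[of _ _ "P + Q"]) (auto simp: \<Psi>.hom_add)
    show "x * y \<in> \<Psi> ` rees_carrier I" using * by (intro image_eqI[of _ _ "P * Q"]) (auto simp: \<Psi>.hom_mult)
  qed
  then interpret Im: subr "\<Psi> ` rees_carrier I" .
  have im: "x \<in> \<Psi> ` rees_carrier I" if "\<Psi> P = x" "P \<in> rees_carrier I" for x P using that by auto
  interpret Im: kalg "\<Psi> ` rees_carrier I" kconst
    by unfold_locales (auto simp: single_add mult_single im[OF \<Psi>_Const const_in_rees])
  have "set gens_rees \<subseteq> \<Psi> ` rees_carrier I"
  proof -
    have "mono_at (xyz_pt v) \<in> \<Psi> ` rees_carrier I" for v
      by (rule im[OF \<Psi>_xyz const_in_rees])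
    from this[of vx] this[of vy] this[of vz]
    have "mono_at (1, 0, 0, 0) \<in> \<Psi> ` rees_carrier I" "mono_at (0, 1, 0, 0) \<in> \<Psi> ` rees_carrier I"
      "mono_at (0, 0, 1, 0) \<in> \<Psi> ` rees_carrier I" by simp_all
    moreover have "mono_at (pt i) \<in> \<Psi> ` rees_carrier I" if "i \<le> a + b" for i
      by (rule im[OF \<Psi>_g[OF that] monom_in_rees[OF g_in_I[OF that]]])
    ultimately show ?thesis unfolding gens_rees_def gens_fiber_def by (auto simp del: upt_Suc)
  qed
  then show "malg SA \<subseteq> \<Psi> ` rees_carrier I" unfolding malg_generated(1) by (rule Im.kgen_least)
qed

lemma iso_rees: "iso_rings (rees_algebra I) (ring_on (malg SA)) \<Psi>"
proof -
  interpret RR: subr "rees_carrier I" by (rule subr_rees_carrier)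
  interpret A: subr "malg SA :: (int4 \<Rightarrow>\<^sub>0 'k) set" by (rule subr_malg)
  have "bij_betw \<Psi> (rees_carrier I) (malg SA)"
    using \<Psi>_image \<Psi>_inj by (auto simp: bij_betw_def inj_on_def)
  then have "\<Psi> \<in> ring_iso (ring_on (rees_carrier I)) (ring_on (malg SA))"
    using \<Psi>_image by (intro ring_iso_memI) (auto simp: \<Psi>.hom_add \<Psi>.hom_mult)
  then show ?thesis
    unfolding rees_algebra_ring_on using RR.cring_ring_on A.cring_ring_on by (simp add: iso_rings_def)
qed

lemma vars_ideal:
  assumes "Poly_Mapping.lookup r 0 = 0"
  shows "[:r:] \<in> gen (rees_carrier I) {[:Var vx:], [:Var vy:], [:Var vz:]}"
proof -
  interpret RR: subr "rees_carrier I" by (rule subr_rees_carrier)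
  let ?J = "gen (rees_carrier I) {[:Var vx:], [:Var vy:], [:Var vz:]}"
  interpret J: ideal_in "rees_carrier I" ?J by (rule RR.gen_ideal) (auto intro: const_in_rees)
  have "[:Poly_Mapping.single m c:] \<in> ?J" if m: "m \<in> Poly_Mapping.keys r" for m c
  proof -
    have "m \<noteq> 0" using m assms by (auto simp: in_keys_iff)
    then obtain w where w: "w \<in> Poly_Mapping.keys m" by (metis all_not_in_conv keys_eq_empty)
    then have mw: "(m - Poly_Mapping.single w 1) + Poly_Mapping.single w 1 = m"
      by (intro poly_mapping_eqI) (auto simp: lookup_add lookup_minus lookup_single when_def in_keys_iff)
    have "Poly_Mapping.single (m - Poly_Mapping.single w 1) c * Var w = Poly_Mapping.single m c"
      unfolding Var_def mult_single mw by simp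
    then have "[:Poly_Mapping.single m c:] = [:Poly_Mapping.single (m - Poly_Mapping.single w 1) c:] * [:Var w:]"
      by (simp add: mult.commute)
    moreover have "[:Var w:] \<in> ?J" using RR.gen_incl[of "{[:Var vx:], [:Var vy:], [:Var vz:]}"] by (cases w) auto
    ultimately show ?thesis by (simp only: J.J_mult const_in_rees)
  qed
  then have "(\<Sum>m\<in>Poly_Mapping.keys r. [:Poly_Mapping.single m (Poly_Mapping.lookup r m):]) \<in> ?J" by (intro J.J_sum)
  also have "(\<Sum>m\<in>Poly_Mapping.keys r. [:Poly_Mapping.single m (Poly_Mapping.lookup r m):]) =
      monom (\<Sum>m\<in>Poly_Mapping.keys r. Poly_Mapping.single m (Poly_Mapping.lookup r m)) 0"
    unfolding monom_sum by (simp add: monom_0)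
  finally show ?thesis by (simp add: monom_0 flip: poly_mapping_expand)
qed

text \<open>Only \<open>\<sigma>\<close> is given by linear forms, not its inverse. That
  \<open>\<sigma>\<close> preserves constant terms is enough to see that
  \<open>\<tau> (Var w)\<close> has none and hence lies in the ideal of the variables.\<close>

lemma lookup_\<sigma>_0: "Poly_Mapping.lookup (\<sigma> r) 0 = Poly_Mapping.lookup r 0"
proof -
  have h0: "hcomp 0 (\<sigma> r) = Const (Poly_Mapping.lookup r 0)"
  proof -
    have "hcomp 0 (Const c * moneval l m) = (if m = 0 then Const c else 0)" for c m
    proof -
      have "homogeneous (mdeg m) (Const c * moneval l m)"
        using homogeneous_Const_mult[OF homogeneous_moneval[of m 1 l]] l_hom by simp
      from hcomp_homogeneous[OF this, of 0] show ?thesis using mdeg_eq_0[of m] by (auto simp: when_def)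
    qed
    then have "hcomp 0 (\<sigma> r) = (\<Sum>m\<in>Poly_Mapping.keys r. if m = 0 then Const (Poly_Mapping.lookup r m) else 0)"
      by (simp add: \<sigma>_def mpoly_eval_moneval hcomp_sum)
    then show ?thesis by (auto simp: in_keys_iff)
  qed
  have "Poly_Mapping.lookup (\<sigma> r) 0 = Poly_Mapping.lookup (hcomp 0 (\<sigma> r)) 0" by (simp add: lookup_hcomp)
  then show ?thesis by (simp add: h0 Const_def)
qed

text \<open>The image of a variable is a linear form, so it has excess 1 throughout. Conversely,
  every monomial of positive excess is divisible by some \<open>xyz_pt w\<close>, and the preimage
  of that factor is in the ideal of the variables.\<close>

lemma special_fiber_kernel:
  "{P \<in> rees_carrier I. low (\<Psi> P) = 0} = gen (rees_carrier I) {[:Var vx:], [:Var vy:], [:Var vz:]}" (is "?K = ?J")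
proof
  interpret RR: subr "rees_carrier I" by (rule subr_rees_carrier)
  interpret A: kalg "malg SA :: (int4 \<Rightarrow>\<^sub>0 'k) set" kconst by (rule submonoid.kalg_malg[OF submonoid_SA])
  interpret J: ideal_in "rees_carrier I" ?J by (rule RR.gen_ideal) (auto intro: const_in_rees)
  have mem: "\<Psi> P \<in> malg SA" if "P \<in> rees_carrier I" for P using \<Psi>_image that by auto
  have low0: "low 0 = 0" by (rule low_eq_0) simp
  have K: "ideal_in (rees_carrier I) ?K"
    by unfold_locales (auto simp: \<Psi>.hom_add \<Psi>.hom_mult low_add low_mult mem low0)
  have "low (\<Psi> [:Var v:]) = 0" for v
  proof (rule low_eq_0)
    fix \<gamma> assume \<gamma>: "\<gamma> \<in> Poly_Mapping.keys (\<Psi> [:Var v:])"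
    interpret ev: comm_ring_hom "ev :: (xyz, 'k) mpoly \<Rightarrow> _" by (rule comm_ring_hom_ev)
    have "\<Psi> [:Var v:] = ev (l v)"
      by (simp add: \<Psi>_const \<sigma>_def comm_ring_hom.mpoly_eval_Var[OF comm_ring_hom_Const])
    also have "\<dots> = (\<Sum>m\<in>Poly_Mapping.keys (l v). Poly_Mapping.single (pos m 0) (Poly_Mapping.lookup (l v) m))"
      by (subst poly_mapping_expand) (simp add: ev.hom_sum ev_single)
    finally have "Poly_Mapping.lookup (\<Sum>m\<in>Poly_Mapping.keys (l v). Poly_Mapping.single (pos m 0) (Poly_Mapping.lookup (l v) m)) \<gamma> \<noteq> 0"
      using \<gamma> by (simp add: in_keys_iff)
    then have "(\<Sum>m\<in>Poly_Mapping.keys (l v). Poly_Mapping.lookup (Poly_Mapping.single (pos m 0) (Poly_Mapping.lookup (l v) m)) \<gamma>) \<noteq> 0"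
      by (simp add: lookup_sum)
    then obtain m where m: "m \<in> Poly_Mapping.keys (l v)" "Poly_Mapping.lookup (Poly_Mapping.single (pos m 0) (Poly_Mapping.lookup (l v) m)) \<gamma> \<noteq> 0"
      by (rule sum.not_neutral_contains_not_neutral)
    then have m: "m \<in> Poly_Mapping.keys (l v)" "\<gamma> = pos m 0" by (auto simp: lookup_single when_def split: if_splits)
    have "mdeg m = 1" using l_hom[of v] m(1) by (simp add: homogeneous_def)
    then show "excess \<gamma> \<noteq> 0" by (simp add: m(2) pos_def excess_def mdeg_xyz)
  qed
  then show "?J \<subseteq> ?K" by (intro RR.gen_least[OF K]) (auto intro: const_in_rees)
  show "?K \<subseteq> ?J"
  proof
    fix P assume "P \<in> ?K"
    then have P: "P \<in> rees_carrier I" "low (\<Psi> P) = 0" by auto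
    have divis: "\<exists>Q\<in>?J. \<Psi> Q = Poly_Mapping.single \<gamma> c" if \<gamma>: "\<gamma> \<in> Poly_Mapping.keys (\<Psi> P)" for \<gamma> c
    proof -
      have "\<gamma> \<in> SA" using mem[OF P(1)] \<gamma> by (auto simp: malg_def)
      moreover have "excess \<gamma> \<noteq> 0"
        using \<gamma> P(2) keys_low[of \<gamma> "\<Psi> P"] by auto
      ultimately obtain w where w: "\<gamma> - xyz_pt w \<in> SA" using excess_pos_divisible excess_nonneg by (metis order_le_less)
      then have "(Poly_Mapping.single (\<gamma> - xyz_pt w) c :: int4 \<Rightarrow>\<^sub>0 'k) \<in> \<Psi> ` rees_carrier I"
        unfolding \<Psi>_image by (auto simp: malg_def)
      then obtain Q where Q: "Q \<in> rees_carrier I" "\<Psi> Q = Poly_Mapping.single (\<gamma> - xyz_pt w) c" by auto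
      have "Poly_Mapping.single w (1 :: nat) \<noteq> 0" by (metis lookup_single_eq lookup_zero zero_neq_one)
      then have "Poly_Mapping.lookup (\<tau> (Var w)) 0 = 0"
        using lookup_\<sigma>_0[of "\<tau> (Var w)"] by (simp add: Var_def lookup_single when_def)
      then have "[:\<tau> (Var w):] \<in> ?J" by (rule vars_ideal)
      then have "Q * [:\<tau> (Var w):] \<in> ?J" using Q(1) by (rule J.J_mult[rotated])
      moreover have "\<Psi> (Q * [:\<tau> (Var w):]) = Poly_Mapping.single \<gamma> c"
        unfolding \<Psi>.hom_mult \<Psi>_xyz Q(2) by (simp add: mult_single)
      ultimately show ?thesis by blast
    qed
    then have "\<forall>\<gamma>\<in>Poly_Mapping.keys (\<Psi> P). \<exists>Q. Q \<in> ?J \<and> \<Psi> Q = Poly_Mapping.single \<gamma> (Poly_Mapping.lookup (\<Psi> P) \<gamma>)"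
      by blast
    from bchoice[OF this] obtain Q where Q: "\<And>\<gamma>. \<gamma> \<in> Poly_Mapping.keys (\<Psi> P) \<Longrightarrow> Q \<gamma> \<in> ?J"
      "\<And>\<gamma>. \<gamma> \<in> Poly_Mapping.keys (\<Psi> P) \<Longrightarrow> \<Psi> (Q \<gamma>) = Poly_Mapping.single \<gamma> (Poly_Mapping.lookup (\<Psi> P) \<gamma>)"
      by auto
    have "\<Psi> (\<Sum>\<gamma>\<in>Poly_Mapping.keys (\<Psi> P). Q \<gamma>) = \<Psi> P"
      by (simp add: \<Psi>.hom_sum Q(2) flip: poly_mapping_expand)
    then have "(\<Sum>\<gamma>\<in>Poly_Mapping.keys (\<Psi> P). Q \<gamma>) = P" by (rule \<Psi>_inj)
    moreover have "(\<Sum>\<gamma>\<in>Poly_Mapping.keys (\<Psi> P). Q \<gamma>) \<in> ?J" using Q(1) by (rule J.J_sum)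
    ultimately show "P \<in> ?J" by simp
  qed
qed

lemma low_image: "(\<lambda>P. low (\<Psi> P)) ` rees_carrier I = malg FA"
proof -
  have "(\<lambda>P. low (\<Psi> P)) ` rees_carrier I = low ` malg SA"
    using \<Psi>_image by (metis image_image)
  also have "\<dots> = malg FA"
  proof
    show "low ` malg SA \<subseteq> (malg FA :: (int4 \<Rightarrow>\<^sub>0 'k) set)"
      by (auto simp: malg_def FA_def keys_low)
    show "malg FA \<subseteq> low ` (malg SA :: (int4 \<Rightarrow>\<^sub>0 'k) set)"
    proof
      fix p :: "int4 \<Rightarrow>\<^sub>0 'k" assume "p \<in> malg FA"
      then have "p \<in> malg SA" "low p = p" by (auto simp: malg_def FA_def intro!: low_id)
      then show "p \<in> low ` malg SA" by (metis image_eqI)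
    qed
  qed
  finally show ?thesis .
qed

lemma iso_fiber: "\<exists>F. iso_rings (special_fiber I) (ring_on (malg FA :: (int4 \<Rightarrow>\<^sub>0 'k) set)) F"
proof -
  interpret RR: subr "rees_carrier I" by (rule subr_rees_carrier)
  interpret FF: kalg "malg FA :: (int4 \<Rightarrow>\<^sub>0 'k) set" kconst by (rule submonoid.kalg_malg[OF submonoid_FA])
  let ?R = "ring_on (rees_carrier I)"
  let ?S = "ring_on (malg FA :: (int4 \<Rightarrow>\<^sub>0 'k) set)"
  let ?h = "\<lambda>P. low (\<Psi> P)"
  have mem: "\<Psi> P \<in> malg SA" if "P \<in> rees_carrier I" for P using \<Psi>_image that by auto
  have "?h \<in> Ring.ring_hom ?R ?S"
  proof (rule ring_hom_memI)
    show "?h P \<in> carrier ?S" if "P \<in> carrier ?R" for P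
      using that unfolding ring_on_simps low_image[symmetric] by (rule imageI)
    show "?h (P \<otimes>\<^bsub>?R\<^esub> Q) = ?h P \<otimes>\<^bsub>?S\<^esub> ?h Q" if "P \<in> carrier ?R" "Q \<in> carrier ?R" for P Q
      using that by (simp add: \<Psi>.hom_mult low_mult mem)
    show "?h (P \<oplus>\<^bsub>?R\<^esub> Q) = ?h P \<oplus>\<^bsub>?S\<^esub> ?h Q" if "P \<in> carrier ?R" "Q \<in> carrier ?R" for P Q
      by (simp add: \<Psi>.hom_add low_add)
    have "low 1 = (1 :: int4 \<Rightarrow>\<^sub>0 'k)" by (rule low_id) simp
    then show "?h \<one>\<^bsub>?R\<^esub> = \<one>\<^bsub>?S\<^esub>" by simp
  qed
  then have hom: "ring_hom_ring ?R ?S ?h"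
    by (rule ring_hom_ringI2[OF RR.ring_ring_on FF.ring_ring_on])
  have ker: "a_kernel ?R ?S ?h = Idl\<^bsub>?R\<^esub> {[:Var vx:], [:Var vy:], [:Var vz:]}"
    unfolding RR.Idl_ring_on special_fiber_kernel[symmetric] a_kernel_def' ring_on_simps ..
  have "(\<lambda>Y. the_elem (?h ` Y)) \<in> ring_iso (?R Quot (a_kernel ?R ?S ?h)) ?S"
    using ring_hom_ring.FactRing_iso_set[OF hom] unfolding ring_on_simps low_image by simp
  moreover have "cring (?R Quot (a_kernel ?R ?S ?h))"
    by (rule ideal.quotient_is_cring[OF ring_hom_ring.kernel_is_ideal[OF hom] RR.cring_ring_on])
  ultimately show ?thesis
    unfolding special_fiber_def rees_algebra_ring_on ker[symmetric]
    using FF.cring_ring_on by (auto simp: iso_rings_def)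
qed

end

lemma (in iso_rings) Cohen_Macaulay_iso_rev: "Cohen_Macaulay S \<Longrightarrow> Cohen_Macaulay R"
  using iso_rings.Cohen_Macaulay_iso[OF iso_rings_sym] .

theorem rees_setup_Cohen_Macaulay:
  fixes I :: "(xyz, 'k::alg_closed_field) mpoly set"
  assumes "rees_setup a b I l g"
  shows "Cohen_Macaulay (rees_algebra I)" "Cohen_Macaulay (special_fiber I)"
proof -
  interpret rees_setup a b I l g by fact
  show "Cohen_Macaulay (rees_algebra I)"
    using iso_rings.Cohen_Macaulay_iso_rev[OF iso_rees Cohen_Macaulay_rees] .
  show "Cohen_Macaulay (special_fiber I)"
    using iso_fiber iso_rings.Cohen_Macaulay_iso_rev[OF _ Cohen_Macaulay_fiber] by blast
qed

section \<open>Straightening modulo the syzygies and the fiber relations\<close>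

context ideal_in begin

definition cong :: "'r \<Rightarrow> 'r \<Rightarrow> bool" (infix \<open>\<approx>\<close> 50) where "p \<approx> q \<longleftrightarrow> p - q \<in> J"

lemma cong_refl [simp]: "p \<approx> p"
  by (simp add: cong_def)

lemma cong_sym: "p \<approx> q \<Longrightarrow> q \<approx> p"
  unfolding cong_def using J_uminus[of "p - q"] by simp

lemma cong_trans [trans]: "p \<approx> q \<Longrightarrow> q \<approx> r \<Longrightarrow> p \<approx> r"
  unfolding cong_def using J_add[of "p - q" "q - r"] by simp

lemma cong_add: "p \<approx> q \<Longrightarrow> p' \<approx> q' \<Longrightarrow> p + p' \<approx> q + q'"
  unfolding cong_def using J_add[of "p - q" "p' - q'"] by (simp add: algebra_simps)

lemma cong_sum: "(\<And>i. i \<in> Y \<Longrightarrow> f i \<approx> f' i) \<Longrightarrow> sum f Y \<approx> sum f' Y"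
  by (induction Y rule: infinite_finite_induct) (auto intro: cong_add)

lemma cong_mult: "p \<approx> q \<Longrightarrow> c \<in> A \<Longrightarrow> c * p \<approx> c * q"
  unfolding cong_def using J_mult[of c "p - q"] by (simp add: algebra_simps)

text \<open>The standard monomials \<open>x\<^sup>e\<close> and \<open>t\<^sub>i t\<^sub>m\<^sup>g\<close>, \<open>1 \<le> i \<le> m\<close>, of one block, indexed by the integers.\<close>

definition blk :: "'r \<Rightarrow> (nat \<Rightarrow> 'r) \<Rightarrow> nat \<Rightarrow> int \<Rightarrow> 'r" where
  "blk x t m e = (if e \<ge> 0 then x ^ nat e else t m ^ ((nat (- e) - 1) div m) * t ((nat (- e) - 1) mod m + 1))"

lemma blk_nonneg: "blk x t m (int e) = x ^ e"
  by (simp add: blk_def)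

lemma blk_neg:
  assumes "1 \<le> i" "i \<le> m" shows "blk x t m (- int (n * m + i)) = t m ^ n * t i"
proof -
  obtain i' where i: "i = Suc i'" using assms(1) by (cases i) auto
  have "nat (- (- int (n * m + i))) - 1 = n * m + i'" unfolding i by (simp only: minus_minus nat_int)
  moreover have "(n * m + i') div m = n" "(n * m + i') mod m = i'" using assms by (simp_all add: i)
  moreover have "\<not> 0 \<le> - int (n * m + i)"
  proof -
    have "0 < int (n * m + i)" using assms by (simp only: of_nat_0_less_iff)
    then show ?thesis by linarith
  qed
  ultimately show ?thesis unfolding blk_def by (simp only: if_False i Suc_eq_plus1)
qed

lemma blk_cases:
  fixes e :: int
  assumes "m \<ge> 1"
  obtains (nonneg) e' where "e = int e'" | (neg) n i where "1 \<le> i" "i \<le> m" "e = - int (n * m + i)"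
proof (cases "e \<ge> 0")
  case True
  then show ?thesis using nonneg[of "nat e"] by simp
next
  case False
  define k where "k = nat (- e) - 1"
  have "e = - int (k div m * m + (k mod m + 1))" using False by (simp add: k_def)
  moreover have "k mod m + 1 \<le> m" using assms mod_less_divisor[of m k] by linarith
  ultimately show ?thesis using neg[of "k mod m + 1" "k div m"] by simp
qed

text \<open>A linear relation trades x times \<open>t i\<close> for z times
  \<open>t (i - 1)\<close>, until the power of x is used up or the index has reached 0. A quadratic
  relation moves two factors apart until one of them is \<open>t 0\<close> or \<open>t m\<close>;
  the former is collected in front, the latter in the power.\<close>

lemma block_straighten:
  fixes m :: nat and e :: int
  assumes m: "m \<ge> 1" and x: "x \<in> A" and z: "z \<in> A" and t: "\<And>i. i \<le> m \<Longrightarrow> t i \<in> A"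
    and lin: "\<And>i. i < m \<Longrightarrow> z * t i \<approx> x * t (Suc i)"
    and quad: "\<And>i j k l. i + j = k + l \<Longrightarrow> i \<le> m \<Longrightarrow> j \<le> m \<Longrightarrow> k \<le> m \<Longrightarrow> l \<le> m \<Longrightarrow> t i * t j \<approx> t k * t l"
    and c: "c = x \<or> (\<exists>i\<le>m. c = t i)"
  shows "\<exists>\<alpha> \<beta> e'. c * blk x t m e \<approx> z ^ \<alpha> * t 0 ^ \<beta> * blk x t m e'"
  using m
proof (cases rule: blk_cases[of m e])
  case (nonneg n)
  have x_case: "\<exists>\<alpha> \<beta> e'. x * x ^ n \<approx> z ^ \<alpha> * t 0 ^ \<beta> * blk x t m e'" for n
    by (rule exI[of _ 0], rule exI[of _ 0], rule exI[of _ "int (Suc n)"]) (simp add: blk_nonneg[of _ _ _ "Suc n", simplified])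
  have t_case: "\<exists>\<alpha> \<beta> e'. t i * x ^ n \<approx> z ^ \<alpha> * t 0 ^ \<beta> * blk x t m e'" if "i \<le> m" for i n
    using that
  proof (induction n arbitrary: i)
    case 0
    show ?case
    proof (cases "i = 0")
      case True
      have "t i * x ^ 0 = z ^ 0 * t 0 ^ 1 * blk x t m (int 0)" unfolding blk_nonneg using True by simp
      then show ?thesis by (metis cong_refl)
    next
      case False
      then have "t i * x ^ 0 = z ^ 0 * t 0 ^ 0 * blk x t m (- int (0 * m + i))"
        using 0 by (subst blk_neg) auto
      then show ?thesis by (metis cong_refl)
    qed
  next
    case (Suc n)
    show ?case
    proof (cases "i = 0")
      case True
      have "t i * x ^ Suc n = z ^ 0 * t 0 ^ 1 * blk x t m (int (Suc n))" unfolding blk_nonneg using True by simp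
      then show ?thesis by (metis cong_refl)
    next
      case False
      have "x ^ n * (x * t (Suc (i - 1))) \<approx> x ^ n * (z * t (i - 1))"
        using lin[of "i - 1"] Suc.prems False x by (intro cong_mult cong_sym[OF lin]) auto
      then have 1: "t i * x ^ Suc n \<approx> z * (t (i - 1) * x ^ n)" using False by (simp add: algebra_simps)
      obtain \<alpha> \<beta> e' where "t (i - 1) * x ^ n \<approx> z ^ \<alpha> * t 0 ^ \<beta> * blk x t m e'"
        using Suc.IH[OF le_trans[OF diff_le_self Suc.prems], of 1] by blast
      then have "z * (t (i - 1) * x ^ n) \<approx> z * (z ^ \<alpha> * t 0 ^ \<beta> * blk x t m e')" using z by (rule cong_mult)
      then have "t i * x ^ Suc n \<approx> z ^ Suc \<alpha> * t 0 ^ \<beta> * blk x t m e'"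
        using cong_trans[OF 1] by (simp add: mult.assoc)
      then show ?thesis by blast
    qed
  qed
  from c show ?thesis unfolding nonneg blk_nonneg
  proof (elim disjE exE conjE)
    fix j assume "j \<le> m" "c = t j"
    then show "\<exists>\<alpha> \<beta> e'. c * x ^ n \<approx> z ^ \<alpha> * t 0 ^ \<beta> * blk x t m e'" using t_case by blast
  qed (use x_case in blast)
next
  case (neg n i)
  have tm: "t m ^ k \<in> A" for k using t[of m] by auto
  have blk: "blk x t m e = t m ^ n * t i" unfolding neg(3) by (rule blk_neg[OF neg(1,2)])
  have x_case: "\<exists>\<alpha> \<beta> e'. x * (t m ^ n * t i) \<approx> z ^ \<alpha> * t 0 ^ \<beta> * blk x t m e'"
  proof -
    have "t m ^ n * (x * t (Suc (i - 1))) \<approx> t m ^ n * (z * t (i - 1))"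
      using neg tm by (intro cong_mult cong_sym[OF lin]) auto
    then have 1: "x * (t m ^ n * t i) \<approx> z * (t m ^ n * t (i - 1))" using neg by (simp add: algebra_simps)
    have "\<exists>\<alpha> \<beta> e'. z * (t m ^ n * t (i - 1)) = z ^ \<alpha> * t 0 ^ \<beta> * blk x t m e'"
    proof (cases "i = 1")
      case False
      have "z * (t m ^ n * t (i - 1)) = z ^ 1 * t 0 ^ 0 * blk x t m (- int (n * m + (i - 1)))"
        using neg False by (subst blk_neg) auto
      then show ?thesis by blast
    next
      case i1: True
      show ?thesis
      proof (cases n)
        case 0
        have "z * (t m ^ n * t (i - 1)) = z ^ 1 * t 0 ^ 1 * blk x t m (int 0)"
          unfolding blk_nonneg using i1 0 by simp
        then show ?thesis by blast
      next
        case (Suc n')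
        \<comment> \<open>Once \<open>t 0\<close> is taken out, one factor of the power
          \<open>t m ^ n\<close> takes over the role of the single factor, with
          \<open>i = m\<close>.\<close>
        have "z * (t m ^ n * t (i - 1)) = z ^ 1 * t 0 ^ 1 * blk x t m (- int (n' * m + m))"
          using m by (subst blk_neg) (auto simp: i1 Suc algebra_simps)
        then show ?thesis by blast
      qed
    qed
    then obtain \<alpha> \<beta> e' where 2: "z * (t m ^ n * t (i - 1)) = z ^ \<alpha> * t 0 ^ \<beta> * blk x t m e'" by blast
    from 1 show ?thesis unfolding 2 by blast
  qed
  have t_case: "\<exists>\<alpha> \<beta> e'. t j * (t m ^ n * t i) \<approx> z ^ \<alpha> * t 0 ^ \<beta> * blk x t m e'" if j: "j \<le> m" for j
  proof (cases "i + j \<le> m")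
    case True
    have "t m ^ n * (t j * t i) \<approx> t m ^ n * (t 0 * t (i + j))"
      using True j neg tm by (intro cong_mult quad) auto
    moreover have "t m ^ n * (t 0 * t (i + j)) = z ^ 0 * t 0 ^ 1 * blk x t m (- int (n * m + (i + j)))"
      using True neg by (subst blk_neg) (auto simp: algebra_simps)
    ultimately show ?thesis by (metis mult.left_commute)
  next
    case False
    have "t m ^ n * (t j * t i) \<approx> t m ^ n * (t m * t (i + j - m))"
      using False j neg tm by (intro cong_mult quad) auto
    moreover have "t m ^ n * (t m * t (i + j - m)) = z ^ 0 * t 0 ^ 0 * blk x t m (- int (Suc n * m + (i + j - m)))"
      using False j neg by (subst blk_neg) (auto simp: algebra_simps)
    ultimately show ?thesis by (metis mult.left_commute)
  qed
  from c show ?thesis unfolding blk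
  proof (elim disjE exE conjE)
    fix j assume "j \<le> m" "c = t j"
    then show "\<exists>\<alpha> \<beta> e'. c * (t m ^ n * t i) \<approx> z ^ \<alpha> * t 0 ^ \<beta> * blk x t m e'" using t_case by blast
  qed (use x_case in blast)
qed

end

section \<open>The defining ideal for an arbitrary choice of minimal generators\<close>

context rees_setup begin

lemma deg_gens_I: "deg_gens I (a + b)"
  unfolding deg_gens_def using g_hom I_gen by (intro exI[of _ "{..a + b}"] exI[of _ g]) auto

end

locale presentation = rees_setup a b I l g for a b :: nat and I :: "(xyz, 'k::field) mpoly set" and l g +
  fixes f :: "(xyz, 'k) mpoly vec" and \<phi> :: "(xyz, 'k) mpoly mat"
  assumes min: "minimal_generators I f" and syz: "syzygy_matrix f \<phi>"
begin

definition N :: nat where "N = dim_vec f"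

definition Car :: "(nat, (xyz, 'k) mpoly) mpoly set" where
  "Car = {p. \<forall>m\<in>Poly_Mapping.keys p. Poly_Mapping.keys m \<subseteq> {..<N}}"

lemma mpoly_ring_Car: "mpoly_ring N = ring_on Car"
  by (simp add: mpoly_ring_def ring_on_def Car_def)

sublocale Car: subr Car
proof unfold_locales
  fix p q assume pq: "p \<in> Car" "q \<in> Car"
  show "p + q \<in> Car" using pq keys_add[of p q] by (auto simp: Car_def)
  show "p * q \<in> Car"
    unfolding Car_def
  proof (intro CollectI ballI)
    fix m assume "m \<in> Poly_Mapping.keys (p * q)"
    then obtain m1 m2 where "m = m1 + m2" "m1 \<in> Poly_Mapping.keys p" "m2 \<in> Poly_Mapping.keys q"
      using keys_mult by blast
    moreover from this have "Poly_Mapping.keys m1 \<subseteq> {..<N}" "Poly_Mapping.keys m2 \<subseteq> {..<N}"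
      using pq by (auto simp: Car_def)
    ultimately show "Poly_Mapping.keys m \<subseteq> {..<N}" using keys_add[of m1 m2] by blast
  qed
next
  fix p assume "p \<in> Car"
  then show "- p \<in> Car" by (auto simp: Car_def in_keys_iff)
qed (auto simp: Car_def)

lemma Const_Car [simp]: "Const r \<in> Car"
  by (auto simp: Car_def Const_def)

lemma Var_Car [simp]: "j < N \<Longrightarrow> Var j \<in> Car"
  by (auto simp: Car_def Var_def)

lemma comm_ring_hom_pCons: "comm_ring_hom (\<lambda>r :: (xyz, 'k) mpoly. [:r:])"
  by unfold_locales auto

definition E :: "(nat, (xyz, 'k) mpoly) mpoly \<Rightarrow> (xyz, 'k) mpoly poly" where
  "E = mpoly_eval (\<lambda>r. [:r:]) (\<lambda>i. monom (f $ i) 1)"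

definition \<Theta> :: "(nat, (xyz, 'k) mpoly) mpoly \<Rightarrow> int4 \<Rightarrow>\<^sub>0 'k" where
  "\<Theta> p = \<Psi> (E p)"

sublocale E: comm_ring_hom E
  unfolding E_def by (rule comm_ring_hom.comm_ring_hom_mpoly_eval[OF comm_ring_hom_pCons])

lemma E_Const [simp]: "E (Const r) = [:r:]" and E_Var [simp]: "E (Var j) = monom (f $ j) 1"
  unfolding E_def by (simp_all add: comm_ring_hom.mpoly_eval_Const[OF comm_ring_hom_pCons]
      comm_ring_hom.mpoly_eval_Var[OF comm_ring_hom_pCons])

sublocale \<Theta>: comm_ring_hom \<Theta>
  using comm_ring_hom_comp[OF comm_ring_hom_\<Psi> E.comm_ring_hom_axioms] by (simp add: \<Theta>_def[abs_def])

lemma rees_ideal_eq: "rees_ideal f = {p \<in> Car. E p = 0}"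
  by (simp add: rees_ideal_def E_def mpoly_ring_Car flip: N_def)

definition rels :: "(nat, (xyz, 'k) mpoly) mpoly set" where
  "rels = {(\<Sum>i<N. Var i * Const (\<phi> $$ (i, j))) | j. j < dim_col \<phi>} \<union> Poly_Mapping.map Const ` fiber_ideal f"

abbreviation mc :: "(nat, 'k) mpoly \<Rightarrow> (nat, (xyz, 'k) mpoly) mpoly" where
  "mc \<equiv> Poly_Mapping.map Const"

lemma lookup_mc: "Poly_Mapping.lookup (mc q) m = Const (Poly_Mapping.lookup q m)"
  by (simp add: map.rep_eq when_def)

lemma Const_eq_0 [simp]: "Const c = (0 :: (xyz, 'k) mpoly) \<longleftrightarrow> c = 0"
proof
  assume "Const c = (0 :: (xyz, 'k) mpoly)"
  then have "Poly_Mapping.lookup (Const c :: (xyz, 'k) mpoly) 0 = 0" by simp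
  then show "c = 0" by (simp add: Const_def)
qed simp

lemma keys_mc: "Poly_Mapping.keys (mc q) = Poly_Mapping.keys q"
  by (auto simp: in_keys_iff lookup_mc)

lemma mc_add: "mc (p + q) = mc p + mc q"
  by (rule poly_mapping_eqI) (simp add: lookup_mc lookup_add Const_add)

lemma mc_single: "mc (Poly_Mapping.single m c) = Poly_Mapping.single m (Const c)"
  by (rule poly_mapping_eqI) (simp add: lookup_mc lookup_single when_def)

sublocale mc: comm_ring_hom mc
proof unfold_locales
  show zero: "mc 0 = 0" by (rule poly_mapping_eqI) (simp add: lookup_mc)
  show "mc (p * q) = mc p * mc q" for p q
    by (rule additive_mult[OF zero mc_add]) (simp add: mc_single mult_single Const_mult)
  show "mc 1 = 1" using mc_single[of 0 1] by simp
qed (rule mc_add)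

lemma mc_Var: "mc (Var i) = Var i"
  unfolding Var_def mc_single by simp

lemma mc_Const: "mc (Const c) = Const (Const c)"
proof -
  have "mc (Const c) = mc (Poly_Mapping.single 0 c)" by (simp only: Const_def)
  also have "\<dots> = Const (Const c)" unfolding mc_single by (rule Const_def[symmetric])
  finally show ?thesis .
qed

lemma phi_carrier: "\<phi> \<in> carrier_mat N (N - 1)"
  using syz by (simp add: syzygy_matrix_def N_def)

lemma f_hom: "i < N \<Longrightarrow> homogeneous (a + b) (f $ i)"
  using minimal_generators_degree[OF deg_gens_I min] by (simp add: N_def)

lemma I_f: "I = gen UNIV ((\<lambda>i. f $ i) ` {..<N})"
  using minimal_generators_gen[OF min] by (simp add: N_def)

text \<open>All generators have the same positive degree \<open>a + b\<close>. Thus the part of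
  degree \<open>d\<close> in T is the homogeneous component of degree \<open>d * (a + b)\<close> of
  the relation among the generators, and it vanishes separately.\<close>

lemma fiber_ideal_E:
  assumes q: "q \<in> fiber_ideal f" shows "E (mc q) = 0"
proof -
  have keys: "Poly_Mapping.keys m \<subseteq> {..<N}" if "m \<in> Poly_Mapping.keys q" for m
    using q that by (auto simp: fiber_ideal_def mpoly_ring_def N_def)
  have q0: "(\<Sum>m\<in>Poly_Mapping.keys q. Const (Poly_Mapping.lookup q m) * moneval (\<lambda>i. f $ i) m) = 0"
    using q by (simp add: fiber_ideal_def mpoly_eval_moneval)
  define F where "F m = Const (Poly_Mapping.lookup q m) * moneval (\<lambda>i. f $ i) m" for m
  have mon: "moneval (\<lambda>i. monom (f $ i) 1) m = monom (moneval (\<lambda>i. f $ i) m) (mdeg m)" for m :: "nat \<Rightarrow>\<^sub>0 nat"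
  proof -
    have "(\<Prod>i\<in>Y. monom (f $ i) 1 ^ k i) = monom (\<Prod>i\<in>Y. f $ i ^ k i) (\<Sum>i\<in>Y. k i)" if "finite Y" for Y and k :: "nat \<Rightarrow> nat"
      using that by (induction Y rule: finite_induct) (auto simp: monom_power mult_monom simp del: One_nat_def)
    then show ?thesis by (simp add: moneval_def mdeg_def)
  qed
  have "E (mc q) = (\<Sum>m\<in>Poly_Mapping.keys q. monom (F m) (mdeg m))"
    unfolding E_def mpoly_eval_moneval keys_mc lookup_mc mon by (simp add: F_def smult_monom)
  moreover have "coeff (\<Sum>m\<in>Poly_Mapping.keys q. monom (F m) (mdeg m)) d = 0" for d
  proof -
    have hom: "homogeneous (mdeg m * (a + b)) (F m)" if "m \<in> Poly_Mapping.keys q" for m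
      unfolding F_def using keys[OF that] by (intro homogeneous_Const_mult homogeneous_moneval f_hom) auto
    have "0 = hcomp (d * (a + b)) (\<Sum>m\<in>Poly_Mapping.keys q. F m)" using q0 by (simp add: F_def)
    also have "\<dots> = (\<Sum>m\<in>Poly_Mapping.keys q. hcomp (d * (a + b)) (F m))" by (rule hcomp_sum)
    also have "\<dots> = (\<Sum>m\<in>Poly_Mapping.keys q. if mdeg m = d then F m else 0)"
    proof (rule sum.cong)
      fix m assume "m \<in> Poly_Mapping.keys q"
      then show "hcomp (d * (a + b)) (F m) = (if mdeg m = d then F m else 0)"
        using hcomp_homogeneous[OF hom, of m "d * (a + b)"] a_pos by (auto simp: when_def)
    qed simp
    finally show ?thesis by (simp add: coeff_sum)
  qed
  ultimately show ?thesis by (simp add: poly_eq_iff)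
qed

lemma syz_zero: "j < dim_col \<phi> \<Longrightarrow> (\<Sum>i<N. \<phi> $$ (i, j) * f $ i) = 0"
proof -
  assume j: "j < dim_col \<phi>"
  have "\<phi> *\<^sub>v unit_vec (dim_col \<phi>) j \<in> {\<phi> *\<^sub>v w | w. w \<in> carrier_vec (dim_col \<phi>)}" by auto
  then have "f \<bullet> (\<phi> *\<^sub>v unit_vec (dim_col \<phi>) j) = 0" using syz unfolding syzygy_matrix_def by auto
  moreover have "\<phi> *\<^sub>v unit_vec (dim_col \<phi>) j = col \<phi> j"
    using j by (intro eq_vecI) (auto simp: scalar_prod_right_unit)
  ultimately have "f \<bullet> col \<phi> j = 0" by simp
  then show ?thesis using phi_carrier j by (simp add: scalar_prod_def atLeast0LessThan mult.commute)
qed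

lemma rels_Car: "rels \<subseteq> Car"
proof -
  have "mc q \<in> Car" if "q \<in> fiber_ideal f" for q
    using that by (auto simp: fiber_ideal_def mpoly_ring_def Car_def keys_mc N_def)
  then show ?thesis by (auto simp: rels_def intro!: Car.sum_mem Car.mult_mem)
qed

definition L :: "(nat, (xyz, 'k) mpoly) mpoly set" where "L = gen Car rels"

sublocale L: ideal_in Car L
  unfolding L_def by (rule Car.gen_ideal[OF rels_Car])

lemma kernel_ideal: "ideal_in Car {p \<in> Car. E p = 0}"
  by unfold_locales (auto simp: E.hom_add E.hom_mult)

lemma L_subset: "L \<subseteq> {p \<in> Car. E p = 0}"
  unfolding L_def
proof (rule Car.gen_least[OF kernel_ideal])
  have "E (\<Sum>i<N. Var i * Const (\<phi> $$ (i, j))) = 0" if "j < dim_col \<phi>" for j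
  proof -
    have "E (\<Sum>i<N. Var i * Const (\<phi> $$ (i, j))) = (\<Sum>i<N. monom (\<phi> $$ (i, j) * f $ i) 1)"
      by (simp add: E.hom_sum E.hom_mult smult_monom mult.commute)
    also have "\<dots> = monom (\<Sum>i<N. \<phi> $$ (i, j) * f $ i) 1" by (simp add: monom_sum)
    finally show ?thesis using syz_zero[OF that] by simp
  qed
  then show "rels \<subseteq> {p \<in> Car. E p = 0}" using rels_Car fiber_ideal_E by (auto simp: rels_def)
qed

text \<open>The coefficient vector \<open>W\<close> is a syzygy of \<open>f\<close>, hence a
  combination of the columns of \<open>\<phi>\<close>.\<close>

lemma linear_in_L:
  assumes W: "(\<Sum>i<N. W i * f $ i) = 0" shows "(\<Sum>i<N. Var i * Const (W i)) \<in> L"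
proof -
  have "f \<bullet> vec N W = (\<Sum>i<N. W i * f $ i)"
    by (simp add: scalar_prod_def atLeast0LessThan mult.commute)
  then have "vec N W \<in> {v \<in> carrier_vec (dim_vec f). f \<bullet> v = 0}" using W by (simp add: N_def)
  then obtain w where w: "w \<in> carrier_vec (dim_col \<phi>)" "vec N W = \<phi> *\<^sub>v w"
    using syz unfolding syzygy_matrix_def by blast
  interpret K: comm_ring_hom "Const :: (xyz, 'k) mpoly \<Rightarrow> (nat, (xyz, 'k) mpoly) mpoly" by (rule comm_ring_hom_Const)
  have Wi: "W i = (\<Sum>j<dim_col \<phi>. w $ j * \<phi> $$ (i, j))" if "i < N" for i
  proof -
    have "W i = (\<phi> *\<^sub>v w) $ i" using that by (simp flip: w(2))
    then show ?thesis using that w(1) phi_carrier by (simp add: scalar_prod_def atLeast0LessThan mult.commute)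
  qed
  have "(\<Sum>i<N. Var i * Const (W i)) = (\<Sum>i<N. \<Sum>j<dim_col \<phi>. Const (w $ j) * (Var i * Const (\<phi> $$ (i, j))))"
  proof (rule sum.cong)
    fix i assume "i \<in> {..<N}"
    then show "Var i * Const (W i) = (\<Sum>j<dim_col \<phi>. Const (w $ j) * (Var i * Const (\<phi> $$ (i, j))))"
      using Wi[of i] by (simp add: K.hom_sum sum_distrib_left Const_mult algebra_simps)
  qed simp
  also have "\<dots> = (\<Sum>j<dim_col \<phi>. Const (w $ j) * (\<Sum>i<N. Var i * Const (\<phi> $$ (i, j))))"
    by (subst sum.swap) (simp add: sum_distrib_left)
  also have "\<dots> \<in> L"
  proof (rule L.J_sum)
    fix j assume "j \<in> {..<dim_col \<phi>}"
    then have "(\<Sum>i<N. Var i * Const (\<phi> $$ (i, j))) \<in> rels" by (auto simp: rels_def)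
    then have "(\<Sum>i<N. Var i * Const (\<phi> $$ (i, j))) \<in> L" unfolding L_def using Car.gen_incl by blast
    then show "Const (w $ j) * (\<Sum>i<N. Var i * Const (\<phi> $$ (i, j))) \<in> L" by (rule L.J_mult[OF Const_Car])
  qed
  finally show ?thesis .
qed

text \<open>Both families consist of forms of degree \<open>a + b\<close>, so the coefficients are
  constants. This matters: the forms \<open>ti i\<close> then come from polynomials over the ground
  field, and relations among them can be taken from the fiber ideal.\<close>

lemma ex_V: "\<exists>V. \<forall>i\<le>a + b. g i = (\<Sum>j<N. Const (V i j) * f $ j)"
proof -
  have "\<forall>i. \<exists>V. i \<le> a + b \<longrightarrow> g i = (\<Sum>j<N. Const (V j) * f $ j)"
    using homogeneous_span[of "{..<N}" "a + b" "\<lambda>j. f $ j"] f_hom g_in_I g_hom unfolding I_f by auto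
  from choice[OF this] show ?thesis by blast
qed

definition V :: "nat \<Rightarrow> nat \<Rightarrow> 'k" where
  "V = (SOME V. \<forall>i\<le>a + b. g i = (\<Sum>j<N. Const (V i j) * f $ j))"

lemma V: "i \<le> a + b \<Longrightarrow> (\<Sum>j<N. Const (V i j) * f $ j) = g i"
  using someI_ex[OF ex_V] unfolding V_def[symmetric] by simp

definition tk :: "nat \<Rightarrow> (nat, 'k) mpoly" where "tk i = (\<Sum>j<N. Var j * Const (V i j))"
definition ti :: "nat \<Rightarrow> (nat, (xyz, 'k) mpoly) mpoly" where "ti i = mc (tk i)"
definition xv :: "xyz \<Rightarrow> (nat, (xyz, 'k) mpoly) mpoly" where "xv w = Const (\<tau> (Var w))"

lemma ti_eq: "ti i = (\<Sum>j<N. Var j * Const (Const (V i j)))"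
  by (simp add: ti_def tk_def mc.hom_sum mc.hom_mult mc_Var mc_Const)

lemma ti_Car [simp]: "ti i \<in> Car"
  unfolding ti_eq by (intro Car.sum_mem Car.mult_mem) auto

lemma xv_Car [simp]: "xv w \<in> Car"
  by (simp add: xv_def)

lemma E_ti: "i \<le> a + b \<Longrightarrow> E (ti i) = monom (g i) 1"
proof -
  assume i: "i \<le> a + b"
  have "E (ti i) = (\<Sum>j<N. monom (Const (V i j) * f $ j) 1)"
    unfolding ti_eq by (simp add: E.hom_sum E.hom_mult smult_monom mult.commute)
  also have "\<dots> = monom (\<Sum>j<N. Const (V i j) * f $ j) 1" by (simp add: monom_sum)
  finally show ?thesis by (simp add: V[OF i])
qed

lemma \<Theta>_ti: "i \<le> a + b \<Longrightarrow> \<Theta> (ti i) = mono_at (pt i)"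
  unfolding \<Theta>_def E_ti by (rule \<Psi>_g)

lemma \<Theta>_xv: "\<Theta> (xv w) = mono_at (xyz_pt w)"
  unfolding \<Theta>_def xv_def E_Const by (rule \<Psi>_xyz)

definition kk :: "'k \<Rightarrow> (nat, (xyz, 'k) mpoly) mpoly" where "kk c = Const (Const c)"

lemma \<Theta>_kk: "\<Theta> (kk c) = kconst c"
  unfolding \<Theta>_def kk_def E_Const by (rule \<Psi>_Const)

lemma kk_Car [simp]: "kk c \<in> Car"
  by (simp add: kk_def)

lemma rel_linear:
  assumes j: "j < a + b" shows "L.cong (xv vz * ti j) (xv (cvar j) * ti (Suc j))"
proof -
  define W where "W i = \<tau> (Var vz) * Const (V j i) - \<tau> (Var (cvar j)) * Const (V (Suc j) i)" for i
  have "(\<Sum>i<N. W i * f $ i) = \<tau> (Var vz) * (\<Sum>i<N. Const (V j i) * f $ i) - \<tau> (Var (cvar j)) * (\<Sum>i<N. Const (V (Suc j) i) * f $ i)"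
    by (simp add: W_def sum_distrib_left sum_subtractf algebra_simps)
  also have "\<dots> = \<tau> (Var vz) * g j - \<tau> (Var (cvar j)) * g (Suc j)" using j by (simp add: V)
  also have "\<dots> = 0"
  proof (rule \<sigma>_inj)
    have "\<sigma> (g j) = f0 j" "\<sigma> (g (Suc j)) = f0 (Suc j)" using j g_f0 by (simp_all add: \<sigma>_def)
    then show "\<sigma> (\<tau> (Var vz) * g j - \<tau> (Var (cvar j)) * g (Suc j)) = \<sigma> 0"
      using f0_linear[OF j, where 'k = 'k] by (simp add: \<sigma>.hom_minus \<sigma>.hom_mult)
  qed
  finally have "(\<Sum>i<N. Var i * Const (W i)) \<in> L" by (rule linear_in_L)
  moreover have "xv vz * ti j - xv (cvar j) * ti (Suc j) = (\<Sum>i<N. Var i * Const (W i))"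
  proof -
    interpret K: comm_ring_hom "Const :: (xyz, 'k) mpoly \<Rightarrow> (nat, (xyz, 'k) mpoly) mpoly" by (rule comm_ring_hom_Const)
    show ?thesis
      unfolding xv_def ti_eq W_def by (simp add: sum_distrib_left sum_subtractf K.hom_minus Const_mult algebra_simps)
  qed
  ultimately show ?thesis by (simp add: L.cong_def)
qed

text \<open>The difference comes from a polynomial over the ground field that vanishes at
  \<open>f\<close>, hence from the fiber ideal.\<close>

lemma rel_quadratic:
  assumes "i + j = k + n" "{i, j, k, n} \<subseteq> {..a} \<or> {i, j, k, n} \<subseteq> {a..a + b}"
  shows "L.cong (ti i * ti j) (ti k * ti n)"
proof -
  have le: "i \<le> a + b" "j \<le> a + b" "k \<le> a + b" "n \<le> a + b" using assms(2) by auto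
  interpret K: comm_ring_hom "mpoly_eval Const (\<lambda>i. f $ i) :: (nat, 'k) mpoly \<Rightarrow> (xyz, 'k) mpoly"
    by (rule comm_ring_hom.comm_ring_hom_mpoly_eval[OF comm_ring_hom_Const])
  have ev_tk: "mpoly_eval Const (\<lambda>i. f $ i) (tk i) = g i" if "i \<le> a + b" for i
    using V[OF that] by (simp add: tk_def K.hom_sum K.hom_mult mult.commute
        comm_ring_hom.mpoly_eval_Const[OF comm_ring_hom_Const] comm_ring_hom.mpoly_eval_Var[OF comm_ring_hom_Const])
  have "g i * g j = g k * g n"
    by (rule \<sigma>_inj) (use g_f0 le f0_product[OF assms, where 'k = 'k] in \<open>simp add: \<sigma>.hom_mult flip: \<sigma>_def\<close>)
  then have zero: "mpoly_eval Const (\<lambda>i. f $ i) (tk i * tk j - tk k * tk n) = 0"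
    by (simp add: K.hom_minus K.hom_mult ev_tk le)
  have "ti i * ti j - ti k * ti n = mc (tk i * tk j - tk k * tk n)"
    by (simp add: ti_def mc.hom_minus mc.hom_mult)
  moreover from this have "mc (tk i * tk j - tk k * tk n) \<in> Car"
    by (metis Car.diff_mem Car.mult_mem ti_Car)
  then have "tk i * tk j - tk k * tk n \<in> fiber_ideal f"
    using zero by (simp add: fiber_ideal_def mpoly_ring_def Car_def keys_mc flip: N_def)
  then have "mc (tk i * tk j - tk k * tk n) \<in> L"
    unfolding L_def using Car.gen_incl[of rels] by (auto simp: rels_def)
  ultimately show ?thesis by (simp add: L.cong_def)
qed

text \<open>The generator \<open>f $ j\<close> is a combination of the \<open>g i\<close> over R.
  Rewriting the \<open>g i\<close> in terms of \<open>f\<close> turns this into a syzygy, that is,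
  an element of \<open>L\<close>.\<close>

lemma Var_span:
  assumes j: "j < N" shows "\<exists>c. L.cong (Var j) (\<Sum>i\<le>a + b. Const (c i) * ti i)"
proof -
  have "f $ j \<in> I" unfolding I_f by (rule subsetD[OF subr.gen_incl[OF subr_UNIV]]) (use j in simp)
  then obtain c where c: "f $ j = (\<Sum>i\<le>a + b. c i * g i)"
    using gen_type_indexed[of "{..a + b}" g] unfolding I_gen by auto
  define W where "W n = (if n = j then 1 else 0) - (\<Sum>i\<le>a + b. c i * Const (V i n))" for n
  have "(\<Sum>n<N. W n * f $ n) = (\<Sum>n<N. if n = j then f $ n else 0) - (\<Sum>n<N. \<Sum>i\<le>a + b. c i * (Const (V i n) * f $ n))"
    by (simp add: W_def left_diff_distrib sum_subtractf sum_distrib_right mult.assoc if_distrib[of "\<lambda>x. x * _"] cong: if_cong)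
  also have "(\<Sum>n<N. \<Sum>i\<le>a + b. c i * (Const (V i n) * f $ n)) = (\<Sum>i\<le>a + b. c i * (\<Sum>n<N. Const (V i n) * f $ n))"
    by (subst sum.swap) (simp add: sum_distrib_left)
  also have "\<dots> = f $ j" using c V by simp
  finally have "(\<Sum>n<N. W n * f $ n) = 0" using j by simp
  then have "(\<Sum>n<N. Var n * Const (W n)) \<in> L" by (rule linear_in_L)
  moreover have "(\<Sum>n<N. Var n * Const (W n)) = Var j - (\<Sum>i\<le>a + b. Const (c i) * ti i)"
  proof -
    interpret K: comm_ring_hom "Const :: (xyz, 'k) mpoly \<Rightarrow> (nat, (xyz, 'k) mpoly) mpoly" by (rule comm_ring_hom_Const)
    have "(\<Sum>n<N. Var n * Const (W n)) = (\<Sum>n<N. (if n = j then Var n else 0) - (\<Sum>i\<le>a + b. Const (c i) * (Var n * Const (Const (V i n)))))"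
      by (rule sum.cong) (auto simp: W_def K.hom_minus K.hom_sum K.hom_mult algebra_simps sum_distrib_left)
    also have "\<dots> = Var j - (\<Sum>i\<le>a + b. Const (c i) * ti i)"
      unfolding sum_subtractf ti_eq sum_distrib_left by (subst sum.swap) (use j in simp)
    finally show ?thesis .
  qed
  ultimately show ?thesis by (intro exI[of _ c]) (simp add: L.cong_def)
qed

section \<open>Standard monomials, their exponents and their multiplication\<close>

definition st :: "nat \<times> nat \<times> int \<times> int \<Rightarrow> (nat, (xyz, 'k) mpoly) mpoly" where
  "st = (\<lambda>(\<alpha>, \<beta>, e, e'). xv vz ^ \<alpha> * ti 0 ^ \<beta> * L.blk (xv vx) ti a e * L.blk (xv vy) (\<lambda>j. ti (a + j)) b e')"

definition ex :: "nat \<times> nat \<times> int \<times> int \<Rightarrow> int4" where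
  "ex = (\<lambda>(\<alpha>, \<beta>, e, e'). (0, 0, int \<alpha>, int \<beta>) + u e + v e')"

text \<open>The second coordinate gives the index of the second block, the first coordinate then
  gives that of the first block, and the remaining two give the powers of z and
  \<open>ti 0\<close>.\<close>

lemma ex_inj: "inj ex"
proof (rule injI)
  fix x y assume eq: "ex x = ex y"
  obtain \<alpha> \<beta> e e' \<alpha>' \<beta>' d d' where xy: "x = (\<alpha>, \<beta>, e, e')" "y = (\<alpha>', \<beta>', d, d')" by (cases x; cases y) auto
  have 1: "e' = d'" using eq by (simp add: ex_def xy u_def v_def)
  have 2: "e = d" using eq by (simp add: ex_def xy u_def v_def 1)
  show "x = y" using eq by (simp add: ex_def xy 1 2)
qed

lemma \<Theta>_blk1: "\<Theta> (L.blk (xv vx) ti a e) = mono_at (u e)"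
  using a_pos
proof (cases rule: L.blk_cases[of a e])
  case (nonneg n)
  have "\<Theta> (L.blk (xv vx) ti a e) = mono_at (1, 0, 0, 0) ^ n"
    unfolding nonneg L.blk_nonneg by (simp add: \<Theta>.hom_power \<Theta>_xv)
  also have "\<dots> = mono_at (u e)" unfolding mono_at_power by (simp add: u_def neg_def nonneg)
  finally show ?thesis .
next
  case (neg n i)
  have "u (- int (n * a + i)) = (- (int n * int a), 0, int n * int a, int n) + pt i" for n
  proof (induction n)
    case 0
    then show ?case using pt_u[OF neg(1,2)] by (simp add: zero_prod_def[symmetric])
  next
    case (Suc n)
    have "- int (Suc n * a + i) = - int (n * a + i) - int a" by simp
    then have "u (- int (Suc n * a + i)) = u (- int (n * a + i) - int a)" by (rule arg_cong)
    also have "\<dots> = u (- int a) + u (- int (n * a + i))" by (rule u_down) (simp del: of_nat_add of_nat_mult)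
    also have "u (- int a) = (- int a, 0, int a, 1)" using pt_u[of a] a_pos by (simp add: pt_def)
    finally show ?case unfolding Suc by (cases "pt i") (simp add: algebra_simps)
  qed
  moreover have "\<Theta> (L.blk (xv vx) ti a e) = mono_at (pt a) ^ n * mono_at (pt i)"
    unfolding neg(3) L.blk_neg[OF neg(1,2)] using neg by (simp add: \<Theta>.hom_mult \<Theta>.hom_power \<Theta>_ti)
  moreover have "mono_at (pt a) ^ n = (mono_at (- (int n * int a), 0, int n * int a, int n) :: int4 \<Rightarrow>\<^sub>0 'k)"
    by (simp add: pt_def mono_at_power)
  ultimately show ?thesis by (simp add: neg(3) mult_single)
qed

lemma \<Theta>_blk2: "\<Theta> (L.blk (xv vy) (\<lambda>j. ti (a + j)) b e) = mono_at (v e)"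
  using b_pos
proof (cases rule: L.blk_cases[of b e])
  case (nonneg n)
  have "\<Theta> (L.blk (xv vy) (\<lambda>j. ti (a + j)) b e) = mono_at (0, 1, 0, 0) ^ n"
    unfolding nonneg L.blk_nonneg by (simp add: \<Theta>.hom_power \<Theta>_xv)
  also have "\<dots> = mono_at (v e)" unfolding mono_at_power by (simp add: v_def neg_def nonneg)
  finally show ?thesis .
next
  case (neg n i)
  have "v (- int (n * b + i)) = (- (int n * int a), - (int n * int b), int n * int (a + b), int n) + pt (a + i)" for n
  proof (induction n)
    case 0
    then show ?case using pt_v[OF neg(1,2)] by (simp add: zero_prod_def[symmetric])
  next
    case (Suc n)
    have "- int (Suc n * b + i) = - int (n * b + i) - int b" by simp
    then have "v (- int (Suc n * b + i)) = v (- int (n * b + i) - int b)" by (rule arg_cong)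
    also have "\<dots> = v (- int b) + v (- int (n * b + i))" by (rule v_down) (simp del: of_nat_add of_nat_mult)
    also have "v (- int b) = (- int a, - int b, int (a + b), 1)" using pt_v[of b] b_pos by (simp add: pt_def)
    finally show ?case unfolding Suc by (cases "pt (a + i)") (simp add: algebra_simps)
  qed
  moreover have "\<Theta> (L.blk (xv vy) (\<lambda>j. ti (a + j)) b e) = mono_at (pt (a + b)) ^ n * mono_at (pt (a + i))"
    unfolding neg(3) L.blk_neg[OF neg(1,2)] using neg by (simp add: \<Theta>.hom_mult \<Theta>.hom_power \<Theta>_ti)
  moreover have "mono_at (pt (a + b)) ^ n = (mono_at (- (int n * int a), - (int n * int b), int n * int (a + b), int n) :: int4 \<Rightarrow>\<^sub>0 'k)"
    by (simp add: pt_def mono_at_power)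
  ultimately show ?thesis by (simp add: neg(3) mult_single)
qed

lemma \<Theta>_st: "\<Theta> (st x) = mono_at (ex x)"
proof -
  obtain \<alpha> \<beta> e e' where x: "x = (\<alpha>, \<beta>, e, e')" by (cases x) auto
  show ?thesis
    by (simp add: x st_def ex_def \<Theta>.hom_mult \<Theta>.hom_power \<Theta>_blk1 \<Theta>_blk2 \<Theta>_xv \<Theta>_ti pt_0 mono_at_power mult_single)
qed

lemma blk_Car: "L.blk (xv w) t m e \<in> Car" if "\<And>i. t i \<in> Car"
  unfolding L.blk_def using that by (auto intro!: Car.mult_mem Car.power_mem)

lemma st_Car [simp]: "st x \<in> Car"
  by (cases x) (auto simp: st_def intro!: Car.mult_mem Car.power_mem blk_Car)

lemma st_xv_z: "xv vz * st (\<alpha>, \<beta>, e, e') = st (Suc \<alpha>, \<beta>, e, e')"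
  by (simp add: st_def mult.assoc)

lemma st_block1:
  assumes c: "c = xv vx \<or> (\<exists>i\<le>a. c = ti i)"
  shows "\<exists>y. L.cong (c * st x) (st y)"
proof -
  obtain \<alpha> \<beta> e e' where x: "x = (\<alpha>, \<beta>, e, e')" by (cases x) auto
  have "\<exists>\<alpha>' \<beta>' d. L.cong (c * L.blk (xv vx) ti a e) (xv vz ^ \<alpha>' * ti 0 ^ \<beta>' * L.blk (xv vx) ti a d)"
  proof (rule L.block_straighten[OF a_pos])
    show "L.cong (xv vz * ti i) (xv vx * ti (Suc i))" if "i < a" for i
      using rel_linear[of i] that by (simp add: cvar_def)
    show "L.cong (ti i * ti j) (ti k * ti n)" if "i + j = k + n" "i \<le> a" "j \<le> a" "k \<le> a" "n \<le> a" for i j k n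
      by (rule rel_quadratic) (use that in auto)
  qed (use c in auto)
  then obtain \<alpha>' \<beta>' d where *: "L.cong (c * L.blk (xv vx) ti a e) (xv vz ^ \<alpha>' * ti 0 ^ \<beta>' * L.blk (xv vx) ti a d)" by blast
  let ?r = "xv vz ^ \<alpha> * ti 0 ^ \<beta> * L.blk (xv vy) (\<lambda>j. ti (a + j)) b e'"
  have "?r \<in> Car" by (intro Car.mult_mem Car.power_mem blk_Car) auto
  from L.cong_mult[OF * this] have "L.cong (c * st x) (st (\<alpha> + \<alpha>', \<beta> + \<beta>', d, e'))"
    by (simp add: x st_def power_add algebra_simps)
  then show ?thesis by blast
qed

text \<open>Straightening the second block emits powers of z and of its own initial generator, which
  is \<open>ti a\<close>. The latter belongs to the first block as well and is absorbed by
  straightening there.\<close>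

lemma st_coefficients: "\<exists>y. L.cong (xv vz ^ \<alpha> * ti a ^ \<beta> * st x) (st y)"
proof (induction \<alpha>)
  case 0
  show ?case
  proof (induction \<beta>)
    case 0
    then show ?case by (intro exI[of _ x]) simp
  next
    case (Suc \<beta>)
    then obtain y where y: "L.cong (xv vz ^ 0 * ti a ^ \<beta> * st x) (st y)" by blast
    obtain y' where y': "L.cong (ti a * st y) (st y')" using st_block1[of "ti a" y] by blast
    have "L.cong (ti a * (xv vz ^ 0 * ti a ^ \<beta> * st x)) (ti a * st y)" by (rule L.cong_mult[OF y ti_Car])
    from L.cong_trans[OF this y'] show ?case by (intro exI[of _ y']) (simp add: mult.assoc)
  qed
next
  case (Suc \<alpha>)
  then obtain y where y: "L.cong (xv vz ^ \<alpha> * ti a ^ \<beta> * st x) (st y)" by blast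
  obtain y' where y': "xv vz * st y = st y'" using st_xv_z by (cases y) blast
  have "L.cong (xv vz * (xv vz ^ \<alpha> * ti a ^ \<beta> * st x)) (xv vz * st y)" by (rule L.cong_mult[OF y xv_Car])
  then show ?case unfolding y' by (intro exI[of _ y']) (simp add: mult.assoc)
qed

lemma st_block2:
  assumes c: "c = xv vy \<or> (\<exists>i\<le>b. c = ti (a + i))"
  shows "\<exists>y. L.cong (c * st x) (st y)"
proof -
  let ?t = "\<lambda>j. ti (a + j)"
  obtain \<alpha> \<beta> e e' where x: "x = (\<alpha>, \<beta>, e, e')" by (cases x) auto
  have "\<exists>\<alpha>' \<beta>' d. L.cong (c * L.blk (xv vy) ?t b e') (xv vz ^ \<alpha>' * ?t 0 ^ \<beta>' * L.blk (xv vy) ?t b d)"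
  proof (rule L.block_straighten[OF b_pos])
    show "L.cong (xv vz * ti (a + i)) (xv vy * ti (a + Suc i))" if "i < b" for i
      using rel_linear[of "a + i"] that by (simp add: cvar_def)
    show "L.cong (ti (a + i) * ti (a + j)) (ti (a + k) * ti (a + n))"
      if "i + j = k + n" "i \<le> b" "j \<le> b" "k \<le> b" "n \<le> b" for i j k n
      by (rule rel_quadratic) (use that in auto)
  qed (use c in auto)
  then obtain \<alpha>' \<beta>' d where *: "L.cong (c * L.blk (xv vy) ?t b e') (xv vz ^ \<alpha>' * ti a ^ \<beta>' * L.blk (xv vy) ?t b d)" by auto
  let ?r = "xv vz ^ \<alpha> * ti 0 ^ \<beta> * L.blk (xv vx) ti a e"
  have "?r \<in> Car" by (intro Car.mult_mem Car.power_mem blk_Car) auto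
  from L.cong_mult[OF * this] have 1: "L.cong (c * st x) (xv vz ^ \<alpha>' * ti a ^ \<beta>' * st (\<alpha>, \<beta>, e, d))"
    by (simp add: x st_def algebra_simps)
  obtain y where "L.cong (xv vz ^ \<alpha>' * ti a ^ \<beta>' * st (\<alpha>, \<beta>, e, d)) (st y)" using st_coefficients by blast
  from L.cong_trans[OF 1 this] show ?thesis by blast
qed

section \<open>Spanning and independence of the standard monomials\<close>

definition \<Xi> :: "(nat \<times> nat \<times> int \<times> int \<Rightarrow>\<^sub>0 'k) \<Rightarrow> (nat, (xyz, 'k) mpoly) mpoly" where
  "\<Xi> m = (\<Sum>x\<in>Poly_Mapping.keys m. kk (Poly_Mapping.lookup m x) * st x)"

lemma kk_0 [simp]: "kk 0 = 0" and kk_1 [simp]: "kk 1 = 1" and kk_add: "kk (c + d) = kk c + kk d" and kk_mult: "kk (c * d) = kk c * kk d"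
  by (simp_all add: kk_def Const_add Const_mult)

lemma \<Xi>_add: "\<Xi> (m + m') = \<Xi> m + \<Xi> m'"
  unfolding \<Xi>_def by (rule sum_keys_add) (auto simp: kk_add distrib_right)

lemma \<Xi>_single: "\<Xi> (Poly_Mapping.single x c) = kk c * st x"
  by (simp add: \<Xi>_def)

lemma \<Xi>_0: "\<Xi> 0 = 0"
  by (simp add: \<Xi>_def)

lemma \<Xi>_sum: "(\<Sum>y\<in>Y. \<Xi> (F y)) = \<Xi> (sum F Y)"
  by (induction Y rule: infinite_finite_induct) (auto simp: \<Xi>_add \<Xi>_0)

lemma \<Xi>_eq_0:
  assumes "\<Theta> (\<Xi> m) = 0" shows "m = 0"
proof (rule poly_mapping_eqI)
  fix x
  have "\<Theta> (\<Xi> m) = (\<Sum>y\<in>Poly_Mapping.keys m. Poly_Mapping.single (ex y) (Poly_Mapping.lookup m y))"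
    unfolding \<Xi>_def
    by (subst \<Theta>.hom_sum, rule sum.cong[OF refl], subst \<Theta>.hom_mult, subst \<Theta>_kk, subst \<Theta>_st, subst mult_single) simp
  then have "0 = Poly_Mapping.lookup (\<Sum>y\<in>Poly_Mapping.keys m. Poly_Mapping.single (ex y) (Poly_Mapping.lookup m y)) (ex x)"
    using assms by simp
  also have "\<dots> = (\<Sum>y\<in>Poly_Mapping.keys m. Poly_Mapping.lookup (Poly_Mapping.single (ex y) (Poly_Mapping.lookup m y)) (ex x))"
    by (rule lookup_sum)
  also have "\<dots> = (\<Sum>y\<in>Poly_Mapping.keys m. if y = x then Poly_Mapping.lookup m y else 0)"
    by (rule sum.cong) (use ex_inj in \<open>auto simp: lookup_single when_def dest: injD\<close>)
  also have "\<dots> = Poly_Mapping.lookup m x" by (simp add: in_keys_iff)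
  finally show "Poly_Mapping.lookup m x = Poly_Mapping.lookup 0 x" by simp
qed

text \<open>The multipliers that preserve, modulo \<open>L\<close>, the span of the standard
  monomials over the ground field. They form a subring, so it suffices to test generators; applied
  to the standard monomial 1 this yields a normal form for every element.\<close>

definition stable :: "(nat, (xyz, 'k) mpoly) mpoly set" where
  "stable = {c \<in> Car. \<forall>m. \<exists>m'. L.cong (c * \<Xi> m) (\<Xi> m')}"

lemma stableI:
  assumes c: "c \<in> Car" and st: "\<And>x. \<exists>m'. L.cong (c * st x) (\<Xi> m')"
  shows "c \<in> stable"
proof -
  obtain F where F: "\<And>x. L.cong (c * st x) (\<Xi> (F x))" using st by metis
  have kk: "\<exists>m'. kk d * \<Xi> m = \<Xi> m'" for d m
  proof -
    have "kk d * \<Xi> m = (\<Sum>x\<in>Poly_Mapping.keys m. \<Xi> (Poly_Mapping.single x (d * Poly_Mapping.lookup m x)))"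
      by (simp add: \<Xi>_def[of m] \<Xi>_single sum_distrib_left kk_mult mult.assoc)
    then show ?thesis unfolding \<Xi>_sum by blast
  qed
  have "\<exists>m'. L.cong (c * \<Xi> m) (\<Xi> m')" for m
  proof -
    have "\<forall>x. \<exists>m'. kk (Poly_Mapping.lookup m x) * \<Xi> (F x) = \<Xi> m'" using kk by blast
    then obtain G where G: "\<And>x. kk (Poly_Mapping.lookup m x) * \<Xi> (F x) = \<Xi> (G x)" by metis
    have "L.cong (\<Sum>x\<in>Poly_Mapping.keys m. kk (Poly_Mapping.lookup m x) * (c * st x))
        (\<Sum>x\<in>Poly_Mapping.keys m. kk (Poly_Mapping.lookup m x) * \<Xi> (F x))"
      by (intro L.cong_sum L.cong_mult F kk_Car)
    then have "L.cong (c * \<Xi> m) (\<Xi> (sum G (Poly_Mapping.keys m)))"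
      by (simp add: \<Xi>_def[of m] sum_distrib_left mult.left_commute G \<Xi>_sum)
    then show ?thesis by blast
  qed
  then show ?thesis using c by (simp add: stable_def)
qed

lemma kk_stable: "kk d \<in> stable"
  by (rule stableI) (auto simp: \<Xi>_single[symmetric] intro: L.cong_refl)

lemma subr_stable: "subr stable"
proof -
  have add: "c + d \<in> stable" if cd: "c \<in> stable" "d \<in> stable" for c d
  proof -
    have "\<exists>m'. L.cong ((c + d) * \<Xi> m) (\<Xi> m')" for m
    proof -
      obtain m1 m2 where "L.cong (c * \<Xi> m) (\<Xi> m1)" "L.cong (d * \<Xi> m) (\<Xi> m2)"
        using cd unfolding stable_def by blast
      from L.cong_add[OF this] have "L.cong ((c + d) * \<Xi> m) (\<Xi> (m1 + m2))" by (simp add: distrib_right \<Xi>_add)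
      then show ?thesis by blast
    qed
    then show ?thesis using cd by (simp add: stable_def)
  qed
  have mult: "c * d \<in> stable" if cd: "c \<in> stable" "d \<in> stable" for c d
  proof -
    have "\<exists>m'. L.cong (c * d * \<Xi> m) (\<Xi> m')" for m
    proof -
      obtain m1 where m1: "L.cong (d * \<Xi> m) (\<Xi> m1)" using cd unfolding stable_def by blast
      obtain m2 where m2: "L.cong (c * \<Xi> m1) (\<Xi> m2)" using cd unfolding stable_def by blast
      have "c \<in> Car" using cd by (simp add: stable_def)
      from L.cong_trans[OF L.cong_mult[OF m1 this] m2] show ?thesis by (auto simp: mult.assoc)
    qed
    then show ?thesis using cd by (simp add: stable_def)
  qed
  have one: "1 \<in> stable" using kk_stable[of 1] by simp
  have "kk (- 1) = - 1" using kk_add[of 1 "- 1"] by (simp add: eq_neg_iff_add_eq_0 add.commute)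
  then have "- c \<in> stable" if "c \<in> stable" for c
    using mult[OF kk_stable[of "- 1"] that] by simp
  then show ?thesis using add mult one by unfold_locales
qed

lemma L_stable: "c \<in> L \<Longrightarrow> c \<in> stable"
proof (rule stableI)
  assume c: "c \<in> L"
  then show "c \<in> Car" using L.J_subset by auto
  show "\<exists>m'. L.cong (c * st x) (\<Xi> m')" for x
    by (rule exI[of _ 0]) (use c in \<open>simp add: L.cong_def \<Xi>_0\<close>)
qed

lemma stable_of_st: "c \<in> Car \<Longrightarrow> (\<And>x. \<exists>y. L.cong (c * st x) (st y)) \<Longrightarrow> c \<in> stable"
proof (rule stableI)
  fix x assume "\<And>x. \<exists>y. L.cong (c * st x) (st y)"
  then obtain y where "L.cong (c * st x) (st y)" by blast
  then have "L.cong (c * st x) (\<Xi> (Poly_Mapping.single y 1))" by (simp add: \<Xi>_single)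
  then show "\<exists>m'. L.cong (c * st x) (\<Xi> m')" by blast
qed

lemma xv_stable: "xv w \<in> stable"
proof (rule stable_of_st)
  show "\<exists>y. L.cong (xv w * st x) (st y)" for x
  proof (cases w)
    case vz
    obtain y where "xv vz * st x = st y" using st_xv_z by (cases x) blast
    then show ?thesis unfolding vz by (intro exI[of _ y]) (simp add: L.cong_refl)
  next
    case vx
    show ?thesis unfolding vx by (rule st_block1) simp
  next
    case vy
    show ?thesis unfolding vy by (rule st_block2) simp
  qed
qed simp

lemma ti_stable: "i \<le> a + b \<Longrightarrow> ti i \<in> stable"
proof (rule stable_of_st)
  assume i: "i \<le> a + b"
  show "\<exists>y. L.cong (ti i * st x) (st y)" for x
  proof (cases "i \<le> a")
    case True
    show ?thesis by (rule st_block1) (use True in auto)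
  next
    case False
    with i have "ti i = ti (a + (i - a))" "i - a \<le> b" by auto
    then have "\<exists>j\<le>b. ti i = ti (a + j)" by blast
    then show ?thesis by (intro st_block2 disjI2)
  qed
qed simp

text \<open>The multipliers known so far are the new coordinates \<open>\<tau> (Var w)\<close>. The
  generation argument therefore runs in the target of \<open>\<sigma>\<close>, where these are the
  variables, and is pulled back.\<close>

lemma Const_stable: "Const r \<in> stable"
proof -
  interpret S: subr stable by (rule subr_stable)
  have \<tau>_hom: "\<tau> 1 = 1" "\<tau> (- p) = - \<tau> p" "\<tau> (p + q) = \<tau> p + \<tau> q" "\<tau> (p * q) = \<tau> p * \<tau> q" for p q
    by (rule \<sigma>_inj, simp add: \<sigma>.hom_add \<sigma>.hom_mult \<sigma>.hom_uminus)+
  interpret K: comm_ring_hom "Const :: (xyz, 'k) mpoly \<Rightarrow> (nat, (xyz, 'k) mpoly) mpoly" by (rule comm_ring_hom_Const)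
  have "subr {r. Const (\<tau> r) \<in> stable}"
    by unfold_locales (auto simp: \<tau>_hom K.hom_uminus Const_add Const_mult)
  moreover have "Const c \<in> {r. Const (\<tau> r) \<in> stable}" for c
  proof -
    have "\<tau> (Const c) = Const c" by (rule \<sigma>_inj) simp
    then show ?thesis using kk_stable[of c] by (simp add: kk_def)
  qed
  moreover have "Var w \<in> {r. Const (\<tau> r) \<in> stable}" for w
    using xv_stable[of w] by (simp add: xv_def)
  ultimately have "\<sigma> r \<in> {r. Const (\<tau> r) \<in> stable}"
    by (rule mpoly_generated[where V = UNIV]) auto
  then show ?thesis by simp
qed

lemma Car_stable: "p \<in> Car \<Longrightarrow> p \<in> stable"
proof (rule mpoly_generated[OF subr_stable Const_stable, where V = "{..<N}"])
  interpret S: subr stable by (rule subr_stable)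
  fix j assume "j \<in> {..<N}"
  then obtain c where c: "L.cong (Var j) (\<Sum>i\<le>a + b. Const (c i) * ti i)" using Var_span by auto
  then have "Var j - (\<Sum>i\<le>a + b. Const (c i) * ti i) \<in> stable"
    by (intro L_stable) (simp add: L.cong_def)
  moreover have "(\<Sum>i\<le>a + b. Const (c i) * ti i) \<in> stable"
    using ti_stable by (intro S.sum_mem S.mult_mem Const_stable) auto
  ultimately have "(Var j - (\<Sum>i\<le>a + b. Const (c i) * ti i)) + (\<Sum>i\<le>a + b. Const (c i) * ti i) \<in> stable"
    by (rule S.add_mem)
  then show "Var j \<in> stable" by simp
qed (auto simp: Car_def)

text \<open>An element of the kernel is congruent modulo \<open>L\<close> to a combination of
  standard monomials. Its image under \<open>\<Theta>\<close> is zero, while standard monomials have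
  distinct exponents; so the combination is empty.\<close>

theorem rees_ideal_L: "rees_ideal f = L"
proof
  show "L \<subseteq> rees_ideal f" using L_subset by (simp add: rees_ideal_eq)
  show "rees_ideal f \<subseteq> L"
  proof
    fix p assume "p \<in> rees_ideal f"
    then have p: "p \<in> Car" "E p = 0" by (simp_all add: rees_ideal_eq)
    have "st (0, 0, 0, 0) = 1" by (simp add: st_def L.blk_def)
    then have 1: "\<Xi> (Poly_Mapping.single (0, 0, 0, 0) 1) = 1" by (simp add: \<Xi>_single)
    obtain m where m: "L.cong (p * \<Xi> (Poly_Mapping.single (0, 0, 0, 0) 1)) (\<Xi> m)"
      using Car_stable[OF p(1)] unfolding stable_def by blast
    then have "p - \<Xi> m \<in> L" by (simp add: 1 L.cong_def)
    then have "E (p - \<Xi> m) = 0" using L_subset by blast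
    then have "\<Theta> (\<Xi> m) = 0" using p(2) by (simp add: E.hom_minus \<Theta>_def)
    then have "m = 0" by (rule \<Xi>_eq_0)
    then show "p \<in> L" using \<open>p - \<Xi> m \<in> L\<close> by (simp add: \<Xi>_0)
  qed
qed

end

theorem rees_setup_fiber_type:
  assumes "rees_setup a b I l g" shows "fiber_type I"
  unfolding fiber_type_def
proof (intro allI impI, elim conjE)
  fix f \<phi> assume f: "minimal_generators I f" "syzygy_matrix f \<phi>"
  interpret presentation a b I l g f \<phi>
    using assms f by (simp add: presentation_def presentation_axioms_def)
  show "rees_ideal f = Idl\<^bsub>mpoly_ring (dim_vec f)\<^esub>
      ({(\<Sum>i<dim_vec f. Var i * Const (\<phi> $$ (i, j))) | j. j < dim_col \<phi>} \<union> Poly_Mapping.map Const ` fiber_ideal f)"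
    unfolding rees_ideal_L L_def rels_def N_def[symmetric] mpoly_ring_Car Car.Idl_ring_on ..
qed

theorem theorem4p13:
  fixes I :: "(xyz, 'k::alg_closed_field) mpoly set"
    and n :: nat
    and c :: "xyz list"
  assumes "ideal I ring_of_type_algebra"
    and "minimally_generated_by_monomials I n (n - 1)"
    and "linearly_presented I"
    and "ideal_height ring_of_type_algebra I = 2"
    and "perfect_ideal I"
    and "card (minimal_primes (ring_of_type_algebra Quot I)) = 2"
    and "length c = n - 1"
    and "basic_entry_sequence I c"
    and "separating c"
  shows "Cohen_Macaulay (special_fiber I) \<and>
    (Cohen_Macaulay (rees_algebra I) \<and> fiber_type I)"
proof -
  obtain a b where ab: "a \<ge> 1" "b \<ge> 1" and c: "c = replicate a vx @ replicate b vy"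
    using assms(9) unfolding separating_def by blast
  interpret two_blocks a b using ab by unfold_locales
  \<comment> \<open>The number of entries equals the degree of the monomials, which is what the
    degree argument for the left kernel needs.\<close>
  have "n - 1 = a + b" using assms(7) c by simp
  then have "deg_gens I (a + b)" using deg_gens_monomials[OF assms(2)] by simp
  moreover have "basic_entry_sequence I entries" using assms(8) c by (simp add: entries_def)
  ultimately obtain l g where "rees_setup a b I l g"
    using reduction[of I] two_blocks_axioms unfolding rees_setup_def rees_setup_axioms_def by metis
  then show ?thesis using rees_setup_Cohen_Macaulay rees_setup_fiber_type by blast
qed

end
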